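(* There exists an $O(n^3)$-time algorithm that, given a graphic sequence $d=(d_1,\ldots,d_n)$, constructs a graph realizing $d$ that has a dominating set of minimum size among all realizations of $d$ (i.e., of size $\textsc{MDS}(d)$).
   Context: A sequence $d=(d_1,\ldots,d_n)$ is a non-increasing sequence of positive integers. A simple undirected graph $G$ on vertices $1,\ldots,n$ realizes $d$ if $\deg_G(i)=d_i$ for all $i$; $d$ is graphic if some graph realizes it. A dominating set of $G$ is a vertex set $D$ such that every vertex not in $D$ has a neighbour in $D$; $\textsc{MDS}(d)$ is the minimum, over all realizations $G$ of $d$, of the minimum size of a dominating set of $G$. *)

theory Defs
  imports Complex_Main "HOL-Library.Landau_Symbols"
begin

section \<open>Graphs, realizations and domination\<close>

text \<open>A sequence of length \<open>n\<close> is a list indexed from \<open>0\<close>, and accordingly the vertices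
  are \<open>0, \<dots>, n - 1\<close> rather than \<open>1, \<dots>, n\<close>.\<close>

definition degree_sequence :: "nat list \<Rightarrow> bool" where
  "degree_sequence d \<longleftrightarrow> sorted_wrt (\<ge>) d \<and> (\<forall>x\<in>set d. 0 < x)"

definition simple_graph :: "nat \<Rightarrow> nat set set \<Rightarrow> bool" where
  "simple_graph n E \<longleftrightarrow> (\<forall>e\<in>E. e \<subseteq> {..<n} \<and> card e = 2)"

definition degree :: "nat set set \<Rightarrow> nat \<Rightarrow> nat" where
  "degree E v = card {u. {u, v} \<in> E}"

definition realizes :: "nat set set \<Rightarrow> nat list \<Rightarrow> bool" where
  "realizes E d \<longleftrightarrow> simple_graph (length d) E \<and> (\<forall>i<length d. degree E i = d ! i)"

definition graphic :: "nat list \<Rightarrow> bool" where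
  "graphic d \<longleftrightarrow> (\<exists>E. realizes E d)"

definition dominating_set :: "nat \<Rightarrow> nat set set \<Rightarrow> nat set \<Rightarrow> bool" where
  "dominating_set n E D \<longleftrightarrow> D \<subseteq> {..<n} \<and> (\<forall>v\<in>{..<n} - D. \<exists>u\<in>D. {u, v} \<in> E)"

definition domination_number :: "nat \<Rightarrow> nat set set \<Rightarrow> nat" where
  "domination_number n E = (INF D\<in>{D. dominating_set n E D}. card D)"

text \<open>Both infima are over natural numbers, hence attained whenever the index set is nonempty.
  For the dominating sets this always holds; for the realizations it holds iff \<open>d\<close> is graphic.\<close>

definition MDS :: "nat list \<Rightarrow> nat" where
  "MDS d = (INF E\<in>{E. realizes E d}. domination_number (length d) E)"

section \<open>Algorithms and their running time\<close>

text \<open>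
  Algorithms are programs of a structured word RAM: finitely many scalar registers and arrays
  (named by numbers), unit-cost arithmetic, comparison and memory access, and the usual control
  flow. The parameter \<open>W\<close> of the semantics is the largest number that fits into a machine word:
  a step that involves a larger value (including array indices) has no successor state, so unit
  cost is only ever charged for operations on words. A program has no means of reading \<open>W\<close>.
\<close>

datatype exp =
    Const nat
  | Reg nat
  | Load nat exp
  | Plus exp exp
  | Minus exp exp
  | Times exp exp

datatype bexp =
    Less exp exp
  | Equal exp exp
  | Neg bexp
  | Conj bexp bexp

datatype com =
    Skip
  | Assign nat exp
  | Store nat exp exp
  | Seq com com
  | Cond bexp com com
  | While bexp com

record state =
  regs :: "nat \<Rightarrow> nat"
  arrs :: "nat \<Rightarrow> nat \<Rightarrow> nat"

text \<open>\<open>Minus\<close> is truncated subtraction.\<close>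

primrec eval :: "exp \<Rightarrow> state \<Rightarrow> nat" where
  "eval (Const k) s = k"
| "eval (Reg x) s = regs s x"
| "eval (Load a e) s = arrs s a (eval e s)"
| "eval (Plus e f) s = eval e s + eval f s"
| "eval (Minus e f) s = eval e s - eval f s"
| "eval (Times e f) s = eval e s * eval f s"

primrec fits :: "nat \<Rightarrow> exp \<Rightarrow> state \<Rightarrow> bool" where
  "fits W (Const k) s \<longleftrightarrow> k \<le> W"
| "fits W (Reg x) s \<longleftrightarrow> regs s x \<le> W"
| "fits W (Load a e) s \<longleftrightarrow> fits W e s \<and> arrs s a (eval e s) \<le> W"
| "fits W (Plus e f) s \<longleftrightarrow> fits W e s \<and> fits W f s \<and> eval e s + eval f s \<le> W"
| "fits W (Minus e f) s \<longleftrightarrow> fits W e s \<and> fits W f s"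
| "fits W (Times e f) s \<longleftrightarrow> fits W e s \<and> fits W f s \<and> eval e s * eval f s \<le> W"

primrec cost :: "exp \<Rightarrow> nat" where
  "cost (Const k) = 1"
| "cost (Reg x) = 1"
| "cost (Load a e) = 1 + cost e"
| "cost (Plus e f) = 1 + cost e + cost f"
| "cost (Minus e f) = 1 + cost e + cost f"
| "cost (Times e f) = 1 + cost e + cost f"

primrec beval :: "bexp \<Rightarrow> state \<Rightarrow> bool" where
  "beval (Less e f) s \<longleftrightarrow> eval e s < eval f s"
| "beval (Equal e f) s \<longleftrightarrow> eval e s = eval f s"
| "beval (Neg b) s \<longleftrightarrow> \<not> beval b s"
| "beval (Conj b c) s \<longleftrightarrow> beval b s \<and> beval c s"

text \<open>\<open>Conj\<close> is evaluated strictly: both conjuncts have to fit and both are charged.\<close>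

primrec bfits :: "nat \<Rightarrow> bexp \<Rightarrow> state \<Rightarrow> bool" where
  "bfits W (Less e f) s \<longleftrightarrow> fits W e s \<and> fits W f s"
| "bfits W (Equal e f) s \<longleftrightarrow> fits W e s \<and> fits W f s"
| "bfits W (Neg b) s \<longleftrightarrow> bfits W b s"
| "bfits W (Conj b c) s \<longleftrightarrow> bfits W b s \<and> bfits W c s"

primrec bcost :: "bexp \<Rightarrow> nat" where
  "bcost (Less e f) = 1 + cost e + cost f"
| "bcost (Equal e f) = 1 + cost e + cost f"
| "bcost (Neg b) = 1 + bcost b"
| "bcost (Conj b c) = 1 + bcost b + bcost c"

text \<open>\<open>exec W c s t s'\<close>: on words bounded by \<open>W\<close>, program \<open>c\<close> started in \<open>s\<close> terminates in \<open>s'\<close>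
  after exactly \<open>t\<close> unit steps.\<close>

inductive exec :: "nat \<Rightarrow> com \<Rightarrow> state \<Rightarrow> nat \<Rightarrow> state \<Rightarrow> bool" for W :: nat where
  Skip: "exec W Skip s 1 s"
| Assign: "fits W e s \<Longrightarrow>
    exec W (Assign x e) s (1 + cost e) (s\<lparr>regs := (regs s)(x := eval e s)\<rparr>)"
| Store: "fits W i s \<Longrightarrow> fits W e s \<Longrightarrow>
    exec W (Store a i e) s (1 + cost i + cost e)
      (s\<lparr>arrs := (arrs s)(a := (arrs s a)(eval i s := eval e s))\<rparr>)"
| Seq: "exec W c\<^sub>1 s t\<^sub>1 s' \<Longrightarrow> exec W c\<^sub>2 s' t\<^sub>2 s'' \<Longrightarrow> exec W (Seq c\<^sub>1 c\<^sub>2) s (t\<^sub>1 + t\<^sub>2) s''"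
| CondTrue: "bfits W b s \<Longrightarrow> beval b s \<Longrightarrow> exec W c\<^sub>1 s t s' \<Longrightarrow>
    exec W (Cond b c\<^sub>1 c\<^sub>2) s (1 + bcost b + t) s'"
| CondFalse: "bfits W b s \<Longrightarrow> \<not> beval b s \<Longrightarrow> exec W c\<^sub>2 s t s' \<Longrightarrow>
    exec W (Cond b c\<^sub>1 c\<^sub>2) s (1 + bcost b + t) s'"
| WhileFalse: "bfits W b s \<Longrightarrow> \<not> beval b s \<Longrightarrow> exec W (While b c) s (1 + bcost b) s"
| WhileTrue: "bfits W b s \<Longrightarrow> beval b s \<Longrightarrow> exec W c s t\<^sub>1 s' \<Longrightarrow> exec W (While b c) s' t\<^sub>2 s'' \<Longrightarrow>
    exec W (While b c) s (1 + bcost b + t\<^sub>1 + t\<^sub>2) s''"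

inductive_cases exec_SkipE: "exec W Skip s t s'"
inductive_cases exec_AssignE: "exec W (Assign x e) s t s'"
inductive_cases exec_StoreE: "exec W (Store a i e) s t s'"
inductive_cases exec_SeqE: "exec W (Seq c\<^sub>1 c\<^sub>2) s t s'"
inductive_cases exec_CondE: "exec W (Cond b c\<^sub>1 c\<^sub>2) s t s'"
inductive_cases exec_WhileE: "exec W (While b c) s t s'"

lemma exec_deterministic:
  "exec W c s t s' \<Longrightarrow> exec W c s u s'' \<Longrightarrow> u = t \<and> s'' = s'"
proof (induction arbitrary: u s'' rule: exec.induct)
  case (Skip s)
  from Skip.prems show ?case by (rule exec_SkipE) simp
next
  case (Assign e s x)
  from Assign.prems show ?case by (rule exec_AssignE) simp
next
  case (Store i s e a)
  from Store.prems show ?case by (rule exec_StoreE) simp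
next
  case (Seq c\<^sub>1 s t\<^sub>1 s' c\<^sub>2 t\<^sub>2 r)
  from Seq.prems obtain u\<^sub>1 q u\<^sub>2
    where u: "u = u\<^sub>1 + u\<^sub>2" "exec W c\<^sub>1 s u\<^sub>1 q" "exec W c\<^sub>2 q u\<^sub>2 s''"
    by (rule exec_SeqE)
  from Seq.IH(1)[OF u(2)] u(3) have "exec W c\<^sub>2 s' u\<^sub>2 s''" by simp
  from Seq.IH(2)[OF this] Seq.IH(1)[OF u(2)] u(1) show ?case by simp
next
  case (CondTrue b s c\<^sub>1 t s' c\<^sub>2)
  from CondTrue.prems show ?case
    by (rule exec_CondE) (use CondTrue.hyps(2) in \<open>auto dest: CondTrue.IH\<close>)
next
  case (CondFalse b s c\<^sub>2 t s' c\<^sub>1)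
  from CondFalse.prems show ?case
    by (rule exec_CondE) (use CondFalse.hyps(2) in \<open>auto dest: CondFalse.IH\<close>)
next
  case (WhileFalse b s c)
  from WhileFalse.prems show ?case
    by (rule exec_WhileE) (use WhileFalse.hyps(2) in simp_all)
next
  case (WhileTrue b s c t\<^sub>1 s' t\<^sub>2 r)
  from WhileTrue.prems obtain u\<^sub>1 q u\<^sub>2
    where u: "u = Suc (bcost b + u\<^sub>1 + u\<^sub>2)" "exec W c s u\<^sub>1 q" "exec W (While b c) q u\<^sub>2 s''"
    by (rule exec_WhileE) (use WhileTrue.hyps(2) in \<open>simp, metis\<close>)
  from WhileTrue.IH(1)[OF u(2)] u(3) have "exec W (While b c) s' u\<^sub>2 s''" by simp
  from WhileTrue.IH(2)[OF this] WhileTrue.IH(1)[OF u(2)] u(1) show ?case by simp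
qed

text \<open>Words of \<open>O(log n)\<close> bits, for inputs of length \<open>n\<close>.\<close>

definition max_word :: "nat \<Rightarrow> nat \<Rightarrow> nat" where
  "max_word k n = n ^ k + k"

text \<open>The input is the length of \<open>d\<close> in register 0 and the entries of \<open>d\<close> in array 0;
  all other memory is initially zero. The output is an adjacency matrix, stored row by row
  in array 1.\<close>

definition input_state :: "nat list \<Rightarrow> state" where
  "input_state d =
    \<lparr>regs = (\<lambda>x. if x = 0 then length d else 0),
     arrs = (\<lambda>a i. if a = 0 \<and> i < length d then d ! i else 0)\<rparr>"

definition outputs_graph :: "nat \<Rightarrow> state \<Rightarrow> nat set set \<Rightarrow> bool" where
  "outputs_graph n s E \<longleftrightarrow>
    simple_graph n E \<and>
    (\<forall>i<n. \<forall>j<n. arrs s 1 (i * n + j) = (if {i, j} \<in> E then 1 else 0))"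

end

theory Submission
  imports Defs
begin

text \<open>
  Exchange arguments show that some optimal dominating set consists of the \<open>k\<close> vertices
  \<open>D = {..<k}\<close> of largest degree. Let \<open>C\<close> be the other vertices and \<open>W \<subseteq> C\<close>. Every vertex of
  \<open>C - W\<close> needs an edge to \<open>D\<close>, so it offers at most \<open>f j - 1\<close> edges to \<open>W\<close> and takes one unit of
  the degrees of \<open>D\<close> away from \<open>W\<close>. Counting the edges at \<open>W\<close> gives two inequalities:
  condition A charges the edges to \<open>D\<close> against the total degree of \<open>D\<close>, condition B is the
  Erdos--Gallai bound. Conversely, a graphic sequence that satisfies both for all \<open>W\<close> has a
  realization dominated by \<open>D\<close>: in a realization with as few undominated vertices as possible,
  the vertices of \<open>C\<close> whose degree is at least that of a neighbour of an undominated vertex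
  violate one of them. Both are hardest for sets \<open>W\<close> of vertices of largest degree, hence the
  least \<open>k\<close> is found by testing \<open>O(n\<^sup>2)\<close> inequalities in linear time each.

  The graph is built as by Havel and Hakimi, with the largest remaining vertex of \<open>C\<close> as pivot.
  Its neighbours are chosen greedily, beginning with one in \<open>D\<close>. As long as condition A
  fails for what remains, the smallest neighbour in \<open>D\<close> is exchanged for the largest remaining
  vertex of \<open>C\<close>. A realization that agrees as far as possible with this choice
  can be switched into one that agrees completely; condition B takes care of itself. Each of
  the at most \<open>2 n\<close> tests and exchanges per pivot takes linear time. When \<open>C\<close> is exhausted, the rest
  is a graphic sequence on \<open>D\<close>.
\<close>

section \<open>Realizations and switching\<close>

text \<open>The set that violates a condition is only a part \<open>core\<close> of the set of large
  vertices (degree at least \<open>\<theta>\<close>): those missing another large vertex, and those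
  that \<open>u\<close> avoids without offering an edge for a profitable switch, are left out.
  Statements about neighbours of \<open>u\<close> carry over to all large vertices because a
  neighbour of least degree can be traded for any of them. Condition A fails if \<open>D\<close>
  wastes nothing, that is, if it has no inner edge and no second edge to a vertex of
  \<open>C\<close> outside the core; otherwise condition B fails.

  In the construction, condition A sees the degrees of \<open>D\<close> only through their sum, so
  moving a neighbour of the pivot from \<open>D\<close> to \<open>C\<close> can only help it, and a
  prefix inequality that holds once is never tested again for this pivot. In the exchanges the other
  way, condition B could break only if some vertex of \<open>C\<close> exceeded the pivot, which is
  why the pivot is the largest. Ties are broken towards the last index: then the residual degrees on
  \<open>C\<close> stay sorted and prefixes remain the hardest sets, without any sorting at run
  time.\<close>

definition nbrs :: "nat set set \<Rightarrow> nat \<Rightarrow> nat set" where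
  "nbrs E v = {u. {u, v} \<in> E}"

text \<open>The vertex set is arbitrary, unlike in \<open>simple_graph\<close>, because pivots are
  deleted one after the other; for the same reason degrees are prescribed by a function and not by a
  list.\<close>

definition graph_on :: "nat set \<Rightarrow> nat set set \<Rightarrow> bool" where
  "graph_on V E \<longleftrightarrow> finite V \<and> (\<forall>e\<in>E. e \<subseteq> V \<and> card e = 2)"

definition realization :: "nat set \<Rightarrow> nat set set \<Rightarrow> (nat \<Rightarrow> nat) \<Rightarrow> bool" where
  "realization V E f \<longleftrightarrow> graph_on V E \<and> (\<forall>v\<in>V. card (nbrs E v) = f v)"

lemma nbrs_iff: "u \<in> nbrs E v \<longleftrightarrow> {u, v} \<in> E"
  by (simp add: nbrs_def)

lemma nbrs_sym: "u \<in> nbrs E v \<longleftrightarrow> v \<in> nbrs E u"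
  by (simp add: nbrs_def insert_commute)

lemma graph_on_edge:
  assumes "graph_on V E" "{u, v} \<in> E"
  shows "u \<in> V" "v \<in> V" "u \<noteq> v"
proof -
  have "{u, v} \<subseteq> V" "card {u, v} = 2" using assms unfolding graph_on_def by blast+
  then show "u \<in> V" "v \<in> V" "u \<noteq> v" by auto
qed

lemma nbrs_subset: "graph_on V E \<Longrightarrow> nbrs E v \<subseteq> V"
  using graph_on_edge by (auto simp: nbrs_iff)

lemma nbrs_irrefl: "graph_on V E \<Longrightarrow> v \<notin> nbrs E v"
  using graph_on_edge(3) nbrs_iff by metis

lemma finite_nbrs: "graph_on V E \<Longrightarrow> finite (nbrs E v)"
  using nbrs_subset finite_subset unfolding graph_on_def by metis

lemma graph_on_finite: "graph_on V E \<Longrightarrow> finite E"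
  unfolding graph_on_def by (meson PowI finite_Pow_iff finite_subset subsetI)

lemma card_nbrs_incident:
  assumes "graph_on V E"
  shows "card (nbrs E v) = card {e \<in> E. v \<in> e}"
proof (rule bij_betw_same_card)
  show "bij_betw (\<lambda>u. {u, v}) (nbrs E v) {e \<in> E. v \<in> e}"
    unfolding bij_betw_def
  proof
    show "inj_on (\<lambda>u. {u, v}) (nbrs E v)"
      by (auto simp: inj_on_def doubleton_eq_iff)
    show "(\<lambda>u. {u, v}) ` nbrs E v = {e \<in> E. v \<in> e}"
    proof (intro equalityI subsetI)
      fix e assume e: "e \<in> {e \<in> E. v \<in> e}"
      then have "card e = 2" using assms unfolding graph_on_def by auto
      then obtain a b where "e = {a, b}" by (auto simp: card_2_iff)
      then show "e \<in> (\<lambda>u. {u, v}) ` nbrs E v" using e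
        by (auto simp: nbrs_def image_iff insert_commute)
    qed (auto simp: nbrs_def)
  qed
qed

text \<open>Each vertex gains with \<open>A\<close> as many incident edges as it loses with
  \<open>R\<close>. All switches below are instances, so that only incidences have to be counted for
  them.\<close>

lemma realization_exchange:
  assumes r: "realization V E f" and "R \<subseteq> E" "A \<inter> E = {}"
    and A: "\<And>e. e \<in> A \<Longrightarrow> e \<subseteq> V \<and> card e = 2"
    and deg: "\<And>v. card {e \<in> R. v \<in> e} = card {e \<in> A. v \<in> e}"
  shows "realization V (E - R \<union> A) f"
proof -
  have g: "graph_on V E" using r unfolding realization_def by simp
  have g': "graph_on V (E - R \<union> A)"
    using g A unfolding graph_on_def by auto
  have "card (nbrs (E - R \<union> A) v) = card (nbrs E v)" for v
  proof -
    have fE: "finite E" and fA: "finite A"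
      using graph_on_finite[OF g] graph_on_finite[OF g'] by auto
    have "{e \<in> E - R \<union> A. v \<in> e} = ({e \<in> E. v \<in> e} - {e \<in> R. v \<in> e}) \<union> {e \<in> A. v \<in> e}" by auto
    also have "card \<dots> = card ({e \<in> E. v \<in> e} - {e \<in> R. v \<in> e}) + card {e \<in> A. v \<in> e}"
      using assms(3) fE fA by (intro card_Un_disjoint) auto
    also have "card ({e \<in> E. v \<in> e} - {e \<in> R. v \<in> e}) = card {e \<in> E. v \<in> e} - card {e \<in> R. v \<in> e}"
      using assms(2) fE by (intro card_Diff_subset) (auto intro: finite_subset)
    also have "card {e \<in> E. v \<in> e} - card {e \<in> R. v \<in> e} + card {e \<in> A. v \<in> e} = card {e \<in> E. v \<in> e}"
    proof -
      have "card {e \<in> R. v \<in> e} \<le> card {e \<in> E. v \<in> e}"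
        using assms(2) fE by (intro card_mono) auto
      then show ?thesis using deg[of v] by simp
    qed
    finally show ?thesis by (simp add: card_nbrs_incident[OF g] card_nbrs_incident[OF g'])
  qed
  then show ?thesis using r g' unfolding realization_def by simp
qed

text \<open>The 2-switch on the alternating cycle \<open>a, b, d, c\<close>: \<open>a\<close> trades
  \<open>b\<close> for \<open>c\<close>, \<open>b\<close> trades \<open>a\<close> for
  \<open>d\<close>, and so on around the cycle.\<close>

definition switch :: "nat set set \<Rightarrow> nat \<Rightarrow> nat \<Rightarrow> nat \<Rightarrow> nat \<Rightarrow> nat set set" where
  "switch E a b c d = E - {{a, b}, {c, d}} \<union> {{a, c}, {b, d}}"

lemma card_incident2:
  assumes "e1 \<noteq> e2"
  shows "card {e \<in> {e1, e2}. v \<in> e} = (if v \<in> e1 then 1 else 0) + (if v \<in> e2 then 1 else 0)"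
proof -
  have "{e \<in> {e1, e2}. v \<in> e} = (if v \<in> e1 then {e1} else {}) \<union> (if v \<in> e2 then {e2} else {})" by auto
  then show ?thesis using assms by simp
qed

lemma card_incident3:
  assumes "e1 \<noteq> e2" "e1 \<noteq> e3" "e2 \<noteq> e3"
  shows "card {e \<in> {e1, e2, e3}. v \<in> e} =
    (if v \<in> e1 then 1 else 0) + (if v \<in> e2 then 1 else 0) + (if v \<in> e3 then 1 else 0)"
proof -
  have "{e \<in> {e1, e2, e3}. v \<in> e} =
    (if v \<in> e1 then {e1} else {}) \<union> (if v \<in> e2 then {e2} else {}) \<union> (if v \<in> e3 then {e3} else {})" by auto
  then show ?thesis using assms by simp
qed

lemma realization_switch:
  assumes r: "realization V E f" and e: "{a, b} \<in> E" "{c, d} \<in> E"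
    and n: "{a, c} \<notin> E" "{b, d} \<notin> E" "a \<noteq> c" "b \<noteq> d"
  shows "realization V (switch E a b c d) f"
proof -
  have g: "graph_on V E" using r unfolding realization_def by simp
  have V: "a \<in> V" "b \<in> V" "c \<in> V" "d \<in> V" and ne: "a \<noteq> b" "c \<noteq> d"
    using graph_on_edge[OF g] e by auto
  \<comment> \<open>\<open>a = d\<close> would identify the edge \<open>{a, b}\<close> with the
    non-edge \<open>{b, d}\<close>, and \<open>b = c\<close> would identify it with the non-edge
    \<open>{a, c}\<close>.\<close>
  have ne': "a \<noteq> d" "b \<noteq> c" using e n by (auto simp: insert_commute)
  show ?thesis unfolding switch_def
  proof (rule realization_exchange[OF r])
    fix v
    have d1: "{a, b} \<noteq> {c, d}" "{a, c} \<noteq> {b, d}" using ne ne' n by (auto simp: doubleton_eq_iff)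
    show "card {e \<in> {{a, b}, {c, d}}. v \<in> e} = card {e \<in> {{a, c}, {b, d}}. v \<in> e}"
      unfolding card_incident2[OF d1(1)] card_incident2[OF d1(2)]
      using ne ne' n by auto
  qed (use e n V ne ne' in \<open>auto simp: card_2_iff\<close>)
qed

text \<open>A closed alternating trail that passes through \<open>u\<close> twice.\<close>

definition bowtie :: "nat set set \<Rightarrow> nat \<Rightarrow> nat \<Rightarrow> nat \<Rightarrow> nat \<Rightarrow> nat \<Rightarrow> nat set set" where
  "bowtie E u x e p q = E - {{x, e}, {u, p}, {u, q}} \<union> {{u, x}, {u, e}, {p, q}}"

lemma realization_bowtie:
  assumes r: "realization V E f" and e: "{x, e} \<in> E" "{u, p} \<in> E" "{u, q} \<in> E"
    and n: "{u, x} \<notin> E" "{u, e} \<notin> E" "{p, q} \<notin> E" "u \<noteq> x" "u \<noteq> e" "p \<noteq> q"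
  shows "realization V (bowtie E u x e p q) f"
proof -
  have g: "graph_on V E" using r unfolding realization_def by simp
  have V: "x \<in> V" "e \<in> V" "u \<in> V" "p \<in> V" "q \<in> V" and ne: "x \<noteq> e" "u \<noteq> p" "u \<noteq> q"
    using graph_on_edge[OF g] e by auto
  have ne': "p \<noteq> x" "p \<noteq> e" "q \<noteq> x" "q \<noteq> e" using e n by (auto simp: insert_commute)
  show ?thesis unfolding bowtie_def
  proof (rule realization_exchange[OF r])
    fix v
    have d1: "{x, e} \<noteq> {u, p}" "{x, e} \<noteq> {u, q}" "{u, p} \<noteq> {u, q}"
      and d2: "{u, x} \<noteq> {u, e}" "{u, x} \<noteq> {p, q}" "{u, e} \<noteq> {p, q}"
      using ne ne' n by (auto simp: doubleton_eq_iff)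
    show "card {ea \<in> {{x, e}, {u, p}, {u, q}}. v \<in> ea} = card {ea \<in> {{u, x}, {u, e}, {p, q}}. v \<in> ea}"
      unfolding card_incident3[OF d1] card_incident3[OF d2]
      using ne ne' n by auto
  qed (use e n V ne ne' in \<open>auto simp: card_2_iff\<close>)
qed

lemma realization_graph: "realization V E f \<Longrightarrow> graph_on V E"
  by (simp add: realization_def)

lemma realization_card: "realization V E f \<Longrightarrow> v \<in> V \<Longrightarrow> card (nbrs E v) = f v"
  by (simp add: realization_def)

text \<open>The combinatorial core of all switching arguments: comparing degrees yields a neighbour
  to switch with.\<close>

lemma card_Diff_nbrs:
  assumes r: "realization V E f" and V: "x \<in> V" "y \<in> V"
  shows "card (nbrs E y - insert x (nbrs E x)) + f x = card (nbrs E x - insert y (nbrs E y)) + f y"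
proof -
  have g: "graph_on V E" using r realization_graph by blast
  have fin: "finite (nbrs E x)" "finite (nbrs E y)" using finite_nbrs[OF g] by auto
  have irr: "x \<notin> nbrs E x" "y \<notin> nbrs E y" using nbrs_irrefl[OF g] by auto
  have 1: "card (nbrs E x) = card (nbrs E x - insert y (nbrs E y)) + card (nbrs E x \<inter> insert y (nbrs E y))"
    using fin by (metis card_Int_Diff add.commute)
  have 2: "card (nbrs E y) = card (nbrs E y - insert x (nbrs E x)) + card (nbrs E y \<inter> insert x (nbrs E x))"
    using fin by (metis card_Int_Diff add.commute)
  have "card (nbrs E x \<inter> insert y (nbrs E y)) = card (nbrs E y \<inter> insert x (nbrs E x))"
  proof (cases "x \<in> nbrs E y")
    case True
    then have "nbrs E x \<inter> insert y (nbrs E y) = insert y (nbrs E x \<inter> nbrs E y)"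
      "nbrs E y \<inter> insert x (nbrs E x) = insert x (nbrs E x \<inter> nbrs E y)"
      by (auto simp: nbrs_sym)
    then show ?thesis using irr fin by simp
  next
    case False
    then have "nbrs E x \<inter> insert y (nbrs E y) = nbrs E x \<inter> nbrs E y"
      "nbrs E y \<inter> insert x (nbrs E x) = nbrs E x \<inter> nbrs E y"
      by (auto simp: nbrs_sym)
    then show ?thesis by simp
  qed
  then show ?thesis using 1 2 realization_card[OF r] V by simp
qed

lemma double_count:
  assumes "finite X" "finite Y"
  shows "(\<Sum>x\<in>X. card (nbrs E x \<inter> Y)) = (\<Sum>y\<in>Y. card (nbrs E y \<inter> X))"
proof -
  have "(\<Sum>x\<in>X. card (nbrs E x \<inter> Y)) = (\<Sum>x\<in>X. \<Sum>y\<in>Y. if {x, y} \<in> E then 1 else 0)"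
    using assms by (intro sum.cong) (auto simp: nbrs_def sum.If_cases insert_commute Int_def conj_commute)
  also have "\<dots> = (\<Sum>y\<in>Y. \<Sum>x\<in>X. if {x, y} \<in> E then 1 else 0)" by (rule sum.swap)
  also have "\<dots> = (\<Sum>y\<in>Y. card (nbrs E y \<inter> X))"
    using assms by (intro sum.cong) (auto simp: nbrs_def sum.If_cases Int_def conj_commute)
  finally show ?thesis .
qed

lemma card_Int_Un_disj:
  assumes "finite N" "X \<inter> Y = {}"
  shows "card (N \<inter> (X \<union> Y)) = card (N \<inter> X) + card (N \<inter> Y)"
proof -
  have "N \<inter> (X \<union> Y) = (N \<inter> X) \<union> (N \<inter> Y)" by auto
  then show ?thesis using assms by (simp add: card_Un_disjoint disjoint_iff)
qed

section \<open>Necessary conditions for domination\<close>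

text \<open>\<open>f j - 1\<close> is what remains of the degree of \<open>j\<close> after its edge
  to \<open>D\<close> is set aside. The edges from \<open>D\<close> to \<open>C - W\<close> are
  charged on the left-hand side to avoid a truncated difference with \<open>sum f D\<close>.\<close>

definition cond_A :: "nat set \<Rightarrow> nat set \<Rightarrow> (nat \<Rightarrow> nat) \<Rightarrow> nat set \<Rightarrow> bool" where
  "cond_A D C f W \<longleftrightarrow> sum f W + card (C - W) \<le>
    card W * (card W - 1) + (\<Sum>j\<in>C - W. min (card W) (f j - 1)) + sum f D"

definition cond_B :: "nat set \<Rightarrow> nat set \<Rightarrow> (nat \<Rightarrow> nat) \<Rightarrow> nat set \<Rightarrow> bool" where
  "cond_B D C f W \<longleftrightarrow> sum f W \<le>
    card W * (card W - 1) + (\<Sum>j\<in>C - W. min (card W) (f j - 1)) + (\<Sum>i\<in>D. min (card W) (f i))"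

lemma degree_split:
  assumes r: "realization (D \<union> C) E f" and "D \<inter> C = {}" "W \<subseteq> C" "v \<in> D \<union> C"
  shows "f v = card (nbrs E v \<inter> W) + card (nbrs E v \<inter> (C - W)) + card (nbrs E v \<inter> D)"
proof -
  have g: "graph_on (D \<union> C) E" using r realization_graph by blast
  have fin: "finite (nbrs E v)" using finite_nbrs[OF g] .
  have "nbrs E v = nbrs E v \<inter> ((W \<union> (C - W)) \<union> D)" using nbrs_subset[OF g, of v] assms by blast
  then have "card (nbrs E v) = card (nbrs E v \<inter> ((W \<union> (C - W)) \<union> D))" by simp
  also have "\<dots> = card (nbrs E v \<inter> W) + card (nbrs E v \<inter> (C - W)) + card (nbrs E v \<inter> D)"
    using fin assms by (subst card_Int_Un_disj, simp, blast, subst card_Int_Un_disj) auto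
  finally show ?thesis using realization_card[OF r assms(4)] by simp
qed

lemma sum_degree_W:
  assumes r: "realization (D \<union> C) E f" and "D \<inter> C = {}" "W \<subseteq> C"
  shows "sum f W = (\<Sum>w\<in>W. card (nbrs E w \<inter> W)) + (\<Sum>j\<in>C - W. card (nbrs E j \<inter> W))
    + (\<Sum>i\<in>D. card (nbrs E i \<inter> W))"
proof -
  have fin: "finite D" "finite C" using r unfolding realization_def graph_on_def by auto
  have finW: "finite W" using assms fin finite_subset by blast
  have "sum f W = (\<Sum>w\<in>W. card (nbrs E w \<inter> W) + card (nbrs E w \<inter> (C - W)) + card (nbrs E w \<inter> D))"
    using degree_split[OF r assms(2,3)] assms(3) by (intro sum.cong) auto
  also have "\<dots> = (\<Sum>w\<in>W. card (nbrs E w \<inter> W)) + (\<Sum>w\<in>W. card (nbrs E w \<inter> (C - W)))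
      + (\<Sum>w\<in>W. card (nbrs E w \<inter> D))"
    by (simp add: sum.distrib)
  finally show ?thesis
    using double_count[OF finW, of "C - W" E] double_count[OF finW fin(1), of E] fin by simp
qed

text \<open>Eliminating the edges between \<open>D\<close> and \<open>W\<close> from this identity
  and \<open>sum_degree_W\<close> produces condition A; bounding them vertex by vertex in
  \<open>sum_degree_W\<close> alone produces condition B.\<close>

lemma sum_degree_D:
  assumes r: "realization (D \<union> C) E f" and "D \<inter> C = {}" "W \<subseteq> C"
  shows "sum f D = (\<Sum>i\<in>D. card (nbrs E i \<inter> W)) + (\<Sum>j\<in>C - W. card (nbrs E j \<inter> D))
    + (\<Sum>i\<in>D. card (nbrs E i \<inter> D))"
proof -
  have fin: "finite D" "finite C" using r unfolding realization_def graph_on_def by auto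
  have "sum f D = (\<Sum>i\<in>D. card (nbrs E i \<inter> W) + card (nbrs E i \<inter> (C - W)) + card (nbrs E i \<inter> D))"
    using degree_split[OF r assms(2,3)] by (intro sum.cong) auto
  then show ?thesis
    using double_count[OF fin(1), of "C - W" E] fin by (simp add: sum.distrib)
qed

lemma sum_inner_le:
  assumes g: "graph_on V E" and W: "finite W"
  shows "(\<Sum>w\<in>W. card (nbrs E w \<inter> W)) \<le> card W * (card W - 1)"
proof -
  have "(\<Sum>w\<in>W. card (nbrs E w \<inter> W)) \<le> (\<Sum>w\<in>W. card W - 1)"
  proof (rule sum_mono)
    fix w assume w: "w \<in> W"
    have "nbrs E w \<inter> W \<subseteq> W - {w}" using nbrs_irrefl[OF g] by auto
    then have "card (nbrs E w \<inter> W) \<le> card (W - {w})" using W by (intro card_mono) auto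
    then show "card (nbrs E w \<inter> W) \<le> card W - 1" using w W by simp
  qed
  then show ?thesis by simp
qed

definition feasible :: "nat set \<Rightarrow> nat set \<Rightarrow> (nat \<Rightarrow> nat) \<Rightarrow> bool" where
  "feasible D C f \<longleftrightarrow> (\<exists>E. realization (D \<union> C) E f \<and> (\<forall>j\<in>C. nbrs E j \<inter> D \<noteq> {}))"

lemma dominated_inner_le:
  assumes r: "realization (D \<union> C) E f" and "D \<inter> C = {}" "W \<subseteq> C" "j \<in> C" "nbrs E j \<inter> D \<noteq> {}"
  shows "card (nbrs E j \<inter> W) \<le> min (card W) (f j - 1)"
proof -
  have g: "graph_on (D \<union> C) E" using r realization_graph by blast
  have fin: "finite (nbrs E j)" "finite W"
    using finite_nbrs[OF g] assms(3) g finite_subset unfolding graph_on_def by auto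
  have "card (nbrs E j \<inter> D) > 0" using fin assms(5) by (simp add: card_gt_0_iff)
  moreover have "card (nbrs E j \<inter> W) \<le> card W" using fin by (intro card_mono) auto
  ultimately show ?thesis using degree_split[OF r assms(2,3), of j] assms(4) by simp
qed

lemma feasible_imp_cond_A:
  assumes "feasible D C f" "D \<inter> C = {}" "W \<subseteq> C"
  shows "cond_A D C f W"
proof -
  obtain E where r: "realization (D \<union> C) E f" and dom: "\<And>j. j \<in> C \<Longrightarrow> nbrs E j \<inter> D \<noteq> {}"
    using assms(1) unfolding feasible_def by auto
  have g: "graph_on (D \<union> C) E" using r realization_graph by blast
  have fin: "finite C" "finite W" using g assms(3) finite_subset unfolding graph_on_def by auto
  have "(\<Sum>j\<in>C - W. card (nbrs E j \<inter> W)) \<le> (\<Sum>j\<in>C - W. min (card W) (f j - 1))"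
    using dominated_inner_le[OF r assms(2,3)] dom by (intro sum_mono) auto
  moreover have "(\<Sum>j\<in>C - W. 1) \<le> (\<Sum>j\<in>C - W. card (nbrs E j \<inter> D))"
    using dom finite_nbrs[OF g] by (intro sum_mono) (auto simp: Suc_le_eq card_gt_0_iff)
  ultimately show ?thesis unfolding cond_A_def
    using sum_degree_W[OF r assms(2,3)] sum_degree_D[OF r assms(2,3)] sum_inner_le[OF g fin(2)] by simp
qed

lemma feasible_imp_cond_B:
  assumes "feasible D C f" "D \<inter> C = {}" "W \<subseteq> C"
  shows "cond_B D C f W"
proof -
  obtain E where r: "realization (D \<union> C) E f" and dom: "\<And>j. j \<in> C \<Longrightarrow> nbrs E j \<inter> D \<noteq> {}"
    using assms(1) unfolding feasible_def by auto
  have g: "graph_on (D \<union> C) E" using r realization_graph by blast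
  have fin: "finite C" "finite W" using g assms(3) finite_subset unfolding graph_on_def by auto
  have "(\<Sum>j\<in>C - W. card (nbrs E j \<inter> W)) \<le> (\<Sum>j\<in>C - W. min (card W) (f j - 1))"
    using dominated_inner_le[OF r assms(2,3)] dom by (intro sum_mono) auto
  moreover have "(\<Sum>i\<in>D. card (nbrs E i \<inter> W)) \<le> (\<Sum>i\<in>D. min (card W) (f i))"
  proof (rule sum_mono)
    fix i assume "i \<in> D"
    then have "card (nbrs E i \<inter> W) \<le> f i" using degree_split[OF r assms(2,3), of i] by simp
    moreover have "card (nbrs E i \<inter> W) \<le> card W" using fin by (intro card_mono) auto
    ultimately show "card (nbrs E i \<inter> W) \<le> min (card W) (f i)" by simp
  qed
  ultimately show ?thesis unfolding cond_B_def
    using sum_degree_W[OF r assms(2,3)] sum_inner_le[OF g fin(2)] by simp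
qed

section \<open>Sufficiency of the two conditions\<close>

definition undominated :: "nat set \<Rightarrow> nat set \<Rightarrow> nat set set \<Rightarrow> nat set" where
  "undominated D C E = {j \<in> C. nbrs E j \<inter> D = {}}"

definition multidominated :: "nat set \<Rightarrow> nat set set \<Rightarrow> nat \<Rightarrow> bool" where
  "multidominated D E j \<longleftrightarrow> (\<exists>a\<in>D. \<exists>b\<in>D. a \<noteq> b \<and> {a, j} \<in> E \<and> {b, j} \<in> E)"

lemma undominated_iff: "j \<in> undominated D C E \<longleftrightarrow> j \<in> C \<and> (\<forall>a\<in>D. {a, j} \<notin> E)"
  by (auto simp: undominated_def nbrs_def)

lemma not_multidominated_card:
  assumes "\<not> multidominated D E j"
  shows "card (nbrs E j \<inter> D) \<le> 1"
proof (cases "nbrs E j \<inter> D = {}")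
  case False
  then obtain a where "a \<in> nbrs E j \<inter> D" by blast
  then have "nbrs E j \<inter> D = {a}" using assms by (auto simp: multidominated_def nbrs_def)
  then show ?thesis by simp
qed simp

text \<open>The neighbour \<open>z\<close> can be taken from \<open>x\<close> and given to \<open>y\<close> without increasing the number of
  undominated vertices.\<close>

lemma ex_switchable_nbr:
  assumes r: "realization (D \<union> C) E f" and disj: "D \<inter> C = {}"
    and V: "x \<in> C" "y \<in> C" and u: "u \<in> C" and le: "f y \<le> f x"
    and uy: "{u, y} \<in> E" and ux: "{u, x} \<notin> E" "u \<noteq> x"
  obtains z where "{z, x} \<in> E" "{z, y} \<notin> E" "z \<noteq> y"
    "z \<in> C \<or> multidominated D E x \<or> y \<in> undominated D C E"
proof -
  let ?Z = "nbrs E x - insert y (nbrs E y)" and ?Y = "nbrs E y - insert x (nbrs E x)"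
  have g: "graph_on (D \<union> C) E" using r realization_graph by blast
  have le': "card ?Y \<le> card ?Z" using card_Diff_nbrs[OF r, of x y] V le by simp
  have uY: "u \<in> ?Y" using uy ux by (simp add: nbrs_iff)
  have fin: "finite ?Y" "finite ?Z" using finite_nbrs[OF g] by auto
  have "\<exists>z\<in>?Z. z \<in> C \<or> multidominated D E x \<or> y \<in> undominated D C E"
  proof (rule ccontr)
    assume neg: "\<not> ?thesis"
    have "card ?Y > 0" using uY fin by (auto simp: card_gt_0_iff)
    then have "0 < card ?Z" using le' by linarith
    then have "?Z \<noteq> {}" by (metis card.empty less_irrefl)
    then have nm: "\<not> multidominated D E x" "y \<notin> undominated D C E" using neg by auto
    have ZD: "?Z \<subseteq> nbrs E x \<inter> D" using neg nbrs_subset[OF g, of x] by auto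
    then have "card ?Z \<le> 1"
      using not_multidominated_card[OF nm(1)] finite_nbrs[OF g] card_mono[of "nbrs E x \<inter> D" ?Z] by simp
    then have "card ?Y \<le> 1" using le' by simp
    \<comment> \<open>So \<open>u\<close> is the only neighbour of \<open>y\<close> not shared with
      \<open>x\<close>, and the dominator \<open>b\<close> of \<open>y\<close> also dominates
      \<open>x\<close>. But \<open>x\<close> has a dominator \<open>z\<close> in \<open>?Z\<close>,
      which misses \<open>y\<close>: two dominators of \<open>x\<close>.\<close>
    then have Yu: "?Y = {u}" using uY fin card_seteq[of ?Y "{u}"] by simp
    obtain b where b: "b \<in> D" "{b, y} \<in> E" using nm(2) V by (auto simp: undominated_iff)
    have "b \<noteq> u" "b \<noteq> x" using b u V disj by auto
    then have "b \<notin> ?Y" unfolding Yu by simp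
    then have "{b, x} \<in> E" using b \<open>b \<noteq> x\<close> by (simp add: nbrs_iff)
    moreover obtain z where z: "z \<in> ?Z" using \<open>?Z \<noteq> {}\<close> by blast
    moreover have "z \<in> D" "{z, x} \<in> E" using z ZD by (auto simp: nbrs_iff)
    ultimately have "b = z" using nm(1) b(1) unfolding multidominated_def by blast
    then show False using z b by (simp add: nbrs_iff)
  qed
  then obtain z where z: "z \<in> ?Z" "z \<in> C \<or> multidominated D E x \<or> y \<in> undominated D C E" by blast
  show ?thesis by (rule that[OF _ _ _ z(2)]) (use z(1) in \<open>auto simp: nbrs_iff\<close>)
qed

text \<open>\<open>m\<close> is the least possible number of undominated vertices, \<open>u\<close> an undominated vertex of largest
  degree and \<open>\<theta>\<close> the least degree of a neighbour of \<open>u\<close>, both over all realizations that attain \<open>m\<close>.\<close>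

locale extremal =
  fixes D C :: "nat set" and f :: "nat \<Rightarrow> nat" and m u \<theta> :: nat
  assumes disj: "D \<inter> C = {}"
    and pos: "\<And>j. j \<in> C \<Longrightarrow> 0 < f j"
    and min_card: "\<And>E. realization (D \<union> C) E f \<Longrightarrow> m \<le> card (undominated D C E)"
    and max_deg: "\<And>E x. realization (D \<union> C) E f \<Longrightarrow> card (undominated D C E) \<le> m \<Longrightarrow>
      x \<in> undominated D C E \<Longrightarrow> f x \<le> f u"
    and min_nbr: "\<And>E w. realization (D \<union> C) E f \<Longrightarrow> card (undominated D C E) \<le> m \<Longrightarrow>
      u \<in> undominated D C E \<Longrightarrow> {u, w} \<in> E \<Longrightarrow> \<theta> \<le> f w"
begin

definition good :: "nat set set \<Rightarrow> bool" where
  "good E \<longleftrightarrow> realization (D \<union> C) E f \<and> card (undominated D C E) \<le> m \<and> u \<in> undominated D C E"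

text \<open>By \<open>good_nbr\<close> all neighbours of \<open>u\<close> in good realizations lie
  here; \<open>reach\<close> provides the converse, that any other member can be made a neighbour of
  \<open>u\<close>.\<close>

definition W :: "nat set" where "W = {w \<in> C. \<theta> \<le> f w}"

lemma goodD:
  assumes "good E"
  shows "realization (D \<union> C) E f" "card (undominated D C E) \<le> m" "u \<in> undominated D C E"
    "graph_on (D \<union> C) E" "finite (undominated D C E)" "u \<in> C" "u \<notin> D" "\<And>a. a \<in> D \<Longrightarrow> {u, a} \<notin> E \<and> {a, u} \<notin> E"
proof -
  show r: "realization (D \<union> C) E f" "card (undominated D C E) \<le> m" "u \<in> undominated D C E"
    using assms unfolding good_def by auto
  show g: "graph_on (D \<union> C) E" using r(1) realization_graph by blast
  then show "finite (undominated D C E)" unfolding graph_on_def undominated_def by auto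
  show uC: "u \<in> C" using r(3) by (simp add: undominated_iff)
  then show "u \<notin> D" using disj by auto
  show "\<And>a. a \<in> D \<Longrightarrow> {u, a} \<notin> E \<and> {a, u} \<notin> E" using r(3) by (auto simp: undominated_iff insert_commute)
qed

lemma good_nbr:
  assumes "good E" "{u, w} \<in> E"
  shows "w \<in> C" "w \<in> W" "w \<noteq> u" "w \<notin> D"
proof -
  have "w \<in> D \<union> C" "u \<noteq> w" using graph_on_edge[OF goodD(4)[OF assms(1)] assms(2)] by auto
  moreover have "w \<notin> D" using goodD(8)[OF assms(1)] assms(2) by auto
  ultimately show "w \<in> C" "w \<noteq> u" "w \<notin> D" by auto
  moreover have "\<theta> \<le> f w" using min_nbr goodD[OF assms(1)] assms(2) by blast
  ultimately show "w \<in> W" unfolding W_def by auto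
qed

lemma fewer_undominated:
  assumes "good E" "realization (D \<union> C) E' f" "undominated D C E' \<subseteq> undominated D C E - {u}"
  shows False
proof -
  have "card (undominated D C E') \<le> card (undominated D C E - {u})"
    using assms goodD(5)[OF assms(1)] by (intro card_mono) auto
  also have "\<dots> < card (undominated D C E)"
    using goodD(3,5)[OF assms(1)] by (intro psubset_card_mono) auto
  finally show False using goodD(2)[OF assms(1)] min_card[OF assms(2)] by simp
qed

text \<open>One vertex may become undominated if another ceases to be. This is why the extremal
  choices range over all realizations that attain \<open>m\<close> and not over a fixed undominated
  set.\<close>

lemma swap_undominated:
  assumes "good E" "realization (D \<union> C) E' f" "w \<in> undominated D C E"
    "undominated D C E' \<subseteq> insert x (undominated D C E - {w})"
  shows "card (undominated D C E') \<le> m"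
proof -
  have fin: "finite (undominated D C E)" using goodD[OF assms(1)] by simp
  have "card (undominated D C E') \<le> card (insert x (undominated D C E - {w}))"
    using assms fin by (intro card_mono) auto
  also have "\<dots> \<le> Suc (card (undominated D C E - {w}))" using fin by (simp add: card_insert_if)
  also have "\<dots> = card (undominated D C E)" using assms(3) fin by (metis card_Suc_Diff1)
  finally show ?thesis using goodD(2)[OF assms(1)] by simp
qed

lemma undominated_cases:
  assumes "j \<in> undominated D C E'" "j \<notin> undominated D C E"
  obtains a where "j \<in> C" "a \<in> D" "{a, j} \<in> E" "{a, j} \<notin> E'"
  using assms by (auto simp: undominated_iff)

text \<open>Otherwise switching \<open>uw, ax\<close> into \<open>ua, wx\<close> would dominate \<open>u\<close> at no expense.\<close>

lemma private_nbr:
  assumes E: "good E" and uw: "{u, w} \<in> E" and a: "a \<in> D" and ax: "{a, x} \<in> E"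
    and wx: "{w, x} \<notin> E" "w \<noteq> x"
  shows "x \<in> C" "\<not> multidominated D E x" "f x \<le> f u"
proof -
  let ?E = "switch E u w a x"
  note w = good_nbr[OF E uw]
  have ua: "u \<noteq> a" "{u, a} \<notin> E" using goodD[OF E] a by auto
  have r: "realization (D \<union> C) ?E f"
    by (rule realization_switch[OF goodD(1)[OF E] uw ax ua(2) wx(1) ua(1) wx(2)])
  have u': "u \<notin> undominated D C ?E" using a by (auto simp: undominated_iff switch_def insert_commute)
  have lose: "j = x \<and> (\<forall>b\<in>D. {b, x} \<in> E \<longrightarrow> b = a)"
    if j: "j \<in> undominated D C ?E" "j \<notin> undominated D C E" for j
  proof -
    obtain c where c: "j \<in> C" "c \<in> D" "{c, j} \<in> E" "{c, j} \<notin> ?E"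
      using undominated_cases[OF j] by metis
    then have "{c, j} = {a, x}" using w goodD(6,7)[OF E] by (auto simp: switch_def doubleton_eq_iff)
    then have jx: "j = x" using c a disj by (auto simp: doubleton_eq_iff)
    have "b = a" if b: "b \<in> D" "{b, x} \<in> E" for b
    proof (rule ccontr)
      assume "b \<noteq> a"
      then have "{b, x} \<in> ?E" using b w goodD(6,7)[OF E] c(1) disj jx by (auto simp: switch_def doubleton_eq_iff)
      then show False using j(1) b jx by (auto simp: undominated_iff)
    qed
    then show ?thesis using jx by blast
  qed
  have "\<exists>j. j \<in> undominated D C ?E \<and> j \<notin> undominated D C E"
    using fewer_undominated[OF E r] u' by blast
  then have x: "x \<in> undominated D C ?E" "x \<notin> undominated D C E" and uniq: "\<forall>b\<in>D. {b, x} \<in> E \<longrightarrow> b = a"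
    using lose by auto
  show "x \<in> C" using x by (auto simp: undominated_iff)
  show "\<not> multidominated D E x" using uniq by (auto simp: multidominated_def)
  \<comment> \<open>\<open>x\<close> takes the place of \<open>u\<close> among the undominated
    vertices, so the new realization still attains \<open>m\<close> and \<open>max_deg\<close>
    applies to \<open>x\<close>.\<close>
  have "undominated D C ?E \<subseteq> insert x (undominated D C E - {u})" using lose u' by blast
  then show "f x \<le> f u" using max_deg[OF r] swap_undominated[OF E r goodD(3)[OF E]] x by blast
qed

text \<open>Only \<open>y\<close> can lose its last dominator, namely \<open>z\<close>. If it does,
  then \<open>w\<close> was undominated and now receives \<open>z\<close>, so the count does not
  grow. Being a neighbour of \<open>u\<close> in a good realization, \<open>y\<close> has degree at
  least \<open>\<theta>\<close>; membership in \<open>W\<close> is the way in which all later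
  closure properties are obtained.\<close>

lemma switch_good:
  assumes E: "good E" and uw: "{u, w} \<in> E" and zy: "{z, y} \<in> E" and uy: "{u, y} \<notin> E" "u \<noteq> y"
    and wz: "{w, z} \<notin> E" "w \<noteq> z" and y: "y \<in> C"
    and ok: "z \<in> C \<or> multidominated D E y \<or> w \<in> undominated D C E"
  shows "good (switch E u w y z)" "y \<in> W" "{u, y} \<in> switch E u w y z"
proof -
  let ?E = "switch E u w y z"
  note w = good_nbr[OF E uw]
  have yz: "{y, z} \<in> E" using zy by (simp add: insert_commute)
  have r: "realization (D \<union> C) ?E f"
    by (rule realization_switch[OF goodD(1)[OF E] uw yz uy(1) wz(1) uy(2) wz(2)])
  have zu: "z \<noteq> u" using zy uy by auto
  have u': "u \<in> undominated D C ?E" using goodD[OF E] w y zu disj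
    by (auto simp: undominated_iff switch_def doubleton_eq_iff)
  have lose: "j = y \<and> z \<in> D \<and> \<not> multidominated D E y"
    if j: "j \<in> undominated D C ?E" "j \<notin> undominated D C E" for j
  proof -
    obtain c where c: "j \<in> C" "c \<in> D" "{c, j} \<in> E" "{c, j} \<notin> ?E"
      using undominated_cases[OF j] by metis
    then have "{c, j} = {y, z}" using w goodD(6,7)[OF E] by (auto simp: switch_def doubleton_eq_iff)
    then have jx: "j = y" "z \<in> D" using c y disj by (auto simp: doubleton_eq_iff)
    have "b = z" if b: "b \<in> D" "{b, y} \<in> E" for b
    proof (rule ccontr)
      assume "b \<noteq> z"
      then have "{b, y} \<in> ?E" using b w goodD(6,7)[OF E] y disj jx by (auto simp: switch_def doubleton_eq_iff)
      then show False using j(1) b jx by (auto simp: undominated_iff)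
    qed
    then show ?thesis using jx by (auto simp: multidominated_def)
  qed
  have "card (undominated D C ?E) \<le> m"
  proof (cases "undominated D C ?E \<subseteq> undominated D C E")
    case True
    then show ?thesis using card_mono[OF goodD(5)[OF E] True] goodD(2)[OF E] by simp
  next
    case False
    then have zy': "z \<in> D" "\<not> multidominated D E y" using lose by blast+
    then have wU: "w \<in> undominated D C E" using ok disj by auto
    have "w \<notin> undominated D C ?E" using zy' by (auto simp: undominated_iff switch_def insert_commute)
    then have "undominated D C ?E \<subseteq> insert y (undominated D C E - {w})" using lose by blast
    then show ?thesis using swap_undominated[OF E r wU] by blast
  qed
  then show "good ?E" unfolding good_def using r u' by simp
  then show "y \<in> W" using good_nbr[of ?E y] by (simp add: switch_def)
  show "{u, y} \<in> ?E" by (simp add: switch_def)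
qed

text \<open>\<open>min_nbr\<close> only bounds degrees from below. Here the bound is attained by an
  actual neighbour \<open>s\<close>, which can therefore be given away for any member of
  \<open>W\<close>.\<close>

definition tight :: "nat set set \<Rightarrow> nat \<Rightarrow> bool" where
  "tight E s \<longleftrightarrow> good E \<and> {u, s} \<in> E \<and> f s = \<theta>"

lemma tightD: "tight E s \<Longrightarrow> good E" "tight E s \<Longrightarrow> {u, s} \<in> E" "tight E s \<Longrightarrow> f s = \<theta>"
  unfolding tight_def by auto

text \<open>Since \<open>f s = \<theta> \<le> f w\<close>, the comparison of degrees yields a
  \<open>z\<close> to switch with, and \<open>w\<close> replaces \<open>s\<close> as a neighbour of
  \<open>u\<close>. What is known about neighbours of \<open>u\<close> thus extends to all of
  \<open>W - {u}\<close>, provided that the edges in question survive the switch.\<close>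

lemma reach:
  assumes t: "tight E s" and w: "w \<in> W" "w \<noteq> u" "{u, w} \<notin> E"
  obtains z where "{z, w} \<in> E" "{z, s} \<notin> E" "z \<noteq> s" "z \<noteq> u" "s \<noteq> w" "z \<noteq> w"
    "z \<in> C \<or> multidominated D E w \<or> s \<in> undominated D C E"
    "good (switch E u s w z)" "{u, w} \<in> switch E u s w z"
proof -
  note E = tightD[OF t]
  note s = good_nbr[OF E(1,2)]
  have wC: "w \<in> C" "f s \<le> f w" using w E by (auto simp: W_def)
  obtain z where z: "{z, w} \<in> E" "{z, s} \<notin> E" "z \<noteq> s"
    "z \<in> C \<or> multidominated D E w \<or> s \<in> undominated D C E"
    using ex_switchable_nbr[OF goodD(1)[OF E(1)] disj wC(1) s(1) goodD(6)[OF E(1)] wC(2) E(2) w(3)] w(2) by metis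
  have zu: "z \<noteq> u" using z w by auto
  have "{s, z} \<notin> E" "s \<noteq> z" using z by (auto simp: insert_commute)
  note sw = switch_good[OF E(1,2) z(1) w(3) w(2)[symmetric] this wC(1) z(4)]
  have "s \<noteq> w" "z \<noteq> w" using w E graph_on_edge(3)[OF goodD(4)[OF E(1)] z(1)] by auto
  then show ?thesis using that z zu sw by blast
qed

text \<open>An undominated \<open>x\<close> has degree at most \<open>f u\<close> by the choice of
  \<open>u\<close>; a dominated one has it by \<open>private_nbr\<close>, applied to a dominator.
  Hence \<open>u\<close> inherits \<open>\<theta> \<le> f u\<close> from \<open>x\<close>.\<close>

lemma root_in_W:
  assumes E: "good E" and uw: "{u, w} \<in> E" and x: "x \<in> W" "x \<noteq> w" "{w, x} \<notin> E"
  shows "u \<in> W"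
proof -
  have "f x \<le> f u"
  proof (cases "x \<in> undominated D C E")
    case True
    then show ?thesis using max_deg goodD[OF E] by blast
  next
    case False
    then obtain a where "a \<in> D" "{a, x} \<in> E" using x by (auto simp: undominated_iff W_def)
    then show ?thesis using private_nbr[OF E uw] x by blast
  qed
  then show ?thesis using x goodD(6)[OF E] by (auto simp: W_def)
qed

text \<open>Switching \<open>{u, w}\<close>, \<open>{y, x}\<close> into \<open>{u, y}\<close>,
  \<open>{w, x}\<close> would make \<open>y\<close> a neighbour of \<open>u\<close>. No dominator is
  involved because \<open>x\<close> is in \<open>C\<close>.\<close>

lemma closed1:
  assumes E: "good E" and uw: "{u, w} \<in> E" and x: "x \<in> C" "x \<noteq> w" "{w, x} \<notin> E"
    and y: "y \<in> C" "{x, y} \<in> E"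
  shows "y \<in> W"
proof (cases "y = u \<or> {u, y} \<in> E")
  case True
  then show ?thesis
  proof
    assume "y = u"
    then have "{u, x} \<in> E" using y by (simp add: insert_commute)
    then have "x \<in> W" using good_nbr[OF E] by blast
    then show "y \<in> W" using root_in_W[OF E uw _ x(2,3)] \<open>y = u\<close> by simp
  qed (use good_nbr[OF E] in blast)
next
  case False
  then show ?thesis using switch_good(2)[OF E uw y(2) _ _ x(3) x(2)[symmetric] y(1)] x(1) by blast
qed

text \<open>The statement of \<open>closed1\<close> transported along \<open>reach\<close> from
  neighbours of \<open>u\<close> to all of \<open>W - {u}\<close>.\<close>

lemma closed:
  assumes t: "tight E s" and w: "w \<in> W" "w \<noteq> u" and x: "x \<in> C" "x \<noteq> w" "{w, x} \<notin> E"
    and y: "y \<in> C" "{x, y} \<in> E"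
  shows "y \<in> W"
proof (cases "{u, w} \<in> E \<or> x = u")
  case True
  then show ?thesis using closed1[OF tightD(1)[OF t] _ x y] good_nbr[OF tightD(1)[OF t]] y by blast
next
  case False
  then obtain z where z: "{z, w} \<in> E" "{z, s} \<notin> E" "z \<noteq> s" "z \<noteq> u" "s \<noteq> w" "z \<noteq> w"
    and g: "good (switch E u s w z)" "{u, w} \<in> switch E u s w z"
    using reach[OF t w] by metis
  have wx: "{w, x} \<notin> switch E u s w z" using x False z by (auto simp: switch_def doubleton_eq_iff)
  show ?thesis
  proof (cases "{x, y} \<in> switch E u s w z")
    case True
    then show ?thesis using closed1[OF g x(1,2) wx y(1)] by blast
  next
    case False
    then have "{x, y} = {u, s} \<or> {x, y} = {w, z}" using y by (auto simp: switch_def)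
    \<comment> \<open>The transport destroys \<open>{u, s}\<close> and \<open>{w, z}\<close> only.
      The second cannot be \<open>{x, y}\<close> since \<open>w\<close> and \<open>x\<close> are not
      adjacent, and \<open>x = u\<close> was treated above.\<close>
    then have "x = s \<and> y = u" using \<open>\<not> ({u, w} \<in> E \<or> x = u)\<close> x z by (auto simp: doubleton_eq_iff insert_commute)
    then show ?thesis using root_in_W[OF tightD(1,2)[OF t] w(1)] x by (auto simp: insert_commute)
  qed
qed

text \<open>Two consequences of \<open>private_nbr\<close>, transported from \<open>switch E u s w z\<close> back to \<open>E\<close>.\<close>

lemma multidominated_adjacent:
  assumes t: "tight E s" and w: "w \<in> W" "w \<noteq> u" and x: "multidominated D E x" "x \<noteq> w"
  shows "{w, x} \<in> E"
proof (rule ccontr)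
  assume wx: "{w, x} \<notin> E"
  obtain a b where ab: "a \<in> D" "b \<in> D" "a \<noteq> b" "{a, x} \<in> E" "{b, x} \<in> E"
    using x(1) unfolding multidominated_def by blast
  show False
  proof (cases "{u, w} \<in> E")
    case True
    then show False using private_nbr[OF tightD(1)[OF t] True ab(1,4) wx] x by auto
  next
    case False
    note G = goodD[OF tightD(1)[OF t]]
    obtain z where z: "{z, w} \<in> E" "{z, s} \<notin> E" "z \<noteq> s" "z \<noteq> u" "s \<noteq> w" "z \<noteq> w"
      and g: "good (switch E u s w z)" "{u, w} \<in> switch E u s w z"
      using reach[OF t w False] by metis
    have xu: "x \<noteq> u" using ab G(8) by auto
    have *: "{c, x} \<in> switch E u s w z" if "c \<in> D" "{c, x} \<in> E" for c
    proof -
      have "c \<noteq> u" "c \<noteq> w" using that G(7) w disj by (auto simp: W_def)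
      moreover have "x \<noteq> z" if "c = w" using that \<open>c \<noteq> w\<close> by simp
      ultimately show ?thesis using that xu x(2) by (auto simp: switch_def doubleton_eq_iff)
    qed
    have "{w, x} \<notin> switch E u s w z" using wx x xu z by (auto simp: switch_def doubleton_eq_iff)
    moreover have "multidominated D (switch E u s w z) x" using ab * by (auto simp: multidominated_def)
    ultimately show False using private_nbr[OF g ab(1) *[OF ab(1,4)]] x by auto
  qed
qed

lemma inner_adjacent:
  assumes t: "tight E s" and w: "w \<in> W" "w \<noteq> u" and x: "x \<in> D" "a \<in> D" "{a, x} \<in> E"
  shows "{w, x} \<in> E"
proof (rule ccontr)
  assume wx: "{w, x} \<notin> E"
  note G = goodD[OF tightD(1)[OF t]]
  have xw: "w \<noteq> x" "a \<noteq> w" "x \<noteq> u" "a \<noteq> u" using w x disj G by (auto simp: W_def)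
  show False
  proof (cases "{u, w} \<in> E")
    case True
    then show False using private_nbr(1)[OF tightD(1)[OF t] True x(2,3) wx xw(1)] x disj by auto
  next
    case False
    obtain z where z: "{z, w} \<in> E" "{z, s} \<notin> E" "z \<noteq> s" "z \<noteq> u" "s \<noteq> w" "z \<noteq> w"
      and g: "good (switch E u s w z)" "{u, w} \<in> switch E u s w z"
      using reach[OF t w False] by metis
    have "{w, x} \<notin> switch E u s w z" "{a, x} \<in> switch E u s w z"
      using wx x xw z by (auto simp: switch_def doubleton_eq_iff)
    then show False using private_nbr(1)[OF g x(2) _ _ xw(1)] x disj by auto
  qed
qed

text \<open>A neighbour of \<open>i\<close> in \<open>D\<close> would force \<open>{w, i}\<close> to
  be an edge by \<open>inner_adjacent\<close>. For a doubly dominated \<open>y\<close>, giving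
  \<open>i\<close> to \<open>w\<close> and \<open>u\<close> to \<open>y\<close> leaves
  \<open>y\<close> a dominator, so \<open>switch_good\<close> places \<open>y\<close> in
  \<open>W\<close>.\<close>

lemma closed_D:
  assumes t: "tight E s" and w: "w \<in> W" "w \<noteq> u" and i: "i \<in> D" "{w, i} \<notin> E"
    and y: "{y, i} \<in> E"
  shows "y \<in> C" "multidominated D E y \<Longrightarrow> y \<in> W"
proof -
  note G = goodD[OF tightD(1)[OF t]]
  have "y \<notin> D" using inner_adjacent[OF t w i(1) _ y] i by auto
  then show yC: "y \<in> C" using graph_on_edge(1)[OF G(4) y] by auto
  assume mult: "multidominated D E y"
  have ne: "y \<noteq> w" "y \<noteq> u" "i \<noteq> u" "i \<noteq> w" using y i G w disj by (auto simp: insert_commute W_def)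
  have iy: "{i, y} \<in> E" using y by (simp add: insert_commute)
  show "y \<in> W"
  proof (cases "{u, y} \<in> E")
    case True
    then show ?thesis using good_nbr[OF tightD(1)[OF t]] by blast
  next
    case uy: False
    show ?thesis
    proof (cases "{u, w} \<in> E")
      case True
      then show ?thesis
        using switch_good(2)[OF tightD(1)[OF t] True iy uy _ i(2) _ yC] mult ne by auto
    next
      case False
      obtain z where z: "{z, w} \<in> E" "{z, s} \<notin> E" "z \<noteq> s" "z \<noteq> u" "s \<noteq> w" "z \<noteq> w"
        and g: "good (switch E u s w z)" "{u, w} \<in> switch E u s w z"
        using reach[OF t w False] by metis
      have keep: "{c, y} \<in> switch E u s w z" if "c \<in> D" "{c, y} \<in> E" for c
      proof -
        have "c \<noteq> u" "c \<noteq> w" using that G(7) w disj by (auto simp: W_def)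
        then show ?thesis using that ne by (auto simp: switch_def doubleton_eq_iff)
      qed
      have "multidominated D (switch E u s w z) y" using mult keep by (auto simp: multidominated_def)
      moreover have "{w, i} \<notin> switch E u s w z" using i ne z by (auto simp: switch_def doubleton_eq_iff)
      ultimately show ?thesis
        using switch_good(2)[OF g keep[OF i(1) iy] _ ne(2)[symmetric] _ ne(4)[symmetric] yC]
          good_nbr(2)[OF g(1)] by blast
    qed
  qed
qed

lemma good_if_undominated_subset:
  assumes "good E" "realization (D \<union> C) E' f" "undominated D C E' \<subseteq> undominated D C E"
    "u \<in> undominated D C E'"
  shows "good E'"
  using assms card_mono[OF goodD(5)[OF assms(1)] assms(3)] goodD(2)[OF assms(1)]
  unfolding good_def by simp

text \<open>The bowtie gives \<open>u\<close> the neighbours \<open>x\<close> and \<open>e\<close>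
  in place of \<open>p\<close> and \<open>q\<close>. If \<open>e\<close> is in \<open>D\<close>,
  then \<open>u\<close> becomes dominated while \<open>x\<close> keeps another dominator, against
  minimality of \<open>m\<close>. If \<open>e\<close> is in \<open>C - W\<close>, domination is
  unchanged, but \<open>u\<close> acquires a neighbour of degree below
  \<open>\<theta>\<close>.\<close>

lemma bowtie_impossible:
  assumes E: "good E" and xe: "{x, e} \<in> E" and pq: "{u, p} \<in> E" "{u, q} \<in> E" "{p, q} \<notin> E" "p \<noteq> q"
    and ux: "{u, x} \<notin> E" "u \<noteq> x" and ue: "{u, e} \<notin> E" and x: "x \<in> C"
    and e: "e \<in> C \<and> e \<notin> W \<and> e \<noteq> u \<or> e \<in> D \<and> multidominated D E x"
  shows False
proof -
  let ?E = "bowtie E u x e p q"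
  note G = goodD[OF E]
  have pC: "p \<in> C" "q \<in> C" using good_nbr[OF E] pq by auto
  have eu: "u \<noteq> e" using e G by auto
  have r: "realization (D \<union> C) ?E f"
    by (rule realization_bowtie[OF G(1) xe pq(1,2) ux(1) ue pq(3) ux(2) eu pq(4)])
  have keep: "{c, j} \<in> ?E" if "c \<in> D" "j \<in> C" "{c, j} \<in> E" "{c, j} \<noteq> {x, e}" for c j
    using that pC G(6,7) disj by (auto simp: bowtie_def doubleton_eq_iff)
  show False
  proof (cases "e \<in> D")
    case True
    then have "u \<notin> undominated D C ?E" by (auto simp: undominated_iff bowtie_def insert_commute)
    moreover have "undominated D C ?E \<subseteq> undominated D C E"
    proof
      fix j assume j: "j \<in> undominated D C ?E"
      show "j \<in> undominated D C E"
      proof (rule ccontr)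
        assume "j \<notin> undominated D C E"
        then obtain c where c: "c \<in> D" "{c, j} \<in> E" "j \<in> C" using j by (auto simp: undominated_iff)
        then have "{c, j} = {x, e}" using keep j by (auto simp: undominated_iff)
        then have "j = x" using True c disj by (auto simp: doubleton_eq_iff)
        moreover obtain b where b: "b \<in> D" "b \<noteq> e" "{b, x} \<in> E"
          using e True disj by (auto simp: multidominated_def)
        ultimately have "{b, j} \<in> ?E" using keep[of b j] c x disj by (auto simp: doubleton_eq_iff)
        then show False using j b by (auto simp: undominated_iff)
      qed
    qed
    ultimately show False using fewer_undominated[OF E r] by blast
  next
    case False
    then have e': "e \<in> C" "e \<notin> W" using e by auto
    have keep': "{c, j} \<in> ?E \<longleftrightarrow> {c, j} \<in> E" if "c \<in> D" "j \<in> C" for c j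
      using that pC G(6,7) e' x disj by (auto simp: bowtie_def doubleton_eq_iff)
    then have "undominated D C ?E = undominated D C E" by (auto simp: undominated_iff)
    then have "good ?E" using good_if_undominated_subset[OF E r] G(3) by simp
    then show False using good_nbr(2)[of ?E e] e' by (simp add: bowtie_def)
  qed
qed

section \<open>The violating set inside \<open>W\<close>\<close>

definition "outer E = {x \<in> C. \<exists>w\<in>W - {u}. w \<noteq> x \<and> {w, x} \<notin> E}"

text \<open>Members of \<open>W\<close> missed by \<open>u\<close> for which
  \<open>bowtie_impossible\<close> finds no edge \<open>{x, e}\<close>: they have neither a
  neighbour in \<open>C - W\<close> nor two dominators. Leaving them out ensures that every core
  vertex missed by \<open>u\<close> supplies such an edge.\<close>

definition "neutral E = {w \<in> W - {u} - outer E. {u, w} \<notin> E \<and> nbrs E w \<inter> C \<subseteq> W \<and> \<not> multidominated D E w}"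

text \<open>A clique that is completely joined to the rest of \<open>W\<close>, with the possible
  exception of \<open>u\<close>.\<close>

definition "core E = W - {u} - outer E - neutral E"

lemma core_subset: "core E \<subseteq> C" "core E \<subseteq> W" "u \<notin> core E"
  by (auto simp: core_def W_def)

lemma core_adjacent: "w \<in> core E \<Longrightarrow> x \<in> W \<Longrightarrow> x \<noteq> u \<Longrightarrow> x \<noteq> w \<Longrightarrow> {x, w} \<in> E"
  unfolding core_def outer_def W_def by blast

lemma not_outer_adjacent: "x \<in> C \<Longrightarrow> x \<notin> outer E \<Longrightarrow> w \<in> W \<Longrightarrow> w \<noteq> u \<Longrightarrow> w \<noteq> x \<Longrightarrow> {w, x} \<in> E"
  unfolding outer_def by blast

lemma outer_closed:
  assumes t: "tight E s" and x: "x \<in> outer E"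
  shows "nbrs E x \<inter> C \<subseteq> W"
proof
  fix y assume y: "y \<in> nbrs E x \<inter> C"
  obtain w where w: "w \<in> W" "w \<noteq> u" "w \<noteq> x" "{w, x} \<notin> E" "x \<in> C"
    using x unfolding outer_def by blast
  have "{x, y} \<in> E" using y by (simp add: nbrs_iff insert_commute)
  then show "y \<in> W" using closed[OF t w(1,2,5) w(3)[symmetric] w(4)] y by blast
qed

lemma outer_not_multidominated: "tight E s \<Longrightarrow> x \<in> outer E \<Longrightarrow> \<not> multidominated D E x"
  using multidominated_adjacent unfolding outer_def by blast

text \<open>The neighbours of \<open>u\<close>, of outer and of neutral vertices within
  \<open>C\<close> all lie in \<open>W\<close>. A vertex \<open>j\<close> outside \<open>W\<close>
  is therefore adjacent to none of them, and a neighbour in \<open>W\<close> can only be a core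
  vertex.\<close>

lemma outer_nbrs_core:
  assumes t: "tight E s" and j: "j \<in> outer E" "j \<notin> W"
  shows "nbrs E j \<inter> C \<subseteq> core E"
proof
  fix w assume w: "w \<in> nbrs E j \<inter> C"
  have jC: "j \<in> C" using j by (simp add: outer_def)
  have wW: "w \<in> W" using outer_closed[OF t j(1)] w by auto
  have jw: "j \<in> nbrs E w \<inter> C" using w jC by (simp add: nbrs_iff insert_commute)
  have "w \<noteq> u" using jw good_nbr(2)[OF tightD(1)[OF t], of j] j(2) by (auto simp: nbrs_iff insert_commute)
  moreover have "w \<notin> outer E" using outer_closed[OF t, of w] jw j(2) by auto
  moreover have "w \<notin> neutral E" using jw j(2) by (auto simp: neutral_def)
  ultimately show "w \<in> core E" using wW by (simp add: core_def)
qed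

lemma root_nbrs:
  assumes t: "tight E s"
  shows "nbrs E u \<subseteq> core E \<union> outer E" "nbrs E u \<subseteq> W"
proof -
  have "w \<in> W \<and> w \<noteq> u \<and> w \<notin> neutral E" if "w \<in> nbrs E u" for w
    using good_nbr[OF tightD(1)[OF t], of w] that by (auto simp: nbrs_iff insert_commute neutral_def)
  then show "nbrs E u \<subseteq> core E \<union> outer E" "nbrs E u \<subseteq> W" by (auto simp: core_def)
qed

text \<open>Such a vertex is joined to all of \<open>core\<close>, or it is an outer vertex outside
  \<open>W\<close>, and then at most one of its edges, the one to its dominator, avoids
  \<open>core\<close>. Either way it reaches the bound that the conditions grant it.\<close>

lemma core_inner:
  assumes t: "tight E s" and j: "j \<in> C - core E" "j \<noteq> u"
  shows "min (card (core E)) (f j - 1) \<le> card (nbrs E j \<inter> core E)"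
proof (cases "j \<in> outer E \<and> j \<notin> W")
  case True
  note G = goodD[OF tightD(1)[OF t]]
  have "nbrs E j \<inter> (C - core E) = {}" using outer_nbrs_core[OF t] True by blast
  moreover have "card (nbrs E j \<inter> D) \<le> 1"
    using not_multidominated_card outer_not_multidominated[OF t] True by blast
  ultimately show ?thesis using degree_split[OF G(1) disj core_subset(1)[of E], of j] j by simp
next
  case False
  have "core E \<subseteq> nbrs E j"
  proof
    fix w assume w: "w \<in> core E"
    then have "w \<in> W" "w \<noteq> u" "w \<noteq> j" using j core_subset by blast+
    then show "w \<in> nbrs E j"
      using False core_adjacent[OF w, of j] not_outer_adjacent[of j E w] j by (auto simp: nbrs_iff insert_commute)
  qed
  then show ?thesis by (simp add: inf.absorb2)
qed

lemma core_clique: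
  "(\<Sum>w\<in>core E. card (nbrs E w \<inter> core E)) = card (core E) * (card (core E) - 1)"
  if "tight E s"
proof -
  note G = goodD[OF tightD(1)[OF that]]
  have fin: "finite (core E)" using core_subset(1) G(4) by (auto simp: graph_on_def intro: finite_subset)
  have "nbrs E w \<inter> core E = core E - {w}" if "w \<in> core E" for w
  proof
    show "nbrs E w \<inter> core E \<subseteq> core E - {w}" using nbrs_irrefl[OF G(4)] by auto
    show "core E - {w} \<subseteq> nbrs E w \<inter> core E"
      using core_adjacent[OF that] core_subset(2,3)[of E] unfolding nbrs_def by blast
  qed
  then have "(\<Sum>w\<in>core E. card (nbrs E w \<inter> core E)) = (\<Sum>w\<in>core E. card (core E) - 1)"
    using fin by (intro sum.cong) auto
  then show ?thesis by simp
qed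

text \<open>All neighbours of \<open>u\<close> are core or outer. If \<open>u\<close> misses a core
  vertex \<open>x\<close> and has two outer neighbours, then one of them, \<open>p\<close>, misses
  some \<open>v\<close> in \<open>W\<close>; once \<open>v\<close> is a neighbour of
  \<open>u\<close>, a bowtie through \<open>x\<close> and the pair \<open>v\<close>,
  \<open>p\<close> contradicts extremality.\<close>

lemma root_inner:
  assumes t: "tight E s"
  shows "min (card (core E)) (f u - 1) \<le> card (nbrs E u \<inter> core E)"
proof -
  note E = tightD[OF t]
  note G = goodD[OF E(1)]
  have finN: "finite (nbrs E u)" using finite_nbrs[OF G(4)] .
  consider "core E \<subseteq> nbrs E u" | "card (nbrs E u \<inter> outer E) \<le> 1"
    | x where "x \<in> core E" "{u, x} \<notin> E" "1 < card (nbrs E u \<inter> outer E)"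
    by (metis insert_commute nbrs_iff not_le subsetI)
  then show ?thesis
  proof cases
    case 1
    then show ?thesis by (simp add: inf.absorb2)
  next
    case 2
    have "card (nbrs E u) \<le> card ((nbrs E u \<inter> core E) \<union> (nbrs E u \<inter> outer E))"
      using root_nbrs(1)[OF t] finN by (intro card_mono) auto
    also have "\<dots> \<le> card (nbrs E u \<inter> core E) + card (nbrs E u \<inter> outer E)" by (rule card_Un_le)
    finally show ?thesis using 2 realization_card[OF G(1), of u] G(6) by simp
  next
    case 3
    have xu: "x \<noteq> u" "x \<in> W" "x \<in> C" using 3 core_subset by blast+
    \<comment> \<open>\<open>p\<close> must differ from \<open>s\<close>: if \<open>v\<close> has to
      be made a neighbour of \<open>u\<close> by \<open>reach\<close>, the edge
      \<open>{u, s}\<close> is deleted and \<open>{u, p}\<close> must survive.\<close>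
    have "\<not> nbrs E u \<inter> outer E \<subseteq> {s}"
    proof
      assume "nbrs E u \<inter> outer E \<subseteq> {s}"
      then have "card (nbrs E u \<inter> outer E) \<le> card {s}" by (intro card_mono) auto
      then show False using 3 by simp
    qed
    then obtain p where p': "p \<in> nbrs E u" "p \<in> outer E" "p \<noteq> s" by blast
    then have p: "{u, p} \<in> E" "p \<in> outer E" "p \<noteq> s" by (auto simp: nbrs_iff insert_commute)
    obtain v where v: "v \<in> W" "v \<noteq> u" "v \<noteq> p" "{v, p} \<notin> E" using p(2) by (auto simp: outer_def)
    have pW: "p \<in> W" "p \<noteq> u" using good_nbr[OF E(1) p(1)] by auto
    have "x \<noteq> p" using 3 p by auto
    then have "{x, p} \<in> E" using core_adjacent[OF 3(1) pW] by (simp add: insert_commute)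
    then have vx: "v \<noteq> x" using v by auto
    \<comment> \<open>\<open>x\<close> is missed by \<open>u\<close> and yet not neutral.\<close>
    have "(\<exists>e. {x, e} \<in> E \<and> e \<in> C \<and> e \<notin> W) \<or> multidominated D E x"
      using 3(1,2) xu(1) by (auto simp: core_def neutral_def nbrs_iff insert_commute)
    then obtain e where xe: "{x, e} \<in> E" and e: "e \<in> C \<and> e \<notin> W \<or> e \<in> D \<and> multidominated D E x"
      by (auto simp: multidominated_def insert_commute)
    have ue: "{u, e} \<notin> E" "e \<noteq> u" "e \<noteq> v"
    proof -
      show "{u, e} \<notin> E" using e good_nbr(2,4)[OF E(1), of e] by auto
      show "e \<noteq> u" using xe 3(2) by (auto simp: insert_commute)
      show "e \<noteq> v" using e v disj by (auto simp: W_def)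
    qed
    have False
    proof (cases "{u, v} \<in> E")
      case True
      show False
        using bowtie_impossible[OF E(1) xe True p(1) v(4,3) 3(2) xu(1)[symmetric] ue(1) xu(3)] e ue by blast
    next
      case False
      obtain z where z: "{z, v} \<in> E" "{z, s} \<notin> E" "z \<noteq> s" "z \<noteq> u" "s \<noteq> v" "z \<noteq> v"
        and g: "good (switch E u s v z)" "{u, v} \<in> switch E u s v z"
        using reach[OF t v(1,2) False] by metis
      let ?E = "switch E u s v z"
      have su: "s \<noteq> u" using good_nbr[OF E(1,2)] by simp
      have 1: "{x, e} \<in> ?E" using xe xu vx ue by (auto simp: switch_def doubleton_eq_iff)
      have 2: "{u, p} \<in> ?E" using p v pW z by (auto simp: switch_def doubleton_eq_iff)
      have 4: "{v, p} \<notin> ?E" using v p pW z by (auto simp: switch_def doubleton_eq_iff)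
      have 5: "{u, x} \<notin> ?E" "{u, e} \<notin> ?E" using 3(2) ue xu vx z su by (auto simp: switch_def doubleton_eq_iff)
      have "multidominated D ?E x" if "multidominated D E x"
      proof -
        have "{c, x} \<in> ?E" if "c \<in> D" "{c, x} \<in> E" for c
          using that xu vx v disj G(7) by (auto simp: switch_def doubleton_eq_iff W_def)
        then show ?thesis using that by (auto simp: multidominated_def)
      qed
      then show False
        using bowtie_impossible[OF g(1) 1 g(2) 2 4 v(3) 5(1) xu(1)[symmetric] 5(2) xu(3)] e ue by blast
    qed
    then show ?thesis ..
  qed
qed

text \<open>The case distinction between the two conditions: if \<open>D\<close> has no surplus edge
  of this kind, its total degree is the bottleneck and condition A fails; a surplus lets the
  individual degrees be the bottleneck and condition B fails.\<close>

definition "lean E \<longleftrightarrow> (\<forall>a\<in>D. \<forall>b\<in>D. {a, b} \<notin> E) \<and> (\<forall>j\<in>C - core E. \<not> multidominated D E j)"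

text \<open>With the degree sums of \<open>core\<close> and \<open>D\<close> written as edge counts,
  the clique term and the edges between \<open>D\<close> and \<open>core\<close> cancel. The rest is
  compared vertex by vertex, and \<open>u\<close>, which has no edge to \<open>D\<close>, makes the
  comparison strict.\<close>

lemma lean_violates_A:
  assumes t: "tight E s" and lean: "lean E"
  shows "\<not> cond_A D C f (core E)"
proof -
  note G = goodD[OF tightD(1)[OF t]]
  let ?W = "core E"
  have fin: "finite C" using G(4) unfolding graph_on_def by simp
  have "(\<Sum>i\<in>D. card (nbrs E i \<inter> D)) = 0"
    using lean unfolding lean_def nbrs_def by (intro sum.neutral) (metis (no_types, lifting) Int_emptyI card.empty mem_Collect_eq)
  moreover have "(\<Sum>j\<in>C - ?W. min (card ?W) (f j - 1) + card (nbrs E j \<inter> D))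
      < (\<Sum>j\<in>C - ?W. card (nbrs E j \<inter> ?W) + 1)"
  proof (rule sum_strict_mono_ex1)
    show "\<forall>j\<in>C - ?W. min (card ?W) (f j - 1) + card (nbrs E j \<inter> D) \<le> card (nbrs E j \<inter> ?W) + 1"
    proof
      fix j assume j: "j \<in> C - ?W"
      have "card (nbrs E j \<inter> D) \<le> 1" using lean j not_multidominated_card by (auto simp: lean_def)
      then show "min (card ?W) (f j - 1) + card (nbrs E j \<inter> D) \<le> card (nbrs E j \<inter> ?W) + 1"
        using core_inner[OF t j] root_inner[OF t] by (cases "j = u") auto
    qed
    have "nbrs E u \<inter> D = {}" using G(8) by (auto simp: nbrs_def)
    then show "\<exists>j\<in>C - ?W. min (card ?W) (f j - 1) + card (nbrs E j \<inter> D) < card (nbrs E j \<inter> ?W) + 1"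
      using root_inner[OF t] G(6) core_subset(3) by (intro bexI[of _ u]) (auto simp: less_Suc_eq_le)
  qed (use fin in simp)
  ultimately show ?thesis
    unfolding cond_A_def using sum_degree_W[OF G(1) disj core_subset(1)[of E]]
      sum_degree_D[OF G(1) disj core_subset(1)[of E]] core_clique[OF t]
    by (simp add: sum.distrib sum_Suc)
qed

text \<open>\<open>y\<close> gets the dominator \<open>a\<close> for \<open>i\<close>, and
  \<open>b\<close> gets \<open>i\<close> for \<open>a\<close>, so nobody becomes undominated. In
  effect an edge of \<open>i\<close> moves to the place of an edge of \<open>a\<close>.\<close>

lemma rematch_good:
  assumes E: "good E" and i: "i \<in> D" "y \<in> C" "{i, y} \<in> E" "\<not> multidominated D E y"
    and a: "a \<in> D" "a \<noteq> i" "{b, a} \<in> E" "{i, b} \<notin> E" "i \<noteq> b"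
  shows "good (switch E i y b a)"
proof -
  let ?E = "switch E i y b a"
  note G = goodD[OF E]
  have ya: "{y, a} \<notin> E" "y \<noteq> a" using i a disj by (auto simp: multidominated_def insert_commute)
  have r: "realization (D \<union> C) ?E f"
    by (rule realization_switch[OF G(1) i(3) a(3,4) ya(1) a(5) ya(2)])
  have yu: "y \<noteq> u" "b \<noteq> u" using i a G(8) by auto
  have sub: "undominated D C ?E \<subseteq> undominated D C E"
  proof
    fix j assume j: "j \<in> undominated D C ?E"
    show "j \<in> undominated D C E"
    proof (rule ccontr)
      assume "j \<notin> undominated D C E"
      then obtain c where c: "c \<in> D" "{c, j} \<in> E" "j \<in> C" "{c, j} \<notin> ?E"
        using undominated_cases[OF j] by metis
      then have "{c, j} = {i, y} \<or> {c, j} = {b, a}" by (auto simp: switch_def)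
      then have "j = y \<or> j = b" using c i a disj by (auto simp: doubleton_eq_iff)
      then have "{a, j} \<in> ?E \<or> {i, j} \<in> ?E" by (auto simp: switch_def insert_commute)
      then show False using j i a by (auto simp: undominated_iff)
    qed
  qed
  have "u \<in> undominated D C ?E"
    using G(3,7) yu i a(1) by (auto simp: undominated_iff switch_def doubleton_eq_iff)
  then show ?thesis using good_if_undominated_subset[OF E r sub] by blast
qed

text \<open>The surplus removes outer vertices from \<open>W - {u}\<close> and forces each
  \<open>i\<close> in \<open>D\<close> to be joined to all of \<open>core\<close> or to nothing
  else. All bounds in condition B are then attained, and \<open>u\<close> even exceeds the
  \<open>f u - 1\<close> edges granted to it.\<close>

lemma fat_violates_B:
  assumes t: "tight E s" and fat: "\<not> lean E"
  shows "\<not> cond_B D C f (core E)"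
proof -
  note E = tightD[OF t]
  note G = goodD[OF E(1)]
  let ?W = "core E"
  have u_single: "\<not> multidominated D E u" using G(8) by (auto simp: multidominated_def)
  have in_core: "q \<in> ?W" if "multidominated D E q" "q \<in> W" for q
    using that u_single outer_not_multidominated[OF t] by (auto simp: core_def neutral_def)
  have excess: "(\<exists>a\<in>D. \<exists>b\<in>D. {a, b} \<in> E) \<or> (\<exists>q\<in>C. q \<notin> W \<and> multidominated D E q)"
    using fat in_core by (auto simp: lean_def)
  \<comment> \<open>An outer \<open>v\<close> in \<open>W\<close> would be adjacent to both ends of
    a surplus edge inside \<open>D\<close> and so be dominated twice; for a surplus at
    \<open>q\<close>, some dominator of \<open>q\<close> misses \<open>v\<close>, and
    \<open>closed_D\<close> would put \<open>q\<close> into \<open>W\<close>.\<close>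
  have no_outer: "v = u" if v: "v \<in> W" "v \<in> outer E" for v
  proof (rule ccontr)
    assume vu: "v \<noteq> u"
    have vm: "\<not> multidominated D E v" using outer_not_multidominated[OF t v(2)] .
    from excess show False
    proof
      assume "\<exists>a\<in>D. \<exists>b\<in>D. {a, b} \<in> E"
      then obtain a b where ab: "a \<in> D" "b \<in> D" "{a, b} \<in> E" by blast
      then have "{v, b} \<in> E" "{v, a} \<in> E" using inner_adjacent[OF t v(1) vu] by (auto simp: insert_commute)
      moreover have "a \<noteq> b" using graph_on_edge(3)[OF G(4) ab(3)] .
      ultimately show False using vm ab by (auto simp: multidominated_def insert_commute)
    next
      assume "\<exists>q\<in>C. q \<notin> W \<and> multidominated D E q"
      then obtain q where q: "q \<in> C" "q \<notin> W" "multidominated D E q" by blast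
      obtain a where "a \<in> D" "{a, q} \<in> E" "{a, v} \<notin> E" using q(3) vm by (auto simp: multidominated_def)
      then show False using closed_D(2)[OF t v(1) vu, of a q] q by (auto simp: insert_commute)
    qed
  qed
  have u_core: "nbrs E u \<subseteq> ?W"
    using root_nbrs[OF t] no_outer nbrs_irrefl[OF G(4)] by blast
  have D_core: "min (card ?W) (f i) \<le> card (nbrs E i \<inter> ?W)" if i: "i \<in> D" for i
  proof (cases "?W \<subseteq> nbrs E i")
    case True
    then show ?thesis by (simp add: inf.absorb2)
  next
    case False
    then obtain w where w: "w \<in> ?W" "{w, i} \<notin> E" unfolding nbrs_def by blast
    have wW: "w \<in> W" "w \<noteq> u" using w core_subset by blast+
    have wD: "w \<notin> D" using wW disj by (auto simp: W_def)
    have "y \<in> ?W" if "y \<in> nbrs E i" for y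
    proof -
      have yi: "{y, i} \<in> E" "{i, y} \<in> E" using that by (auto simp: nbrs_iff insert_commute)
      have yC: "y \<in> C" using closed_D(1)[OF t wW i w(2) yi(1)] .
      show ?thesis
      proof (cases "multidominated D E y")
        case True
        then show ?thesis using closed_D(2)[OF t wW i w(2) yi(1)] in_core by blast
      next
        case ym: False
        \<comment> \<open>The edge from \<open>i\<close> to \<open>y\<close> is moved to the place
          of the surplus. The realization stays tight, so \<open>inner_adjacent\<close> and
          \<open>closed_D\<close> apply to it, and one of them is contradicted there.\<close>
        have keep: "tight (switch E i y b a) s"
          if "a \<in> D" "a \<noteq> i" "{b, a} \<in> E" "{i, b} \<notin> E" "i \<noteq> b" for a b
        proof -
          have "good (switch E i y b a)" using rematch_good[OF E(1) i yC yi(2) ym that] .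
          moreover have "{u, s} \<in> switch E i y b a"
            using E(2) G(7) good_nbr[OF E(1,2)] i that by (auto simp: switch_def doubleton_eq_iff)
          ultimately show ?thesis using E unfolding tight_def by blast
        qed
        from excess have False
        proof
          assume "\<exists>a\<in>D. \<exists>b\<in>D. {a, b} \<in> E"
          then obtain a b where ab: "a \<in> D" "b \<in> D" "{b, a} \<in> E" by (auto simp: insert_commute)
          have iD: "{c, i} \<notin> E" if "c \<in> D" for c using inner_adjacent[OF t wW i that] w by auto
          have ne: "a \<noteq> i" "i \<noteq> b" "{i, b} \<notin> E" using ab iD by (auto simp: insert_commute)
          have t': "tight (switch E i y b a) s" using keep[OF ab(1) ne(1) ab(3) ne(3,2)] .
          have "{b, i} \<in> switch E i y b a" by (auto simp: switch_def insert_commute)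
          then have "{w, i} \<in> switch E i y b a" using inner_adjacent[OF t' wW i ab(2)] by simp
          then show False using w wW ab ne i yC disj by (auto simp: switch_def doubleton_eq_iff W_def)
        next
          assume "\<exists>q\<in>C. q \<notin> W \<and> multidominated D E q"
          then obtain q where q: "q \<in> C" "q \<notin> W" "multidominated D E q" by blast
          have iq: "{i, q} \<notin> E" using closed_D(2)[OF t wW i w(2), of q] q by (auto simp: insert_commute)
          obtain a c where ac: "a \<in> D" "{q, a} \<in> E" "c \<in> D" "{c, q} \<in> E" "a \<noteq> c"
            using q(3) by (auto simp: multidominated_def insert_commute)
          have ne: "a \<noteq> i" "i \<noteq> q" "c \<noteq> i" "y \<noteq> q" using ac iq i q ym disj by (auto simp: insert_commute)
          have t': "tight (switch E i y q a) s" using keep[OF ac(1) ne(1) ac(2) iq ne(2)] .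
          have "{i, q} \<in> switch E i y q a" by (auto simp: switch_def)
          moreover have "{c, q} \<in> switch E i y q a" using ac ne by (auto simp: switch_def doubleton_eq_iff)
          ultimately have "multidominated D (switch E i y q a) q" using ac ne i by (auto simp: multidominated_def)
          moreover have "{w, i} \<notin> switch E i y q a" using w wW wD q ac ne yC disj by (auto simp: switch_def doubleton_eq_iff)
          moreover have "{q, i} \<in> switch E i y q a" by (auto simp: switch_def insert_commute)
          ultimately show False using closed_D(2)[OF t' wW i, of q] q(2) by blast
        qed
        then show ?thesis ..
      qed
    qed
    then have "nbrs E i \<inter> ?W = nbrs E i" by blast
    then show ?thesis using realization_card[OF G(1), of i] i by simp
  qed
  have fin: "finite C" using G(4) unfolding graph_on_def by simp
  \<comment> \<open>The strict term: \<open>u\<close> needs no edge to \<open>D\<close> and spends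
    its whole degree in \<open>core\<close>. Positivity makes the truncated \<open>f u - 1\<close>
    smaller than \<open>f u\<close>.\<close>
  have fu: "card (nbrs E u \<inter> ?W) = f u" "0 < f u"
    using u_core realization_card[OF G(1), of u] G(6) pos by (auto simp: inf.absorb1)
  have "(\<Sum>j\<in>C - ?W. min (card ?W) (f j - 1)) < (\<Sum>j\<in>C - ?W. card (nbrs E j \<inter> ?W))"
  proof (rule sum_strict_mono_ex1)
    show "\<forall>j\<in>C - ?W. min (card ?W) (f j - 1) \<le> card (nbrs E j \<inter> ?W)"
      using core_inner[OF t] root_inner[OF t] by blast
    show "\<exists>j\<in>C - ?W. min (card ?W) (f j - 1) < card (nbrs E j \<inter> ?W)"
      using fu G(6) core_subset(3) by (intro bexI[of _ u]) auto
  qed (use fin in simp)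
  moreover have "(\<Sum>i\<in>D. min (card ?W) (f i)) \<le> (\<Sum>i\<in>D. card (nbrs E i \<inter> ?W))"
    using D_core by (rule sum_mono)
  ultimately show ?thesis
    unfolding cond_B_def using sum_degree_W[OF G(1) disj core_subset(1)[of E]] core_clique[OF t] by simp
qed

end

text \<open>If \<open>f\<close> is infeasible, the least number \<open>m\<close> of undominated
  vertices is positive. Then \<open>m\<close>, \<open>u\<close> and \<open>s\<close> are fixed in
  this order, each extremal among the realizations left by the previous choices, and a final
  realization is tight for all three.\<close>

theorem feasible_if_conds:
  assumes disj: "D \<inter> C = {}" and pos: "\<And>j. j \<in> C \<Longrightarrow> 0 < f j"
    and real: "\<exists>E. realization (D \<union> C) E f"
    and A: "\<And>W. W \<subseteq> C \<Longrightarrow> cond_A D C f W" and B: "\<And>W. W \<subseteq> C \<Longrightarrow> cond_B D C f W"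
  shows "feasible D C f"
proof (rule ccontr)
  assume neg: "\<not> feasible D C f"
  let ?R = "\<lambda>E. realization (D \<union> C) E f" and ?U = "undominated D C"
  obtain E0 where E0: "?R E0" "\<And>E. ?R E \<Longrightarrow> card (?U E0) \<le> card (?U E)"
    using ex_has_least_nat[of ?R _ "\<lambda>E. card (?U E)"] real by blast
  define m where "m = card (?U E0)"
  have finC: "finite C" using E0(1) unfolding realization_def graph_on_def by simp
  have "?U E0 \<noteq> {}" using neg E0(1) unfolding feasible_def undominated_def by blast
  then obtain x0 where x0: "x0 \<in> ?U E0" by blast
  let ?P = "\<lambda>x. \<exists>E. ?R E \<and> card (?U E) \<le> m \<and> x \<in> ?U E"
  have "\<exists>u. ?P u \<and> (\<forall>x. ?P x \<longrightarrow> f x \<le> f u)"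
  proof (rule Lattices_Big.ex_has_greatest_nat)
    show "?P x0" using E0(1) x0 m_def by auto
    show "\<forall>x. ?P x \<longrightarrow> f x < Suc (Max (f ` C))" using finC by (auto simp: undominated_iff less_Suc_eq_le)
  qed
  then obtain u where u: "?P u" "\<And>x. ?P x \<Longrightarrow> f x \<le> f u" by blast
  let ?Q = "\<lambda>w. \<exists>E. ?R E \<and> card (?U E) \<le> m \<and> u \<in> ?U E \<and> {u, w} \<in> E"
  obtain E1 where E1: "?R E1" "card (?U E1) \<le> m" "u \<in> ?U E1" using u by blast
  have uC: "u \<in> C" using E1(3) by (simp add: undominated_iff)
  \<comment> \<open>Positive degree is what gives \<open>u\<close> a neighbour at all, so that a
    least one exists.\<close>
  then have "card (nbrs E1 u) > 0" using realization_card[OF E1(1), of u] pos by simp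
  then obtain w0 where "w0 \<in> nbrs E1 u" by (metis card.empty ex_in_conv less_irrefl)
  then have "?Q w0" using E1 by (auto simp: nbrs_iff insert_commute)
  then obtain s where s: "?Q s" "\<And>w. ?Q w \<Longrightarrow> f s \<le> f w"
    using ex_has_least_nat[of ?Q w0 f] by blast
  interpret extremal D C f m u "f s"
    by (rule extremal.intro[OF disj pos]) (use E0(2) m_def u(2) s(2) in blast)+
  obtain E where "tight E s" using s(1) unfolding tight_def good_def by blast
  then show False
    using lean_violates_A fat_violates_B A B core_subset(1) by blast
qed

section \<open>The neighbourhood of a pivot\<close>

lemma ex_switch_neighbour:
  assumes r: "realization V E f" and V: "x \<in> V" "y \<in> V" and u: "{u, y} \<in> E" "{u, x} \<notin> E" "x \<noteq> u" and le: "f y \<le> f x"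
  obtains z where "{z, x} \<in> E" "{z, y} \<notin> E" "z \<noteq> y" "z \<noteq> u" "realization V (switch E u y x z) f"
    "nbrs (switch E u y x z) u = insert x (nbrs E u - {y})"
proof -
  have g: "graph_on V E" using r realization_graph by blast
  have "u \<in> nbrs E y - insert x (nbrs E x)" using u by (simp add: nbrs_iff)
  then have "0 < card (nbrs E y - insert x (nbrs E x))" using finite_nbrs[OF g] by (auto simp: card_gt_0_iff)
  then have "0 < card (nbrs E x - insert y (nbrs E y))" using card_Diff_nbrs[OF r V] le by linarith
  then have "nbrs E x - insert y (nbrs E y) \<noteq> {}" by (metis card.empty less_irrefl)
  then obtain z where "z \<in> nbrs E x - insert y (nbrs E y)" by blast
  then have z: "{z, x} \<in> E" "{z, y} \<notin> E" "z \<noteq> y" by (auto simp: nbrs_iff)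
  have zu: "z \<noteq> u" using z u by auto
  have xz: "{x, z} \<in> E" "{y, z} \<notin> E" using z by (auto simp: insert_commute)
  have "realization V (switch E u y x z) f"
    by (rule realization_switch[OF r u(1) xz(1) u(2) xz(2) u(3)[symmetric] z(3)[symmetric]])
  moreover have "nbrs (switch E u y x z) u = insert x (nbrs E u - {y})"
    using u z zu graph_on_edge(3)[OF g u(1)]
    by (auto simp: nbrs_def switch_def doubleton_eq_iff insert_commute)
  ultimately show ?thesis using that z zu by blast
qed

definition dec :: "(nat \<Rightarrow> nat) \<Rightarrow> nat set \<Rightarrow> nat \<Rightarrow> nat" where
  "dec f S v = (if v \<in> S then f v - 1 else f v)"

definition delete :: "nat \<Rightarrow> nat set set \<Rightarrow> nat set set" where
  "delete u E = {e \<in> E. u \<notin> e}"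

lemma nbrs_delete: "v \<noteq> u \<Longrightarrow> nbrs (delete u E) v = nbrs E v - {u}"
  by (auto simp: nbrs_def delete_def)

lemma realization_delete:
  assumes r: "realization V E f"
  shows "realization (V - {u}) (delete u E) (dec f (nbrs E u))"
proof -
  have g: "graph_on V E" using r realization_graph by blast
  have "graph_on (V - {u}) (delete u E)" using g unfolding graph_on_def delete_def by auto
  moreover have "card (nbrs (delete u E) v) = dec f (nbrs E u) v" if "v \<in> V - {u}" for v
    using that nbrs_delete[of v u E] realization_card[OF r, of v] finite_nbrs[OF g, of v]
    by (auto simp: dec_def nbrs_sym)
  ultimately show ?thesis unfolding realization_def by blast
qed

text \<open>The inverse of \<open>realization_delete\<close>. Degrees on \<open>S\<close> have to be
  positive because \<open>dec\<close> truncates at 0.\<close>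

lemma realization_insert:
  assumes r: "realization (V - {u}) E (dec f S)" and V: "u \<in> V" "S \<subseteq> V - {u}"
    and S: "card S = f u" "\<And>v. v \<in> S \<Longrightarrow> 0 < f v"
  defines "E' \<equiv> E \<union> (\<lambda>v. {u, v}) ` S"
  shows "realization V E' f" "nbrs E' u = S" "\<And>v. v \<noteq> u \<Longrightarrow> nbrs E v \<subseteq> nbrs E' v"
proof -
  have g: "graph_on (V - {u}) E" using r realization_graph by blast
  have nu: "u \<notin> nbrs E v" for v using nbrs_subset[OF g, of v] by auto
  have ne: "nbrs E u = {}" using nu by (auto simp: nbrs_sym[of _ E u])
  show nb: "nbrs E' u = S"
    using V ne unfolding E'_def by (auto simp: nbrs_def doubleton_eq_iff)
  have nb': "nbrs E' v = nbrs E v \<union> (if v \<in> S then {u} else {})" if "v \<noteq> u" for v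
    using that V unfolding E'_def by (auto simp: nbrs_def doubleton_eq_iff)
  then show "\<And>v. v \<noteq> u \<Longrightarrow> nbrs E v \<subseteq> nbrs E' v" by auto
  have "graph_on V E'" using g V unfolding graph_on_def E'_def by (auto simp: card_insert_if)
  moreover have "card (nbrs E' v) = f v" if "v \<in> V" for v
  proof (cases "v = u")
    case False
    then show ?thesis using nb'[OF False] nu[of v] realization_card[OF r, of v] that S(2)[of v] finite_nbrs[OF g, of v]
      by (auto simp: dec_def)
  qed (use nb S in simp)
  ultimately show "realization V E' f" unfolding realization_def by blast
qed

definition dominated :: "nat set \<Rightarrow> nat set \<Rightarrow> (nat \<Rightarrow> nat) \<Rightarrow> nat set set \<Rightarrow> bool" where
  "dominated D C f E \<longleftrightarrow> realization (D \<union> C) E f \<and> (\<forall>j\<in>C. \<exists>a\<in>D. {a, j} \<in> E)"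

lemma feasible_iff: "feasible D C f \<longleftrightarrow> (\<exists>E. dominated D C f E)"
proof -
  have "(\<forall>j\<in>C. nbrs E j \<inter> D \<noteq> {}) \<longleftrightarrow> (\<forall>j\<in>C. \<exists>a\<in>D. {a, j} \<in> E)" for E
    unfolding nbrs_def by blast
  then show ?thesis unfolding feasible_def dominated_def by simp
qed

lemma feasible_delete:
  assumes E: "dominated D C f E" and disj: "D \<inter> C = {}" and u: "u \<in> C"
  shows "feasible D (C - {u}) (dec f (nbrs E u))"
proof -
  have "D \<union> (C - {u}) = (D \<union> C) - {u}" using disj u by auto
  moreover have "\<exists>a\<in>D. {a, j} \<in> delete u E" if j: "j \<in> C - {u}" for j
  proof -
    obtain a where "a \<in> D" "{a, j} \<in> E" using E j unfolding dominated_def by blast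
    then show ?thesis using j u disj unfolding delete_def by blast
  qed
  ultimately show ?thesis unfolding feasible_iff dominated_def
    using realization_delete[of "D \<union> C" E f u] E unfolding dominated_def by auto
qed

text \<open>The switch moves a further vertex \<open>z\<close> from \<open>x\<close> to
  \<open>y\<close>. If \<open>x\<close> is in \<open>D\<close>, then so is \<open>y\<close>, and
  \<open>z\<close> at worst changes its dominator. If both are in \<open>C\<close>,
  \<open>ex_switchable_nbr\<close> finds a harmless \<open>z\<close>, as \<open>y\<close> is
  dominated. In the mixed case, the strict inequality gives two candidates for \<open>z\<close>: one
  is in \<open>C\<close>, or \<open>x\<close> is dominated twice; and \<open>u\<close> can afford to
  lose \<open>y\<close>.\<close>

lemma dominated_exchange:
  assumes E: "dominated D C f E" and disj: "D \<inter> C = {}" and u: "u \<in> C"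
    and x: "{u, x} \<notin> E" "x \<noteq> u" and y: "{u, y} \<in> E"
    and xy: "x \<in> D \<and> y \<in> D \<and> f y \<le> f x \<or> x \<in> C \<and> y \<in> C \<and> f y \<le> f x \<or>
      x \<in> C \<and> y \<in> D \<and> f y < f x \<and> multidominated D E u"
  obtains E' where "dominated D C f E'" "nbrs E' u = insert x (nbrs E u - {y})"
proof -
  have r: "realization (D \<union> C) E f" and dom: "\<And>j. j \<in> C \<Longrightarrow> \<exists>a\<in>D. {a, j} \<in> E"
    using E unfolding dominated_def by auto
  have g: "graph_on (D \<union> C) E" using r realization_graph by blast
  have V: "x \<in> D \<union> C" "y \<in> D \<union> C" and le: "f y \<le> f x" using xy by auto
  obtain z where z: "{z, x} \<in> E" "{z, y} \<notin> E" "z \<noteq> y" "z \<in> C \<or> x \<in> D \<or> multidominated D E x"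
  proof (cases "x \<in> D")
    case True
    then show ?thesis using ex_switch_neighbour[OF r V y x le] that by metis
  next
    case xD: False
    show ?thesis
    proof (cases "y \<in> C")
      case True
      have "y \<notin> undominated D C E" using dom[OF True] by (auto simp: undominated_iff)
      then show ?thesis using ex_switchable_nbr[OF r disj _ True u le y x(1)] x(2) xD V that by blast
    next
      case False
      then have lt: "f y < f x" using xy xD by blast
      let ?Y = "nbrs E y - insert x (nbrs E x)" and ?Z = "nbrs E x - insert y (nbrs E y)"
      have "u \<in> ?Y" using x y by (simp add: nbrs_iff)
      then have "0 < card ?Y" using finite_nbrs[OF g] by (auto simp: card_gt_0_iff)
      then have "1 < card ?Z" using card_Diff_nbrs[OF r V] lt by linarith
      then have "\<not> card ?Z \<le> Suc 0" by simp
      then obtain z z' where zz: "z \<in> ?Z" "z' \<in> ?Z" "z \<noteq> z'"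
        using card_le_Suc0_iff_eq[of ?Z] finite_nbrs[OF g] by blast
      then have zz': "{z, x} \<in> E" "{z', x} \<in> E" "{z, y} \<notin> E" "z \<noteq> y" "{z', y} \<notin> E" "z' \<noteq> y"
        by (auto simp: nbrs_iff)
      then have "z \<in> D \<union> C" "z' \<in> D \<union> C" using graph_on_edge(1)[OF g] by blast+
      then have "z \<in> C \<or> z' \<in> C \<or> multidominated D E x" using zz zz' unfolding multidominated_def by blast
      then show ?thesis using that zz' by blast
    qed
  qed
  let ?E = "switch E u y x z"
  have ne: "z \<noteq> u" "u \<noteq> y" "z \<noteq> x" using z x y graph_on_edge(3)[OF g] by (metis, metis, metis)
  have xz: "{x, z} \<in> E" "{y, z} \<notin> E" using z by (auto simp: insert_commute)
  have r': "realization (D \<union> C) ?E f"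
    by (rule realization_switch[OF r y xz(1) x(1) xz(2) x(2)[symmetric] z(3)[symmetric]])
  have nb: "nbrs ?E u = insert x (nbrs E u - {y})"
    using x y z ne by (auto simp: nbrs_def switch_def doubleton_eq_iff insert_commute)
  have "\<exists>a\<in>D. {a, j} \<in> ?E" if j: "j \<in> C" for j
  proof -
    obtain a where a: "a \<in> D" "{a, j} \<in> E" using dom[OF j] by blast
    have keep: "{b, j} \<in> ?E" if "b \<in> D" "{b, j} \<in> E" "{b, j} \<noteq> {u, y}" "{b, j} \<noteq> {x, z}" for b
      using that by (simp add: switch_def)
    consider "{a, j} \<noteq> {u, y}" "{a, j} \<noteq> {x, z}" | "{a, j} = {u, y}" | "{a, j} = {x, z}" by blast
    then show ?thesis
    proof cases
      case 1
      then show ?thesis using keep a by blast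
    next
      case 2
      then have ju: "j = u" "a = y" using a u disj j by (auto simp: doubleton_eq_iff)
      show ?thesis
      proof (cases "x \<in> D")
        case True
        then show ?thesis using ju by (auto simp: switch_def insert_commute)
      next
        case False
        then have "multidominated D E u" using xy a ju disj by auto
        then obtain b where b: "b \<in> D" "b \<noteq> y" "{b, u} \<in> E" unfolding multidominated_def by blast
        have "b \<noteq> u" using b u disj by auto
        then have "{b, u} \<in> ?E" using b ne x by (auto simp: switch_def doubleton_eq_iff)
        then show ?thesis using b ju by blast
      qed
    next
      case 3
      then consider "j = z" "a = x" | "j = x" "a = z" by (auto simp: doubleton_eq_iff)
      then show ?thesis
      proof cases
        case 1
        then have "y \<in> D" using a xy disj by auto
        then show ?thesis using 1 by (auto simp: switch_def)
      next
        case 2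
        then have "multidominated D E x" using z(4) a j disj by auto
        then obtain b where b: "b \<in> D" "b \<noteq> z" "{b, x} \<in> E" unfolding multidominated_def by blast
        have "b \<noteq> u" "b \<noteq> x" using b u j 2 disj by auto
        then have "{b, x} \<in> ?E" using b ne x by (auto simp: switch_def doubleton_eq_iff)
        then show ?thesis using b 2 by blast
      qed
    qed
  qed
  then have "dominated D C f ?E" using r' unfolding dominated_def by blast
  then show ?thesis using that nb by blast
qed

lemma sum_dec:
  assumes "finite X" "\<And>v. v \<in> X \<inter> S \<Longrightarrow> 0 < f v"
  shows "sum (dec f S) X + card (X \<inter> S) = sum f X"
proof -
  have "sum f X = (\<Sum>v\<in>X. dec f S v + (if v \<in> S then 1 else 0))"
    using assms(2) by (intro sum.cong) (auto simp: dec_def)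
  also have "\<dots> = sum (dec f S) X + card (X \<inter> S)" using assms(1) by (simp add: sum.distrib sum.If_cases)
  finally show ?thesis by simp
qed

lemma sum_dec_ge: "finite X \<Longrightarrow> sum f X \<le> sum (dec f S) X + card (X \<inter> S)"
proof -
  assume X: "finite X"
  have "sum f X \<le> (\<Sum>v\<in>X. dec f S v + (if v \<in> S then 1 else 0))"
    by (intro sum_mono) (auto simp: dec_def)
  also have "\<dots> = sum (dec f S) X + card (X \<inter> S)" using X by (simp add: sum.distrib sum.If_cases)
  finally show ?thesis .
qed

text \<open>Each vertex of \<open>X\<close>, newly served in \<open>C\<close>, returns one unit to
  \<open>sum f D\<close>. In \<open>W\<close> it also lowers the left-hand side, and in
  \<open>C - W\<close> it costs at most one unit on the right. The slack can only grow.\<close>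

lemma cond_A_mono:
  assumes A: "cond_A D C (dec f M1) W" and W: "W \<subseteq> C" and fin: "finite D" "finite C" and disj: "D \<inter> C = {}"
    and M: "M1 \<subseteq> D \<union> C" "M2 \<subseteq> D \<union> C" "card M1 = card M2" "M1 \<inter> C \<subseteq> M2"
    and pos: "\<And>j. j \<in> C \<Longrightarrow> 0 < f j" "\<And>i. i \<in> M1 \<inter> D \<Longrightarrow> 0 < f i"
  shows "cond_A D C (dec f M2) W"
proof -
  define X where "X = (M2 - M1) \<inter> C"
  have finW: "finite W" "finite X" using W fin finite_subset unfolding X_def by auto
  have split: "card M = card (D \<inter> M) + card (C \<inter> M)" if "M \<subseteq> D \<union> C" for M
  proof -
    have "M = (D \<inter> M) \<union> (C \<inter> M)" using that by auto
    then have "card M = card ((D \<inter> M) \<union> (C \<inter> M))" by simp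
    also have "\<dots> = card (D \<inter> M) + card (C \<inter> M)" using fin disj by (intro card_Un_disjoint) auto
    finally show ?thesis .
  qed
  have "C \<inter> M2 = (C \<inter> M1) \<union> X" using M(4) unfolding X_def by auto
  then have "card (C \<inter> M2) = card (C \<inter> M1) + card X"
    using fin by (simp add: card_Un_disjoint X_def disjoint_iff)
  then have cD: "card (D \<inter> M1) = card (D \<inter> M2) + card X" using split[OF M(1)] split[OF M(2)] M(3) by simp
  have D: "sum (dec f M1) D + card X \<le> sum (dec f M2) D"
    using sum_dec[OF fin(1), of M1 f] pos(2) sum_dec_ge[OF fin(1), of f M2] cD by (simp add: Int_commute)
  have d12: "dec f M1 j = dec f M2 j + (if j \<in> X then 1 else 0)" if "j \<in> C" for j
    using that pos(1)[OF that] M(4) unfolding X_def dec_def by auto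
  have "sum (dec f M1) W = (\<Sum>j\<in>W. dec f M2 j + (if j \<in> X then 1 else 0))"
    using d12 W by (intro sum.cong) auto
  then have W1: "sum (dec f M1) W = sum (dec f M2) W + card (W \<inter> X)"
    using finW by (simp add: sum.distrib sum.If_cases)
  have "(\<Sum>j\<in>C - W. min (card W) (dec f M1 j - 1)) \<le>
      (\<Sum>j\<in>C - W. min (card W) (dec f M2 j - 1) + (if j \<in> X then 1 else 0))"
    using d12 by (intro sum_mono) auto
  then have W2: "(\<Sum>j\<in>C - W. min (card W) (dec f M1 j - 1)) \<le>
      (\<Sum>j\<in>C - W. min (card W) (dec f M2 j - 1)) + card ((C - W) \<inter> X)"
    using fin by (simp add: sum.distrib sum.If_cases)
  have "card X = card ((W \<inter> X) \<union> ((C - W) \<inter> X))" using W unfolding X_def by (intro arg_cong[of _ _ card]) auto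
  also have "\<dots> = card (W \<inter> X) + card ((C - W) \<inter> X)" using finW fin by (intro card_Un_disjoint) auto
  finally show ?thesis using A D W1 W2 unfolding cond_A_def by linarith
qed

text \<open>A missing edge lowers the sum of inner degrees by two, more than the tolerated
  one.\<close>

lemma clique_if_inner:
  assumes g: "graph_on V E" and W: "finite W" and inner: "card W * (card W - 1) \<le> (\<Sum>w\<in>W. card (nbrs E w \<inter> W)) + 1"
    and x: "x \<in> W" "y \<in> W" "x \<noteq> y"
  shows "{x, y} \<in> E"
proof (rule ccontr)
  assume n: "{x, y} \<notin> E"
  have le: "card (nbrs E w \<inter> W) \<le> card W - 1" if "w \<in> W" for w
  proof -
    have "nbrs E w \<inter> W \<subseteq> W - {w}" using nbrs_irrefl[OF g] by auto
    then have "card (nbrs E w \<inter> W) \<le> card (W - {w})" using W by (intro card_mono) auto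
    then show ?thesis using that W by simp
  qed
  have two: "card (nbrs E w \<inter> W) + 1 \<le> card W - 1" if "w \<in> {x, y}" for w
  proof -
    have "nbrs E w \<inter> W \<subseteq> W - {x, y}" using nbrs_irrefl[OF g] n that by (auto simp: nbrs_iff insert_commute)
    then have "card (nbrs E w \<inter> W) \<le> card (W - {x, y})" using W by (intro card_mono) auto
    also have "card (W - {x, y}) = card W - 2" using x W by (subst card_Diff_subset) auto
    moreover have "card {x, y} \<le> card W" using x W by (intro card_mono) auto
    ultimately show ?thesis using x by simp
  qed
  have "(\<Sum>w\<in>W. card (nbrs E w \<inter> W) + (if w \<in> {x, y} then 1 else 0)) \<le> (\<Sum>w\<in>W. card W - 1)"
    using le two by (intro sum_mono) auto
  moreover have "W \<inter> {x, y} = {x, y}" using x by auto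
  ultimately have "(\<Sum>w\<in>W. card (nbrs E w \<inter> W)) + 2 \<le> card W * (card W - 1)"
    using W x(3) by (simp add: sum.distrib sum.If_cases card_2_iff del: insert_iff) (simp add: card_insert_if)
  then show False using inner by simp
qed

text \<open>Moving one unit of demand from \<open>x \<in> D\<close> to \<open>y \<in> C\<close> preserves condition B, because a violated
  inequality would force \<open>y\<close> to have larger degree than \<open>u\<close>.\<close>

lemma cond_B_exchange:
  assumes E: "dominated D C f E" and disj: "D \<inter> C = {}" and u: "u \<in> C" "\<And>j. j \<in> C \<Longrightarrow> f j \<le> f u"
    and x: "x \<in> D" "{x, u} \<notin> E" and y: "y \<in> C" "{y, u} \<in> E" and le: "f y \<le> f x"
    and D_ge: "\<And>v. v \<in> nbrs E u \<inter> D \<Longrightarrow> f x \<le> f v"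
    and C_ge: "\<And>v. v \<in> nbrs E u \<inter> C \<Longrightarrow> f y \<le> f v"
    and W: "W \<subseteq> C - {u}"
  shows "cond_B D (C - {u}) (dec f (insert x (nbrs E u - {y}))) W"
proof (rule ccontr)
  assume neg: "\<not> ?thesis"
  let ?N = "nbrs E u" and ?E = "delete u E" and ?C = "C - {u}" and ?t = "card W"
  define F where "F = dec f ?N"
  define F1 where "F1 = dec f (insert x (?N - {y}))"
  have r0: "realization (D \<union> C) E f" and dom: "\<And>j. j \<in> C \<Longrightarrow> \<exists>a\<in>D. {a, j} \<in> E"
    using E unfolding dominated_def by auto
  have g0: "graph_on (D \<union> C) E" using r0 realization_graph by blast
  have uD: "u \<notin> D" using u disj by auto
  have "D \<union> ?C = (D \<union> C) - {u}" using uD by auto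
  then have r: "realization (D \<union> ?C) ?E F" using realization_delete[OF r0] by (simp add: F_def)
  have disj': "D \<inter> ?C = {}" using disj by auto
  have g: "graph_on (D \<union> ?C) ?E" using r realization_graph by blast
  have fin: "finite D" "finite C" using g0 unfolding graph_on_def by auto
  have finW: "finite W" using W fin finite_subset by blast
  have ne: "x \<noteq> u" "y \<noteq> u" "x \<noteq> y" "x \<notin> C" "y \<notin> D"
    using x y uD disj graph_on_edge(3)[OF g0] by auto
  have xN: "x \<notin> ?N" "y \<in> ?N" using x y by (auto simp: nbrs_iff)
  have dom': "nbrs ?E j \<inter> D \<noteq> {}" if j: "j \<in> ?C" for j
  proof -
    obtain a where "a \<in> D" "{a, j} \<in> E" using dom[of j] j by blast
    then show ?thesis using j uD by (auto simp: nbrs_delete nbrs_iff)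
  qed
  have fy: "2 \<le> f y"
  proof -
    obtain a where a: "a \<in> D" "{a, y} \<in> E" using dom[OF y(1)] by blast
    have "{a, u} \<subseteq> nbrs E y" using a y by (auto simp: nbrs_iff insert_commute)
    then have "card {a, u} \<le> card (nbrs E y)" using finite_nbrs[OF g0] by (intro card_mono) auto
    moreover have "a \<noteq> u" using a uD by auto
    ultimately show ?thesis using realization_card[OF r0, of y] y by simp
  qed
  have fx: "0 < f x" using le fy by simp
  have f1y: "F1 y = F y + 1" "F y = f y - 1" using xN ne fy by (simp_all add: dec_def F_def F1_def)
  have f1x: "F x = f x" "F1 x = f x - 1" using xN by (simp_all add: dec_def F_def F1_def)
  have f1: "F1 v = F v" if "v \<noteq> x" "v \<noteq> y" for v using that by (simp add: dec_def F_def F1_def)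
  have f1C: "F1 j = F j" if "j \<in> C" "j \<noteq> y" for j using f1 that ne by metis
  let ?e = "\<lambda>v. card (nbrs ?E v \<inter> W)"
  have eC: "?e j \<le> min ?t (F j - 1)" if "j \<in> ?C - W" for j
    using dominated_inner_le[OF r disj' W, of j] dom' that by blast
  have eD: "?e i \<le> min ?t (F i)" if "i \<in> D" for i
  proof -
    have "?e i \<le> F i" using degree_split[OF r disj' W, of i] that by simp
    moreover have "?e i \<le> ?t" using finW by (intro card_mono) auto
    ultimately show ?thesis by simp
  qed
  have inner: "(\<Sum>w\<in>W. ?e w) \<le> ?t * (?t - 1)" by (rule sum_inner_le[OF g finW])
  have SW: "sum F W = (\<Sum>w\<in>W. ?e w) + (\<Sum>j\<in>?C - W. ?e j) + (\<Sum>i\<in>D. ?e i)"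
    by (rule sum_degree_W[OF r disj' W])
  have leC: "(\<Sum>j\<in>?C - W. ?e j) \<le> (\<Sum>j\<in>?C - W. min ?t (F j - 1))" by (rule sum_mono[OF eC])
  have leD: "(\<Sum>i\<in>D. ?e i) \<le> (\<Sum>i\<in>D. min ?t (F i))" by (rule sum_mono[OF eD])
  \<comment> \<open>The loss in the sum over \<open>D\<close>: lowering the demand of
    \<open>x\<close> is visible only if it does not exceed the cap \<open>card W\<close>.\<close>
  define \<delta> where "\<delta> = (if f x \<le> ?t then 1 else 0::nat)"
  have D1: "(\<Sum>i\<in>D. min ?t (F1 i)) + \<delta> = (\<Sum>i\<in>D. min ?t (F i))"
  proof -
    have "(\<Sum>i\<in>D. min ?t (F i)) = (\<Sum>i\<in>D. min ?t (F1 i) + (if i = x then \<delta> else 0))"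
    proof (rule sum.cong[OF refl])
      fix i assume "i \<in> D"
      then have "i \<noteq> y" using ne by blast
      show "min ?t (F i) = min ?t (F1 i) + (if i = x then \<delta> else 0)"
      proof (cases "i = x")
        case True
        then show ?thesis using f1x fx by (auto simp: \<delta>_def min_def)
      qed (use f1 \<open>i \<noteq> y\<close> in simp)
    qed
    also have "\<dots> = (\<Sum>i\<in>D. min ?t (F1 i)) + (\<Sum>i\<in>D. if i = x then \<delta> else 0)" by (rule sum.distrib)
    also have "(\<Sum>i\<in>D. if i = x then \<delta> else 0) = \<delta>" using fin x(1) by simp
    finally show ?thesis by (rule sym)
  qed
  have viol: "?t * (?t - 1) + (\<Sum>j\<in>?C - W. min ?t (F1 j - 1)) + (\<Sum>i\<in>D. min ?t (F1 i)) < sum F1 W"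
    using neg unfolding cond_B_def F1_def by simp
  \<comment> \<open>Outside \<open>W\<close>, the unit returned to \<open>y\<close> raises its own
    term by \<open>\<epsilon>\<close>, and \<open>f y \<le> f x\<close> gives
    \<open>\<delta> \<le> \<epsilon>\<close>; the inequality would be inherited from the old
    realization.\<close>
  have yW: "y \<in> W"
  proof (rule ccontr)
    assume yW: "y \<notin> W"
    have 1: "sum F1 W = sum F W"
    proof (rule sum.cong[OF refl])
      show "F1 w = F w" if "w \<in> W" for w using that yW W f1C by blast
    qed
    define \<epsilon> where "\<epsilon> = (if f y - 1 \<le> ?t then 1 else 0::nat)"
    have "(\<Sum>j\<in>?C - W. min ?t (F1 j - 1)) = (\<Sum>j\<in>?C - W. min ?t (F j - 1) + (if j = y then \<epsilon> else 0))"
    proof (rule sum.cong[OF refl])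
      fix j assume j: "j \<in> ?C - W"
      show "min ?t (F1 j - 1) = min ?t (F j - 1) + (if j = y then \<epsilon> else 0)"
      proof (cases "j = y")
        case True
        then show ?thesis using f1y fy by (auto simp: \<epsilon>_def min_def)
      qed (use f1C j in simp)
    qed
    also have "\<dots> = (\<Sum>j\<in>?C - W. min ?t (F j - 1)) + (\<Sum>j\<in>?C - W. if j = y then \<epsilon> else 0)"
      by (rule sum.distrib)
    also have "(\<Sum>j\<in>?C - W. if j = y then \<epsilon> else 0) = \<epsilon>" using fin y(1) ne yW by simp
    finally have "(\<Sum>j\<in>?C - W. min ?t (F1 j - 1)) = (\<Sum>j\<in>?C - W. min ?t (F j - 1)) + \<epsilon>".
    moreover have "\<delta> \<le> \<epsilon>" using le by (auto simp: \<delta>_def \<epsilon>_def)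
    ultimately show False using viol 1 SW inner leC leD D1 by linarith
  qed
  have SW1: "sum F1 W = sum F W + 1"
  proof -
    have "sum F1 W = (\<Sum>w\<in>W. F w + (if w = y then 1 else 0))"
    proof (rule sum.cong[OF refl])
      fix w assume "w \<in> W"
      then show "F1 w = F w + (if w = y then 1 else 0)" using f1C[of w] f1y W by (cases "w = y") auto
    qed
    also have "\<dots> = sum F W + (\<Sum>w\<in>W. if w = y then 1 else 0)" by (rule sum.distrib)
    finally show ?thesis using finW yW by simp
  qed
  have C1: "(\<Sum>j\<in>?C - W. min ?t (F1 j - 1)) = (\<Sum>j\<in>?C - W. min ?t (F j - 1))"
  proof (rule sum.cong[OF refl])
    fix j assume "j \<in> ?C - W"
    then have "F1 j = F j" using f1C yW by blast
    then show "min ?t (F1 j - 1) = min ?t (F j - 1)" by simp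
  qed
  \<comment> \<open>All estimates for the old realization are attained up to
    \<open>\<delta>\<close>, which is at most 1; hence \<open>W\<close> is a clique.\<close>
  have slack: "?t * (?t - 1) + (\<Sum>j\<in>?C - W. min ?t (F j - 1)) + (\<Sum>i\<in>D. min ?t (F i)) \<le>
      (\<Sum>w\<in>W. ?e w) + (\<Sum>j\<in>?C - W. ?e j) + (\<Sum>i\<in>D. ?e i) + \<delta>"
    using viol SW1 C1 D1 SW by linarith
  have \<delta>1: "\<delta> \<le> 1" by (simp add: \<delta>_def)
  have clique: "{y, w} \<in> ?E" if "w \<in> W" "w \<noteq> y" for w
    using clique_if_inner[OF g finW _ yW that(1)] that(2) slack leC leD \<delta>1 by linarith
  have Wy: "W - {y} \<subseteq> nbrs E y"
  proof
    fix w assume "w \<in> W - {y}"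
    then have "{y, w} \<in> E" using clique[of w] by (simp add: delete_def)
    then show "w \<in> nbrs E y" by (simp add: nbrs_iff insert_commute)
  qed
  have uy: "u \<in> nbrs E y" using y by (simp add: nbrs_iff insert_commute)
  have finN: "finite (nbrs E v)" for v by (rule finite_nbrs[OF g0])
  have cy: "card (nbrs E y) = f y" "card ?N = f u" using realization_card[OF r0] y u by auto
  have cW: "card (insert u (W - {y})) = ?t"
    using card_Suc_Diff1[OF finW yW] W finW by (subst card_insert_disjoint) auto
  have mono: "card X \<le> f y" if "X \<subseteq> nbrs E y" for X using card_mono[OF finN that] cy by simp
  \<comment> \<open>If \<open>\<delta>\<close> is 1, the neighbours \<open>a\<close>,
    \<open>u\<close> and \<open>W - {y}\<close> of \<open>y\<close> already give
    \<open>card W < f y\<close>, against \<open>f y \<le> f x \<le> card W\<close>. If it is 0,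
    every estimate is exact, and \<open>y\<close> turns out to be adjacent to \<open>x\<close>,
    \<open>u\<close> and all other neighbours of \<open>u\<close>; this makes \<open>f y\<close>
    larger than \<open>f u\<close>.\<close>
  show False
  proof (cases "f x \<le> ?t")
    case True
    obtain a where a: "a \<in> D" "a \<in> nbrs E y" using dom[OF y(1)] by (auto simp: nbrs_iff)
    have "insert a (insert u (W - {y})) \<subseteq> nbrs E y" using a Wy uy by auto
    then have "card (insert a (insert u (W - {y}))) \<le> f y" by (rule mono)
    moreover have "a \<notin> insert u (W - {y})" using a uD W disj by auto
    ultimately show False using cW finW True le by simp
  next
    case False
    then have \<delta>0: "\<delta> = 0" by (simp add: \<delta>_def)
    have eqC: "(\<Sum>j\<in>?C - W. ?e j) = (\<Sum>j\<in>?C - W. min ?t (F j - 1))"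
      and eqD: "(\<Sum>i\<in>D. ?e i) = (\<Sum>i\<in>D. min ?t (F i))"
      using slack \<delta>0 leC leD inner by linarith+
    have eqC': "?e j = min ?t (F j - 1)" if "j \<in> ?C - W" for j
      using sum_mono_inv[OF eqC eC that] fin by simp
    have eqD': "?e i = min ?t (F i)" if "i \<in> D" for i
      using sum_mono_inv[OF eqD eD that] fin by simp
    have adj: "y \<in> nbrs E v" if "?e v = ?t" for v
    proof -
      have "nbrs ?E v \<inter> W = W" using that finW by (intro card_subset_eq) auto
      then show ?thesis using yW by (auto simp: nbrs_iff delete_def)
    qed
    have adjD: "v \<in> nbrs E y" if v: "v \<in> D" "f x \<le> f v" for v
    proof -
      have "?t \<le> F v" using v False by (auto simp: dec_def F_def)
      then show ?thesis using adj[of v] eqD'[OF v(1)] by (simp add: nbrs_sym)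
    qed
    have xy: "x \<in> nbrs E y" using adjD[OF x(1)] by simp
    have ND: "?N \<inter> D \<subseteq> nbrs E y" using adjD D_ge by auto
    obtain b where b: "b \<in> D" "b \<in> ?N" using dom[OF u(1)] by (auto simp: nbrs_iff)
    have "insert x (insert b (insert u (W - {y}))) \<subseteq> nbrs E y" using ND b xy Wy uy by auto
    then have "card (insert x (insert b (insert u (W - {y})))) \<le> f y" by (rule mono)
    moreover have "b \<notin> insert u (W - {y})" "x \<notin> insert b (insert u (W - {y}))" using b x uD W disj xN by auto
    ultimately have ty: "?t + 2 \<le> f y" using cW finW by simp
    have "v \<in> nbrs E y" if v: "v \<in> ?N" "v \<noteq> y" for v
    proof -
      have vV: "v \<in> D \<union> C" "v \<noteq> u" using nbrs_subset[OF g0, of u] nbrs_irrefl[OF g0, of u] v by auto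
      consider "v \<in> D" | "v \<in> W" | "v \<in> ?C - W" "v \<in> C" using vV by auto
      then show ?thesis
      proof cases
        case 1
        then show ?thesis using ND v by auto
      next
        case 2
        then show ?thesis using Wy v by auto
      next
        case 3
        then have "?t + 2 \<le> f v" using C_ge[of v] v ty by auto
        then show ?thesis using adj[of v] eqC'[OF 3(1)] v by (simp add: dec_def nbrs_sym F_def)
      qed
    qed
    then have "insert x (insert u (?N - {y})) \<subseteq> nbrs E y" using xy uy by auto
    then have "card (insert x (insert u (?N - {y}))) \<le> f y" by (rule mono)
    moreover have "u \<notin> ?N" using nbrs_irrefl[OF g0] by blast
    ultimately have "card (?N - {y}) + 2 \<le> f y" using xN ne finN[of u] by simp
    then have "f u + 1 \<le> f y" using xN(2) finN[of u] cy(2) by simp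
    then show False using u(2)[OF y(1)] by simp
  qed
qed

section \<open>Realizations that agree best with a prescribed neighbourhood\<close>

locale pivot =
  fixes D C :: "nat set" and f :: "nat \<Rightarrow> nat" and u :: nat and Sd Sc :: "nat set"
  assumes disj: "D \<inter> C = {}" and feas: "feasible D C f"
    and u: "u \<in> C" "\<And>j. j \<in> C \<Longrightarrow> f j \<le> f u"
    and Sd: "Sd \<subseteq> D" "\<And>x y. x \<in> Sd \<Longrightarrow> y \<in> D - Sd \<Longrightarrow> f y \<le> f x"
    and Sc: "Sc \<subseteq> C - {u}" "\<And>x y. x \<in> Sc \<Longrightarrow> y \<in> C - {u} - Sc \<Longrightarrow> f y \<le> f x"
    and card_S: "card Sd + card Sc = f u" and Sd_ne: "Sd \<noteq> {}"
begin

abbreviation "S \<equiv> Sd \<union> Sc"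

lemma fin: "finite D" "finite C" "finite S" "finite Sd" "finite Sc"
proof -
  show D: "finite D" "finite C" using feas unfolding feasible_def realization_def graph_on_def by auto
  then show "finite S" "finite Sd" "finite Sc" using Sd(1) Sc(1) by (auto intro: finite_subset)
qed

lemma pos: "j \<in> C \<Longrightarrow> 0 < f j"
proof -
  assume j: "j \<in> C"
  obtain E where E: "realization (D \<union> C) E f" "nbrs E j \<inter> D \<noteq> {}" using feas j unfolding feasible_def by auto
  then show ?thesis using realization_card[OF E(1), of j] j finite_nbrs[OF realization_graph[OF E(1)], of j]
    by (metis UnI2 card_gt_0_iff inf_bot_left)
qed

lemma card_S': "card S = f u"
proof -
  have "Sd \<inter> Sc = {}" using Sd(1) Sc(1) disj by auto
  then show ?thesis using card_S fin by (simp add: card_Un_disjoint)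
qed

text \<open>A lexicographic order: agreement with \<open>S\<close> first, then the total degree of
  the neighbours in \<open>D\<close>, which stays below the factor \<open>Suc (sum f D)\<close>. The
  second component serves \<open>best_D_ge\<close>.\<close>

definition weight :: "nat set set \<Rightarrow> nat" where
  "weight E = card (nbrs E u \<inter> S) * Suc (sum f D) + sum f (nbrs E u \<inter> D)"

definition best :: "nat set set \<Rightarrow> bool" where
  "best E \<longleftrightarrow> dominated D C f E \<and> (\<forall>E'. dominated D C f E' \<longrightarrow> weight E' \<le> weight E)"

lemma ex_best: "\<exists>E. best E"
proof -
  obtain E0 where E0: "dominated D C f E0" using feas feasible_iff by auto
  have "weight E < Suc (card S * Suc (sum f D) + sum f D)" for E
  proof -
    have "card (nbrs E u \<inter> S) \<le> card S" using fin by (intro card_mono) auto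
    moreover have "sum f (nbrs E u \<inter> D) \<le> sum f D" using fin by (intro sum_mono2) auto
    ultimately show ?thesis unfolding weight_def by (meson add_mono le_imp_less_Suc mult_le_mono1)
  qed
  then have "\<exists>E. dominated D C f E \<and> (\<forall>E'. dominated D C f E' \<longrightarrow> weight E' \<le> weight E)"
    using Lattices_Big.ex_has_greatest_nat[of "dominated D C f" E0 weight] E0 by blast
  then show ?thesis unfolding best_def .
qed

lemma bestD:
  assumes "best E"
  shows "dominated D C f E" "realization (D \<union> C) E f" "graph_on (D \<union> C) E" "card (nbrs E u) = f u"
    "finite (nbrs E u)" "u \<notin> nbrs E u" "nbrs E u \<subseteq> D \<union> C" "nbrs E u \<inter> D \<noteq> {}"
    "\<And>v. v \<in> nbrs E u \<Longrightarrow> 0 < f v"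
proof -
  show d: "dominated D C f E" using assms unfolding best_def by blast
  then show r: "realization (D \<union> C) E f" unfolding dominated_def by blast
  then show g: "graph_on (D \<union> C) E" using realization_graph by blast
  show "card (nbrs E u) = f u" using realization_card[OF r] u by simp
  show "finite (nbrs E u)" "u \<notin> nbrs E u" and sub: "nbrs E u \<subseteq> D \<union> C"
    using finite_nbrs[OF g] nbrs_irrefl[OF g] nbrs_subset[OF g] by auto
  show "nbrs E u \<inter> D \<noteq> {}" using d u unfolding dominated_def nbrs_def by blast
  show "0 < f v" if "v \<in> nbrs E u" for v
    using that realization_card[OF r, of v] sub finite_nbrs[OF g, of v] by (metis card_gt_0_iff empty_iff nbrs_sym subsetD)
qed

lemma weight_more:
  assumes "card (nbrs E u \<inter> S) < card (nbrs E' u \<inter> S)"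
  shows "weight E < weight E'"
proof -
  have "sum f (nbrs E u \<inter> D) \<le> sum f D" using fin by (intro sum_mono2) auto
  then have "weight E < Suc (card (nbrs E u \<inter> S)) * Suc (sum f D)" unfolding weight_def by simp
  also have "\<dots> \<le> card (nbrs E' u \<inter> S) * Suc (sum f D)" using assms by (intro mult_right_mono) auto
  finally show ?thesis unfolding weight_def by simp
qed

lemma no_better:
  assumes E: "best E" and E': "dominated D C f E'" and nb: "nbrs E' u = insert x (nbrs E u - {y})"
    and xy: "x \<in> S - nbrs E u" "y \<in> nbrs E u - S"
  shows False
proof -
  have "nbrs E' u \<inter> S = insert x (nbrs E u \<inter> S)" using nb xy by auto
  then have "card (nbrs E u \<inter> S) < card (nbrs E' u \<inter> S)" using xy fin by simp
  then show False using weight_more E E' unfolding best_def by (meson not_less)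
qed

text \<open>In a best realization the vertices of \<open>S\<close> not yet used lie on one side and
  the surplus neighbours on the other, because an exchange within \<open>D\<close> or within
  \<open>C\<close> always succeeds.\<close>

lemma best_same_side:
  assumes E: "best E" and xy: "x \<in> S - nbrs E u" "y \<in> nbrs E u - S"
  shows "\<not> (x \<in> D \<and> y \<in> D)" "\<not> (x \<in> C \<and> y \<in> C)"
proof -
  have ux: "{u, x} \<notin> E" "x \<noteq> u" "{u, y} \<in> E" "y \<noteq> u"
    using xy Sc(1) Sd(1) u(1) disj bestD(6)[OF E] by (auto simp: nbrs_iff insert_commute)
  show "\<not> (x \<in> D \<and> y \<in> D)"
  proof
    assume D: "x \<in> D \<and> y \<in> D"
    then have "x \<in> Sd" "y \<in> D - Sd" using xy Sc(1) disj by auto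
    then have "f y \<le> f x" by (rule Sd(2))
    then obtain E' where "dominated D C f E'" "nbrs E' u = insert x (nbrs E u - {y})"
      using dominated_exchange[OF bestD(1)[OF E] disj u(1) ux(1,2,3)] D by metis
    then show False using no_better[OF E _ _ xy] by blast
  qed
  show "\<not> (x \<in> C \<and> y \<in> C)"
  proof
    assume C: "x \<in> C \<and> y \<in> C"
    then have "x \<in> Sc" "y \<in> C - {u} - Sc" using xy Sd(1) disj ux by auto
    then have "f y \<le> f x" by (rule Sc(2))
    then obtain E' where "dominated D C f E'" "nbrs E' u = insert x (nbrs E u - {y})"
      using dominated_exchange[OF bestD(1)[OF E] disj u(1) ux(1,2,3)] C by metis
    then show False using no_better[OF E _ _ xy] by blast
  qed
qed

text \<open>Trading \<open>v\<close> for a larger \<open>x\<close> inside \<open>D\<close> would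
  preserve the agreement with \<open>S\<close> and raise the second component of
  \<open>weight\<close>. The result is needed for \<open>cond_B_exchange\<close>.\<close>

lemma best_D_ge:
  assumes E: "best E" and x: "x \<in> Sd - nbrs E u" and v: "v \<in> nbrs E u \<inter> D"
  shows "v \<in> Sd" "f x \<le> f v"
proof -
  have xD: "x \<in> D" using x Sd(1) by auto
  show vS: "v \<in> Sd" using best_same_side(1)[OF E, of x v] x v xD Sc(1) disj by auto
  show "f x \<le> f v"
  proof (rule ccontr)
    assume lt: "\<not> f x \<le> f v"
    have ux: "{u, x} \<notin> E" "x \<noteq> u" "{u, v} \<in> E"
      using x v xD u(1) disj by (auto simp: nbrs_iff insert_commute)
    have "x \<in> D \<and> v \<in> D \<and> f v \<le> f x" using xD v lt by auto
    then obtain E' where E': "dominated D C f E'" "nbrs E' u = insert x (nbrs E u - {v})"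
      using dominated_exchange[OF bestD(1)[OF E] disj u(1) ux] by metis
    have "nbrs E' u \<inter> S = insert x (nbrs E u \<inter> S - {v})" using E'(2) x by auto
    then have "card (nbrs E' u \<inter> S) = Suc (card (nbrs E u \<inter> S - {v}))" using x fin by simp
    also have "\<dots> = card (nbrs E u \<inter> S)" using v vS fin by (intro card_Suc_Diff1) auto
    finally have 1: "card (nbrs E' u \<inter> S) = card (nbrs E u \<inter> S)" .
    have "nbrs E' u \<inter> D = insert x (nbrs E u \<inter> D - {v})" using E'(2) x xD by auto
    then have "sum f (nbrs E' u \<inter> D) = f x + sum f (nbrs E u \<inter> D - {v})" using x fin by simp
    moreover have "sum f (nbrs E u \<inter> D) = f v + sum f (nbrs E u \<inter> D - {v})" using v fin by (intro sum.remove) auto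
    ultimately have "weight E < weight E'" using 1 lt unfolding weight_def by simp
    then show False using E E'(1) unfolding best_def by (meson not_less)
  qed
qed

text \<open>Read contrapositively: if condition A fails for a choice \<open>M\<close>, every
  dominated realization gives the pivot a neighbour in \<open>C\<close> that \<open>M\<close> does
  not contain.\<close>

lemma cond_A_transfer:
  assumes E: "best E" and E': "dominated D C f E'" and M: "M \<subseteq> D \<union> (C - {u})" "card M = f u"
    and sub: "nbrs E' u \<inter> C \<subseteq> M" and W: "W \<subseteq> C - {u}"
  shows "cond_A D (C - {u}) (dec f M) W"
proof -
  have r: "realization (D \<union> C) E' f" using E' unfolding dominated_def by blast
  note g = realization_graph[OF r]
  have sub': "nbrs E' u \<subseteq> D \<union> (C - {u})" using nbrs_subset[OF g, of u] nbrs_irrefl[OF g, of u] by auto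
  have disj': "D \<inter> (C - {u}) = {}" using disj by auto
  have A: "cond_A D (C - {u}) (dec f (nbrs E' u)) W"
    by (rule feasible_imp_cond_A[OF feasible_delete[OF E' disj u(1)] disj' W])
  have p: "0 < f i" if "i \<in> nbrs E' u" for i
  proof -
    have "u \<in> nbrs E' i" using that by (simp add: nbrs_sym)
    then have "0 < card (nbrs E' i)" using finite_nbrs[OF g, of i] by (auto simp: card_gt_0_iff)
    then show ?thesis using realization_card[OF r, of i] sub' that by auto
  qed
  show ?thesis
    by (rule cond_A_mono[OF A W fin(1) _ disj' sub' M(1)])
      (use fin(2) realization_card[OF r, of u] u(1) M(2) sub pos p in auto)
qed

text \<open>Repairing is possible whenever it is called for. A best realization uses all of
  \<open>Sc\<close>, a further vertex of \<open>C\<close>, and still a vertex of \<open>D\<close>;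
  as the total is \<open>f u\<close>, \<open>Sd\<close> has a vertex to spare.\<close>

lemma violation_imp_movable:
  assumes W: "W \<subseteq> C - {u}" and viol: "\<not> cond_A D (C - {u}) (dec f S) W"
  shows "2 \<le> card Sd" "C - {u} - Sc \<noteq> {}"
proof -
  obtain E where E: "best E" using ex_best by blast
  note B = bestD[OF E]
  have "S \<subseteq> D \<union> (C - {u})" using Sd(1) Sc(1) by auto
  then have "\<not> nbrs E u \<inter> C \<subseteq> S" using cond_A_transfer[OF E B(1) _ card_S' _ W] viol by blast
  then obtain y where y: "y \<in> nbrs E u - S" "y \<in> C" by blast
  have yu: "y \<noteq> u" using y B(6) by auto
  have "Sc \<subseteq> nbrs E u" using best_same_side(2)[OF E _ y(1)] y(2) Sc(1) by blast
  then have "insert y Sc \<subseteq> nbrs E u \<inter> C" using y Sc(1) by auto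
  then have "card (insert y Sc) \<le> card (nbrs E u \<inter> C)" using B(5) by (intro card_mono) auto
  moreover have "y \<notin> Sc" using y by auto
  moreover have "nbrs E u = (nbrs E u \<inter> D) \<union> (nbrs E u \<inter> C)" using B(7) by auto
  then have "card (nbrs E u) = card ((nbrs E u \<inter> D) \<union> (nbrs E u \<inter> C))" by simp
  then have "card (nbrs E u) = card (nbrs E u \<inter> D) + card (nbrs E u \<inter> C)"
    using B(5) disj by (subst (asm) card_Un_disjoint) auto
  moreover have "0 < card (nbrs E u \<inter> D)" using B(5,8) by (simp add: card_gt_0_iff)
  ultimately show "2 \<le> card Sd" using fin card_S B(4) by simp
  show "C - {u} - Sc \<noteq> {}" using y yu by auto
qed

text \<open>A best realization that disagrees with \<open>S\<close> lacks some \<open>x0\<close> in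
  \<open>S\<close>. If \<open>x0\<close> is in \<open>D\<close>, it can replace the smallest surplus
  vertex of \<open>C\<close>. If \<open>x0\<close> is in \<open>C\<close>, then
  \<open>maximal\<close> says either that the surplus in \<open>D\<close> is smaller and can be
  switched away, or that condition A excludes using so few vertices of \<open>C\<close>.\<close>

theorem ex_pivot:
  assumes A: "\<And>W. W \<subseteq> C - {u} \<Longrightarrow> cond_A D (C - {u}) (dec f S) W"
    and order: "\<And>x y. 2 \<le> card Sd \<Longrightarrow> x \<in> Sd \<Longrightarrow> y \<in> C - {u} - Sc \<Longrightarrow> f y \<le> f x"
    and maximal: "D - Sd \<noteq> {} \<Longrightarrow> Sc \<noteq> {} \<Longrightarrow>
      \<exists>x\<in>D - Sd. \<exists>y\<in>Sc. (\<forall>x'\<in>D - Sd. f x' \<le> f x) \<and> (\<forall>y'\<in>Sc. f y \<le> f y') \<and>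
        (f x < f y \<or> (\<exists>W \<subseteq> C - {u}. \<not> cond_A D (C - {u}) (dec f (insert x S - {y})) W))"
  shows "\<exists>E. dominated D C f E \<and> nbrs E u = S"
proof -
  obtain E where E: "best E" using ex_best by blast
  note B = bestD[OF E]
  let ?N = "nbrs E u"
  have SV: "S \<subseteq> D \<union> (C - {u})" "u \<notin> S" using Sd(1) Sc(1) u(1) disj by auto
  show ?thesis
  proof (cases "?N = S")
    case True
    then show ?thesis using B(1) by blast
  next
    case False
    have cNS: "card ?N = card S" using B(4) card_S' by simp
    have "\<not> ?N \<subseteq> S" using card_subset_eq[OF fin(3) _ cNS] False by blast
    then obtain y0 where y0: "y0 \<in> ?N - S" by blast
    have "\<not> S \<subseteq> ?N" using card_subset_eq[OF B(5) _ cNS[symmetric]] False by blast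
    then obtain x0 where x0: "x0 \<in> S - ?N" by blast
    have splitN: "card ?N = card (?N \<inter> D) + card (?N \<inter> C)"
    proof -
      have "?N = (?N \<inter> D) \<union> (?N \<inter> C)" using B(7) by auto
      then have "card ?N = card ((?N \<inter> D) \<union> (?N \<inter> C))" by simp
      then show ?thesis using B(5) disj by (subst (asm) card_Un_disjoint) auto
    qed
    have False
    proof (cases "x0 \<in> D")
      case True
      then have x: "x0 \<in> Sd - ?N" "x0 \<in> D" "{x0, u} \<notin> E" using x0 Sc(1) disj by (auto simp: nbrs_iff)
      have NSC: "y \<in> C" if "y \<in> ?N - S" for y
        using best_same_side(1)[OF E x0 that] True B(7) that by auto
      have SNC: "Sc \<subseteq> ?N" using best_same_side(2)[OF E _ y0] NSC[OF y0] Sc(1) by blast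
      let ?Y = "?N - S"
      obtain y where y: "y \<in> ?Y" "\<And>v. v \<in> ?Y \<Longrightarrow> f y \<le> f v"
        using ex_has_least_nat[of "\<lambda>v. v \<in> ?Y" y0 f] y0 by blast
      have yC: "y \<in> C" "y \<noteq> u" "y \<in> C - {u} - Sc" "{y, u} \<in> E"
        using NSC[OF y(1)] y(1) B(6) by (auto simp: nbrs_iff)
      obtain b where b: "b \<in> ?N" "b \<in> D" using B(8) by blast
      have "b \<in> Sd" "b \<noteq> x0" using best_D_ge(1)[OF E x(1)] b x by auto
      then have "card {b, x0} \<le> card Sd" using x fin(4) by (intro card_mono) auto
      then have "2 \<le> card Sd" using \<open>b \<noteq> x0\<close> by simp
      then have le: "f y \<le> f x0" using order x(1) yC(3) by blast
      let ?N1 = "insert x0 (?N - {y})"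
      have xN: "x0 \<notin> ?N" "x0 \<notin> C" "x0 \<noteq> u" using x u(1) disj by auto
      have N1V: "?N1 \<subseteq> D \<union> (C - {u})" using B(6,7) x(2) by auto
      have card_N1: "card ?N1 = f u"
        using xN y(1) B(5) card_Suc_Diff1[OF B(5), of y] B(4) by simp
      have f_pos: "0 < f v" if "v \<in> ?N1" for v
        using that B(9) le pos[OF yC(1)] by auto
      have eqV: "D \<union> (C - {u}) = (D \<union> C) - {u}" using u(1) disj by auto
      have disj': "D \<inter> (C - {u}) = {}" using disj by auto
      \<comment> \<open>A single switch might leave a vertex undominated here, so everything except
        the pivot is realized anew by means of the two conditions. The plain switch below only
        certifies that the remaining degrees are realizable.\<close>
      have "feasible D (C - {u}) (dec f ?N1)"
      proof (rule feasible_if_conds[OF disj'])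
        show "0 < dec f ?N1 j" if j: "j \<in> C - {u}" for j
        proof -
          obtain a where a: "a \<in> D" "{a, j} \<in> E" using B(1) j unfolding dominated_def by blast
          have "{a, u} \<subseteq> nbrs E j" if "j \<in> ?N"
            using that a by (auto simp: nbrs_iff insert_commute)
          then have "card {a, u} \<le> card (nbrs E j)" if "j \<in> ?N"
            using that finite_nbrs[OF B(3)] by (intro card_mono) auto
          moreover have "a \<noteq> u" using a u(1) disj by auto
          ultimately have "2 \<le> f j" if "j \<in> ?N" using that realization_card[OF B(2), of j] j by auto
          then show ?thesis using pos[of j] j xN by (auto simp: dec_def)
        qed
        obtain z where "realization (D \<union> C) (switch E u y x0 z) f" "nbrs (switch E u y x0 z) u = ?N1"
          using ex_switch_neighbour[OF B(2), of x0 y u] x yC(1,4) xN le by (metis UnI1 UnI2 insert_commute)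
        then show "\<exists>E. realization (D \<union> (C - {u})) E (dec f ?N1)"
          using realization_delete[of "D \<union> C" "switch E u y x0 z" f u] eqV by auto
        show "cond_A D (C - {u}) (dec f ?N1) W" if W: "W \<subseteq> C - {u}" for W
        proof (rule cond_A_mono[OF A[OF W] W fin(1) _ disj' SV(1) N1V])
          show "card S = card ?N1" using card_S' card_N1 by simp
          show "S \<inter> (C - {u}) \<subseteq> ?N1" using SNC Sd(1) disj y(1) by auto
          show "0 < f i" if "i \<in> S \<inter> D" for i
          proof -
            have "i \<in> Sd" using that Sc(1) disj by auto
            then show ?thesis using order[OF \<open>2 \<le> card Sd\<close> _ yC(3)] pos[OF yC(1)] by (metis gr_zeroI le_zero_eq)
          qed
        qed (use fin pos in auto)
        show "cond_B D (C - {u}) (dec f ?N1) W" if W: "W \<subseteq> C - {u}" for W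
        proof (rule cond_B_exchange[OF B(1) disj u x(2,3) yC(1,4) le _ _ W])
          show "f x0 \<le> f v" if "v \<in> ?N \<inter> D" for v using best_D_ge(2)[OF E x(1) that] .
          show "f y \<le> f v" if "v \<in> ?N \<inter> C" for v
          proof (cases "v \<in> S")
            case True
            then have "v \<in> Sc" using that Sd(1) disj by auto
            then show ?thesis using Sc(2) yC(3) by blast
          qed (use y(2) that in blast)
        qed
      qed
      then obtain E2 where E2: "dominated D (C - {u}) (dec f ?N1) E2" using feasible_iff by blast
      let ?E3 = "E2 \<union> (\<lambda>v. {u, v}) ` ?N1"
      have r2: "realization ((D \<union> C) - {u}) E2 (dec f ?N1)" using E2 eqV unfolding dominated_def by simp
      have N1V': "?N1 \<subseteq> (D \<union> C) - {u}" using N1V eqV by simp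
      have uV: "u \<in> D \<union> C" using u(1) by simp
      note ins = realization_insert[OF r2 uV N1V' card_N1 f_pos]
      have "dominated D C f ?E3"
        unfolding dominated_def
      proof (intro conjI ballI)
        show "realization (D \<union> C) ?E3 f" by (rule ins(1))
        fix j assume j: "j \<in> C"
        show "\<exists>a\<in>D. {a, j} \<in> ?E3"
        proof (cases "j = u")
          case True
          then show ?thesis using x(2) by (intro bexI[of _ x0]) (auto simp: insert_commute)
        next
          case False
          then show ?thesis using E2 j unfolding dominated_def by blast
        qed
      qed
      then show False using no_better[OF E _ ins(2) x0 y(1)] by blast
    next
      case False
      then have x: "x0 \<in> Sc" "x0 \<in> C" "x0 \<noteq> u" "{u, x0} \<notin> E" using x0 Sd(1) Sc(1) by (auto simp: nbrs_iff insert_commute)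
      have NSD: "y \<in> D" if "y \<in> ?N - S" for y
        using best_same_side(2)[OF E x0 that] x(2) B(7) that by auto
      have NC: "?N \<inter> C \<subseteq> Sc - {x0}" using NSD disj x0 Sd(1) by blast
      then have "card (?N \<inter> C) \<le> card (Sc - {x0})" using fin(5) by (intro card_mono) auto
      also have "\<dots> < card Sc" using x(1) fin(5) by (intro psubset_card_mono) auto
      \<comment> \<open>Hence the pivot has two neighbours in \<open>D\<close>, as the mixed case of
        \<open>dominated_exchange\<close> demands.\<close>
      finally have "card Sd < card (?N \<inter> D)" using splitN B(4) card_S by linarith
      moreover have "0 < card Sd" using fin(4) Sd_ne by (simp add: card_gt_0_iff)
      ultimately have "\<not> card (?N \<inter> D) \<le> Suc 0" by linarith
      then obtain a b where ab: "a \<in> ?N \<inter> D" "b \<in> ?N \<inter> D" "a \<noteq> b"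
        using card_le_Suc0_iff_eq[of "?N \<inter> D"] B(5) by blast
      then have mult: "multidominated D E u" by (auto simp: multidominated_def nbrs_iff)
      have y0D: "y0 \<in> D - Sd" "{u, y0} \<in> E" using NSD[OF y0] y0 by (auto simp: nbrs_iff insert_commute)
      then obtain x' y' where xy: "x' \<in> D - Sd" "y' \<in> Sc" "\<And>x. x \<in> D - Sd \<Longrightarrow> f x \<le> f x'"
        "\<And>y. y \<in> Sc \<Longrightarrow> f y' \<le> f y"
        "f x' < f y' \<or> (\<exists>W \<subseteq> C - {u}. \<not> cond_A D (C - {u}) (dec f (insert x' S - {y'})) W)"
        using maximal x(1) by (metis empty_iff)
      from xy(5) show False
      proof
        assume lt: "f x' < f y'"
        have "f y0 < f x0" using lt xy(3)[OF y0D(1)] xy(4)[OF x(1)] by linarith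
        then have "x0 \<in> C \<and> y0 \<in> D \<and> f y0 < f x0 \<and> multidominated D E u" using x y0D mult by auto
        then obtain E' where "dominated D C f E'" "nbrs E' u = insert x0 (?N - {y0})"
          using dominated_exchange[OF B(1) disj u(1) x(4,3) y0D(2)] by metis
        then show False using no_better[OF E _ _ x0 y0] by blast
      next
        assume "\<exists>W \<subseteq> C - {u}. \<not> cond_A D (C - {u}) (dec f (insert x' S - {y'})) W"
        then obtain W where W: "W \<subseteq> C - {u}" "\<not> cond_A D (C - {u}) (dec f (insert x' S - {y'})) W" by blast
        have ne: "x' \<notin> S" "x' \<noteq> y'" "y' \<in> S" "y' \<in> C" using xy Sc(1) disj by auto
        have M: "insert x' S - {y'} \<subseteq> D \<union> (C - {u})" using SV xy by auto
        have "insert x' S - {y'} = insert x' (S - {y'})" using ne by auto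
        then have cM: "card (insert x' S - {y'}) = f u"
          using ne fin(3) card_Suc_Diff1[OF fin(3) ne(3)] card_S' by simp
        obtain E' where E': "dominated D C f E'" "nbrs E' u \<inter> C \<subseteq> Sc - {y'}"
        proof (cases "y' \<in> ?N")
          case True
          have uy: "{u, y'} \<in> E" using True by (auto simp: nbrs_iff insert_commute)
          have "x0 \<in> C \<and> y' \<in> C \<and> f y' \<le> f x0" using x(2) ne xy(4)[OF x(1)] by blast
          then obtain E' where E': "dominated D C f E'" "nbrs E' u = insert x0 (?N - {y'})"
            using dominated_exchange[OF B(1) disj u(1) x(4,3) uy] by metis
          have "x0 \<noteq> y'" using True x0 by auto
          then have "nbrs E' u \<inter> C \<subseteq> Sc - {y'}" unfolding E'(2) using NC x(1) by auto
          then show ?thesis using that[OF E'(1)] by blast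
        next
          case False
          then have "?N \<inter> C \<subseteq> Sc - {y'}" using NC by auto
          then show ?thesis by (rule that[OF B(1)])
        qed
        have "nbrs E' u \<inter> C \<subseteq> insert x' S - {y'}" using E'(2) by blast
        then show False using cond_A_transfer[OF E E'(1) M cM _ W(1)] W(2) by blast
      qed
    qed
    then show ?thesis ..
  qed
qed

end

text \<open>The Havel-Hakimi step without domination, for the vertices of \<open>D\<close> that
  remain at the end. The pivot may have any degree; only its neighbours must be the largest.\<close>

lemma ex_pivot_neighbourhood:
  assumes r0: "realization V E0 f" and u: "u \<in> V" and S: "S \<subseteq> V - {u}" "card S = f u"
    and top: "\<And>x y. x \<in> S \<Longrightarrow> y \<in> V - {u} - S \<Longrightarrow> f y \<le> f x"
  shows "\<exists>E. realization V E f \<and> nbrs E u = S"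
proof -
  have fin: "finite V" "finite S" using r0 S(1) finite_subset unfolding realization_def graph_on_def by auto
  have "card (nbrs E u \<inter> S) < Suc (card S)" for E
    using fin by (simp add: less_Suc_eq_le card_mono)
  then obtain E where E: "realization V E f" and
    max: "\<And>E'. realization V E' f \<Longrightarrow> card (nbrs E' u \<inter> S) \<le> card (nbrs E u \<inter> S)"
    using Lattices_Big.ex_has_greatest_nat[of "\<lambda>E. realization V E f" E0 "\<lambda>E. card (nbrs E u \<inter> S)"] r0 by blast
  note g = realization_graph[OF E]
  have cN: "card (nbrs E u) = card S" "finite (nbrs E u)" "nbrs E u \<subseteq> V - {u}"
    using realization_card[OF E u] S(2) finite_nbrs[OF g] nbrs_subset[OF g] nbrs_irrefl[OF g] by auto
  have "nbrs E u = S"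
  proof (rule ccontr)
    assume ne: "nbrs E u \<noteq> S"
    have "\<not> nbrs E u \<subseteq> S" using card_subset_eq[OF fin(2) _ cN(1)] ne by blast
    then obtain y where y: "y \<in> nbrs E u - S" by blast
    have "\<not> S \<subseteq> nbrs E u" using card_subset_eq[OF cN(2) _ cN(1)[symmetric]] ne by blast
    then obtain x where x: "x \<in> S - nbrs E u" by blast
    have "f y \<le> f x" using top x y cN(3) by blast
    moreover have "x \<in> V" "y \<in> V" "x \<noteq> u" "{u, y} \<in> E" "{u, x} \<notin> E"
      using x y S(1) cN(3) by (auto simp: nbrs_iff insert_commute)
    ultimately have V: "x \<in> V" "y \<in> V" "x \<noteq> u" "{u, y} \<in> E" "{u, x} \<notin> E" "f y \<le> f x" by auto
    obtain z where z: "realization V (switch E u y x z) f" "nbrs (switch E u y x z) u = insert x (nbrs E u - {y})"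
      using ex_switch_neighbour[OF E V(1,2,4,5,3,6)] by metis
    have "nbrs (switch E u y x z) u \<inter> S = insert x (nbrs E u \<inter> S)" using z(2) x y by auto
    then have "card (nbrs E u \<inter> S) < card (nbrs (switch E u y x z) u \<inter> S)" using x fin by simp
    then show False using max[OF z(1)] by simp
  qed
  then show ?thesis using E by blast
qed

section \<open>Dominating sets of largest degree\<close>

definition dominates :: "nat set \<Rightarrow> nat set set \<Rightarrow> nat set \<Rightarrow> bool" where
  "dominates V E D \<longleftrightarrow> D \<subseteq> V \<and> (\<forall>v\<in>V - D. \<exists>a\<in>D. {a, v} \<in> E)"

text \<open>Many switches carried out at once, so that domination has to be checked only for the
  final graph.\<close>

lemma realization_swap_nbrs:
  assumes r: "realization V E f" and A: "A \<subseteq> nbrs E v - insert u (nbrs E u)"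
    and B: "B \<subseteq> nbrs E u - insert v (nbrs E v)" and card: "card A = card B" and uv: "u \<noteq> v" "u \<in> V" "v \<in> V"
  shows "realization V (E - ((\<lambda>a. {v, a}) ` A \<union> (\<lambda>b. {u, b}) ` B) \<union> ((\<lambda>a. {u, a}) ` A \<union> (\<lambda>b. {v, b}) ` B)) f"
    (is "realization V (E - ?R \<union> ?S) f")
proof (rule realization_exchange[OF r])
  have g: "graph_on V E" using r realization_graph by blast
  have A': "{v, a} \<in> E" "{u, a} \<notin> E" "a \<noteq> u" "a \<noteq> v" "a \<in> V" if "a \<in> A" for a
  proof -
    have a: "a \<in> nbrs E v" "a \<noteq> u" "a \<notin> nbrs E u" using that A by blast+
    then show "{v, a} \<in> E" "{u, a} \<notin> E" "a \<noteq> u" by (simp_all add: nbrs_iff insert_commute)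
    show "a \<noteq> v" "a \<in> V" using a(1) nbrs_irrefl[OF g] nbrs_subset[OF g] by blast+
  qed
  have B': "{u, b} \<in> E" "{v, b} \<notin> E" "b \<noteq> u" "b \<noteq> v" "b \<in> V" if "b \<in> B" for b
  proof -
    have b: "b \<in> nbrs E u" "b \<noteq> v" "b \<notin> nbrs E v" using that B by blast+
    then show "{u, b} \<in> E" "{v, b} \<notin> E" "b \<noteq> v" by (simp_all add: nbrs_iff insert_commute)
    show "b \<noteq> u" "b \<in> V" using b(1) nbrs_irrefl[OF g] nbrs_subset[OF g] by blast+
  qed
  show "?R \<subseteq> E" "?S \<inter> E = {}" using A' B' by auto
  show "e \<subseteq> V \<and> card e = 2" if "e \<in> ?S" for e
  proof -
    from that consider a where "a \<in> A" "e = {u, a}" | b where "b \<in> B" "e = {v, b}" by blast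
    then show ?thesis
    proof cases
      case (1 a)
      then show ?thesis using A'(3,5)[of a] uv by (simp add: card_insert_if)
    next
      case (2 b)
      then show ?thesis using B'(4,5)[of b] uv by (simp add: card_insert_if)
    qed
  qed
  have AB: "A \<inter> B = {}" using A'(2) B'(1) by blast
  have nAB: "u \<notin> A" "v \<notin> A" "u \<notin> B" "v \<notin> B" using A'(3,4) B'(3,4) by blast+
  have inj: "inj_on (\<lambda>a. {c, a}) X" for c :: nat and X by (auto simp: inj_on_def doubleton_eq_iff)
  have star: "{e \<in> (\<lambda>a. {c, a}) ` X. c \<in> e} = (\<lambda>a. {c, a}) ` X" for c :: nat and X by auto
  show "card {e \<in> ?R. w \<in> e} = card {e \<in> ?S. w \<in> e}" for w
  proof -
    consider "w = u" | "w = v" | "w \<noteq> u" "w \<noteq> v" by blast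
    then show ?thesis
    proof cases
      case 1
      have "{e \<in> ?R. w \<in> e} = (\<lambda>b. {u, b}) ` B" "{e \<in> ?S. w \<in> e} = (\<lambda>a. {u, a}) ` A"
        using 1 uv nAB by auto
      then show ?thesis using card by (simp add: card_image inj)
    next
      case 2
      have "{e \<in> ?R. w \<in> e} = (\<lambda>a. {v, a}) ` A" "{e \<in> ?S. w \<in> e} = (\<lambda>b. {v, b}) ` B"
        using 2 uv nAB by auto
      then show ?thesis using card by (simp add: card_image inj)
    next
      case 3
      have "{e \<in> ?R. w \<in> e} = (if w \<in> A then {{v, w}} else {}) \<union> (if w \<in> B then {{u, w}} else {})"
        "{e \<in> ?S. w \<in> e} = (if w \<in> A then {{u, w}} else {}) \<union> (if w \<in> B then {{v, w}} else {})"
        using 3 by auto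
      then show ?thesis using AB by auto
    qed
  qed
qed

text \<open>Normally \<open>u\<close> receives all private neighbours of \<open>v\<close>, returns
  equally many of its own, and replaces \<open>v\<close> in the dominating set; the only concern is
  a dominator for \<open>v\<close>. This breaks down if \<open>v\<close> has no private neighbour,
  is not adjacent to \<open>u\<close> and has no neighbour in \<open>D\<close>, the case
  \<open>special\<close>.\<close>

lemma dominates_improve:
  assumes r: "realization V E f" and dom: "dominates V E D" and v: "v \<in> D" and u: "u \<in> V - D"
    and lt: "f v < f u" and pos: "0 < f v"
  obtains E' y where "realization V E' f" "dominates V E' (insert y (D - {v}))" "y \<in> V - D" "f v < f y"
proof -
  have g: "graph_on V E" using r realization_graph by blast
  have DV: "D \<subseteq> V" using dom unfolding dominates_def by blast
  have uv: "u \<noteq> v" "u \<in> V" "v \<in> V" "u \<notin> D" using u v DV by auto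
  have fin: "finite (nbrs E w)" for w by (rule finite_nbrs[OF g])
  let ?A = "nbrs E v - insert u (nbrs E u)" and ?B = "nbrs E u - insert v (nbrs E v)"
  obtain x where x: "x \<in> D" "{x, u} \<in> E" using dom u unfolding dominates_def by blast
  have irr: "a \<noteq> b" if "{a, b} \<in> E" for a b using graph_on_edge(3)[OF g that] .
  consider (special) "?A = {}" "{u, v} \<notin> E" "nbrs E v \<inter> D = {}"
    | (swap) "?A \<noteq> {} \<or> {u, v} \<in> E \<or> nbrs E v \<inter> D \<noteq> {}" by blast
  then show ?thesis
  proof cases
    case swap
    have cAB: "card ?A < card ?B" using card_Diff_nbrs[OF r uv(2,3)] lt by linarith
    \<comment> \<open>If neighbours change hands at all, the dominator \<open>x\<close> of
      \<open>u\<close> is among those given to \<open>v\<close>, unless \<open>x\<close> was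
      adjacent to \<open>v\<close> anyway.\<close>
    obtain B where B: "B \<subseteq> ?B" "card B = card ?A" "?A \<noteq> {} \<Longrightarrow> x \<in> ?B \<Longrightarrow> x \<in> B"
    proof (cases "?A \<noteq> {} \<and> x \<in> ?B")
      case True
      then have "0 < card ?A" using fin by (simp add: card_gt_0_iff)
      then have "card ?A - 1 \<le> card (?B - {x})" using cAB True fin by simp
      then obtain B' where B': "B' \<subseteq> ?B - {x}" "card B' = card ?A - 1" by (meson obtain_subset_with_card_n)
      have "card (insert x B') = card ?A"
        using B' \<open>0 < card ?A\<close> fin finite_subset[OF B'(1)] by (subst card_insert_disjoint) auto
      then show ?thesis using that[of "insert x B'"] B' True by blast
    next
      case False
      obtain B' where "B' \<subseteq> ?B" "card B' = card ?A" using cAB by (meson obtain_subset_with_card_n less_imp_le)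
      then show ?thesis using that False by blast
    qed
    let ?E = "E - ((\<lambda>a. {v, a}) ` ?A \<union> (\<lambda>b. {u, b}) ` B) \<union> ((\<lambda>a. {u, a}) ` ?A \<union> (\<lambda>b. {v, b}) ` B)"
    have r': "realization V ?E f" by (rule realization_swap_nbrs[OF r subset_refl B(1) B(2)[symmetric] uv(1,2,3)])
    have keep: "{c, w} \<in> ?E" if "{c, w} \<in> E" "c \<noteq> u" "c \<noteq> v" "w \<noteq> u" "w \<noteq> v" for c w
    proof -
      have "v \<notin> {c, w}" "u \<notin> {c, w}" using that by auto
      then have "{c, w} \<notin> (\<lambda>a. {v, a}) ` ?A" "{c, w} \<notin> (\<lambda>b. {u, b}) ` B" by blast+
      then show ?thesis using that(1) by blast
    qed
    have common: "{c, v} \<in> ?E" if "{c, v} \<in> E" "{c, u} \<in> E" for c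
    proof -
      have "c \<noteq> u" "c \<noteq> v" using irr that by blast+
      then have "{c, v} \<notin> (\<lambda>a. {v, a}) ` ?A" "{c, v} \<notin> (\<lambda>b. {u, b}) ` B"
        using that uv unfolding image_iff doubleton_eq_iff nbrs_def by blast+
      then show ?thesis using that by blast
    qed
    have uw: "{u, w} \<in> ?E" if w: "{v, w} \<in> E" "w \<noteq> u" for w
    proof (cases "{u, w} \<in> E")
      case True
      have "w \<notin> B" using B(1) w by (auto simp: nbrs_iff insert_commute)
      moreover have "w \<noteq> v" using irr[OF w(1)] by blast
      ultimately have "{u, w} \<notin> (\<lambda>a. {v, a}) ` ?A" "{u, w} \<notin> (\<lambda>b. {u, b}) ` B"
        using uv unfolding image_iff doubleton_eq_iff by blast+
      then show ?thesis using True by blast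
    next
      case False
      then have "w \<in> ?A" using w by (auto simp: nbrs_iff insert_commute)
      then show ?thesis by blast
    qed
    have vdom: "\<exists>a\<in>insert u (D - {v}). {a, v} \<in> ?E"
    proof (cases "{u, v} \<in> E")
      case True
      have "{u, v} \<notin> (\<lambda>a. {v, a}) ` ?A" "{u, v} \<notin> (\<lambda>b. {u, b}) ` B"
        using B(1) uv unfolding image_iff doubleton_eq_iff by blast+
      then show ?thesis using True by blast
    next
      case nuv: False
      then have xv: "x \<noteq> v" using x by (auto simp: insert_commute)
      show ?thesis
      proof (cases "{x, v} \<in> E")
        case True
        show ?thesis using common[OF True x(2)] x(1) xv by blast
      next
        case False
        then have xB: "x \<in> ?B" using x(2) xv by (simp add: nbrs_iff)
        show ?thesis
        proof (cases "?A = {}")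
          case True
          then obtain c where c: "c \<in> D" "{c, v} \<in> E" using swap nuv unfolding nbrs_def by blast
          have "c \<noteq> u" using c(1) uv by blast
          then have "{c, u} \<in> E" using True c(2) unfolding nbrs_def by blast
          then show ?thesis using common[OF c(2)] c(1) irr[OF c(2)] by blast
        next
          case False
          then have "x \<in> B" using B(3) xB by blast
          then have "{x, v} \<in> ?E" by (auto simp: insert_commute)
          then show ?thesis using x xv by blast
        qed
      qed
    qed
    have "dominates V ?E (insert u (D - {v}))"
      unfolding dominates_def
    proof (intro conjI ballI)
      show "insert u (D - {v}) \<subseteq> V" using DV uv by auto
      fix w assume w: "w \<in> V - insert u (D - {v})"
      show "\<exists>a\<in>insert u (D - {v}). {a, w} \<in> ?E"
      proof (cases "w = v")
        case True
        then show ?thesis using vdom by simp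
      next
        case False
        then obtain c where c: "c \<in> D" "{c, w} \<in> E" using dom w unfolding dominates_def by blast
        show ?thesis
        proof (cases "c = v")
          case True
          then show ?thesis using uw[of w] c w by blast
        next
          case cv: False
          then show ?thesis using keep[OF c(2) _ cv _ False] c w uv(4) by blast
        qed
      qed
    qed
    then show ?thesis using that[OF r' _ u lt] by blast
  next
    case special
    have sub: "{u, w} \<in> E" if "{v, w} \<in> E" for w
      using special(1,2) that by (auto simp: nbrs_iff insert_commute)
    have vD: "{c, v} \<notin> E" if "c \<in> D" for c using special(3) that by (auto simp: nbrs_iff)
    have xv: "x \<noteq> v" using x special(2) by (auto simp: insert_commute)
    have other: "\<exists>c\<in>D - {v}. {c, w} \<in> E" if "w \<in> V - D" "{v, w} \<notin> E" for w
      using dom that unfolding dominates_def by (metis Diff_iff singletonD)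
    have "0 < card (nbrs E v)" using realization_card[OF r uv(3)] pos by simp
    then obtain y where "y \<in> nbrs E v" by (metis card.empty ex_in_conv less_irrefl)
    then have y: "{v, y} \<in> E" by (simp add: nbrs_iff insert_commute)
    have nbrV: "w \<in> V - D" if "{v, w} \<in> E" for w
      using graph_on_edge(2)[OF g that] vD[of w] that by (auto simp: insert_commute)
    \<comment> \<open>All neighbours of \<open>v\<close> lie outside \<open>D\<close> and are
      adjacent to \<open>u\<close>. Case \<open>far\<close>: a switch joins \<open>v\<close> to
      \<open>u\<close> and \<open>y\<close> to \<open>x\<close>. Case \<open>big\<close>:
      \<open>y\<close> itself replaces \<open>v\<close>, and \<open>x\<close> dominates the other
      neighbours of \<open>v\<close>. Case \<open>small\<close>: since \<open>u\<close> is adjacent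
      to \<open>y\<close> but not to \<open>v\<close>, some neighbour \<open>z\<close> of
      \<open>v\<close> misses \<open>y\<close>; a switch joins \<open>v\<close> to \<open>u\<close>,
      and \<open>x\<close> dominates all former neighbours of \<open>v\<close>.\<close>
    consider (far) y where "{v, y} \<in> E" "{x, y} \<notin> E"
      | (big) y where "{v, y} \<in> E" "f v < f y" "\<And>w. {v, w} \<in> E \<Longrightarrow> {x, w} \<in> E"
      | (small) "f y \<le> f v" "\<And>w. {v, w} \<in> E \<Longrightarrow> {x, w} \<in> E"
      using y by (meson not_le)
    then show ?thesis
    proof cases
      case far
      have ne: "y \<noteq> x" "y \<noteq> u" "y \<noteq> v" using far special(2) nbrV[OF far(1)] x irr[OF far(1)] by (auto simp: insert_commute)
      have e: "{u, x} \<in> E" "{v, u} \<notin> E" "{y, x} \<notin> E" using x special(2) far by (auto simp: insert_commute)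
      let ?E = "switch E v y u x"
      have r': "realization V ?E f"
        by (rule realization_switch[OF r far(1) e(1,2,3) uv(1)[symmetric] ne(1)])
      have "dominates V ?E (insert u (D - {v}))"
        unfolding dominates_def
      proof (intro conjI ballI)
        show "insert u (D - {v}) \<subseteq> V" using DV uv by auto
        fix w assume w: "w \<in> V - insert u (D - {v})"
        consider "w = v" | "w = y" | "w \<noteq> v" "w \<noteq> y" "{v, w} \<in> E" | "w \<noteq> v" "w \<noteq> y" "{v, w} \<notin> E" by blast
        then show "\<exists>a\<in>insert u (D - {v}). {a, w} \<in> ?E"
        proof cases
          case 1
          then show ?thesis by (auto simp: switch_def insert_commute)
        next
          case 2
          then have "{x, w} \<in> ?E" by (auto simp: switch_def insert_commute)
          then show ?thesis using x xv by blast
        next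
          case 3
          then have "{u, w} \<in> ?E" using sub[OF 3(3)] w x xv uv by (auto simp: switch_def doubleton_eq_iff)
          then show ?thesis by blast
        next
          case 4
          have "w \<in> V - D" using w 4(1) by blast
          then obtain c where c: "c \<in> D - {v}" "{c, w} \<in> E" using other[OF _ 4(3)] by blast
          then have "{c, w} \<in> ?E" using w 4 uv by (auto simp: switch_def doubleton_eq_iff)
          then show ?thesis using c by blast
        qed
      qed
      then show ?thesis using that[OF r' _ u lt] by blast
    next
      case big
      have "dominates V E (insert y (D - {v}))"
        unfolding dominates_def
      proof (intro conjI ballI)
        show "insert y (D - {v}) \<subseteq> V" using DV nbrV[OF big(1)] by auto
        fix w assume w: "w \<in> V - insert y (D - {v})"
        consider "w = v" | "w \<noteq> v" "{v, w} \<in> E" | "w \<noteq> v" "{v, w} \<notin> E" by blast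
        then show "\<exists>a\<in>insert y (D - {v}). {a, w} \<in> E"
        proof cases
          case 1
          then show ?thesis using big(1) by (auto simp: insert_commute)
        next
          case 2
          then show ?thesis using big(3) x xv by blast
        next
          case 3
          have "w \<in> V - D" using w 3(1) by blast
          then show ?thesis using other[OF _ 3(2)] by blast
        qed
      qed
      then show ?thesis using that[OF r _ nbrV[OF big(1)] big(2)] by blast
    next
      case small
      have uy: "{u, y} \<in> E" using sub[OF y] .
      have yV: "y \<in> V" using nbrV[OF y] by blast
      have "u \<in> nbrs E y - insert v (nbrs E v)" using uy special(2) uv by (auto simp: nbrs_iff)
      then have "0 < card (nbrs E y - insert v (nbrs E v))" using fin by (auto simp: card_gt_0_iff)
      then have "0 < card (nbrs E v - insert y (nbrs E y))" using card_Diff_nbrs[OF r uv(3) yV] small(1) by linarith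
      then obtain z where "z \<in> nbrs E v - insert y (nbrs E y)" by (metis card.empty ex_in_conv less_irrefl)
      then have z: "{v, z} \<in> E" "{z, y} \<notin> E" "z \<noteq> y" by (auto simp: nbrs_iff insert_commute)
      have e: "{u, z} \<in> E" "{v, u} \<notin> E" "{y, z} \<notin> E" using sub[OF z(1)] special(2) z by (auto simp: insert_commute)
      let ?E = "switch E v y u z"
      have r': "realization V ?E f"
        by (rule realization_switch[OF r y e(1,2,3) uv(1)[symmetric] z(3)[symmetric]])
      have zD: "z \<notin> D" "y \<notin> D" using nbrV z y by blast+
      have "dominates V ?E (insert u (D - {v}))"
        unfolding dominates_def
      proof (intro conjI ballI)
        show "insert u (D - {v}) \<subseteq> V" using DV uv by auto
        fix w assume w: "w \<in> V - insert u (D - {v})"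
        consider "w = v" | "w \<noteq> v" "{v, w} \<in> E" | "w \<noteq> v" "{v, w} \<notin> E" by blast
        then show "\<exists>a\<in>insert u (D - {v}). {a, w} \<in> ?E"
        proof cases
          case 1
          then show ?thesis by (auto simp: switch_def insert_commute)
        next
          case 2
          then have "{x, w} \<in> ?E" using small(2)[OF 2(2)] x xv uv zD by (auto simp: switch_def doubleton_eq_iff)
          then show ?thesis using x xv by blast
        next
          case 3
          have "w \<in> V - D" using w 3(1) by blast
          then obtain c where c: "c \<in> D - {v}" "{c, w} \<in> E" using other[OF _ 3(2)] by blast
          then have "{c, w} \<in> ?E" using w 3 uv zD by (auto simp: switch_def doubleton_eq_iff)
          then show ?thesis using c by blast
        qed
      qed
      then show ?thesis using that[OF r' _ u lt] by blast
    qed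
  qed
qed

definition swap :: "nat \<Rightarrow> nat \<Rightarrow> nat \<Rightarrow> nat" where
  "swap u v w = (if w = u then v else if w = v then u else w)"

text \<open>Vertices of equal degree may exchange names. This settles ties when the dominating set
  is moved to an initial segment.\<close>

lemma realization_relabel:
  assumes r: "realization V E f" and uv: "u \<in> V" "v \<in> V" "f u = f v"
  defines "\<tau> \<equiv> swap u v"
  shows "realization V ((`) \<tau> ` E) f" "dominates V E D \<Longrightarrow> dominates V ((`) \<tau> ` E) (\<tau> ` D)"
proof -
  have g: "graph_on V E" using r realization_graph by blast
  have inv: "\<tau> (\<tau> w) = w" for w by (simp add: \<tau>_def swap_def)
  have inj: "inj \<tau>" using inv by (metis injI)
  have tV: "\<tau> w \<in> V" if "w \<in> V" for w using that uv by (auto simp: \<tau>_def swap_def)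
  have edge: "{a, b} \<in> (`) \<tau> ` E \<longleftrightarrow> {\<tau> a, \<tau> b} \<in> E" for a b
  proof
    assume "{a, b} \<in> (`) \<tau> ` E"
    then obtain e where e: "e \<in> E" "{a, b} = \<tau> ` e" by blast
    have "\<tau> ` {a, b} = e" unfolding e(2) image_image inv by simp
    then have "{\<tau> a, \<tau> b} = e" by (simp only: image_insert image_empty)
    then show "{\<tau> a, \<tau> b} \<in> E" using e(1) by (simp only:)
  next
    assume "{\<tau> a, \<tau> b} \<in> E"
    then have "\<tau> ` {\<tau> a, \<tau> b} \<in> (`) \<tau> ` E" by blast
    then show "{a, b} \<in> (`) \<tau> ` E" by (simp add: inv)
  qed
  have "graph_on V ((`) \<tau> ` E)"
    using g tV inj unfolding graph_on_def by (auto simp: card_image inj_on_subset)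
  moreover have "card (nbrs ((`) \<tau> ` E) w) = f w" if w: "w \<in> V" for w
  proof -
    have "nbrs ((`) \<tau> ` E) w = \<tau> ` nbrs E (\<tau> w)"
    proof (rule set_eqI)
      fix x
      have "x \<in> \<tau> ` nbrs E (\<tau> w) \<longleftrightarrow> \<tau> x \<in> nbrs E (\<tau> w)" by (metis inv image_eqI image_iff)
      then show "x \<in> nbrs ((`) \<tau> ` E) w \<longleftrightarrow> x \<in> \<tau> ` nbrs E (\<tau> w)" by (simp only: nbrs_iff edge)
    qed
    then have "card (nbrs ((`) \<tau> ` E) w) = card (nbrs E (\<tau> w))"
      using inj by (simp add: card_image inj_on_subset)
    also have "\<dots> = f (\<tau> w)" using realization_card[OF r tV[OF w]] .
    also have "\<dots> = f w" using uv(3) by (auto simp: \<tau>_def swap_def)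
    finally show ?thesis .
  qed
  ultimately show "realization V ((`) \<tau> ` E) f" unfolding realization_def by blast
  show "dominates V ((`) \<tau> ` E) (\<tau> ` D)" if dom: "dominates V E D"
    unfolding dominates_def
  proof (intro conjI ballI)
    show "\<tau> ` D \<subseteq> V" using dom tV unfolding dominates_def by auto
    fix w assume w: "w \<in> V - \<tau> ` D"
    then have "\<tau> w \<in> V - D" using tV inv by (metis Diff_iff image_eqI)
    then obtain a where "a \<in> D" "{a, \<tau> w} \<in> E" using dom unfolding dominates_def by blast
    then show "\<exists>a\<in>\<tau> ` D. {a, w} \<in> (`) \<tau> ` E" by (intro bexI[of _ "\<tau> a"]) (auto simp: edge inv)
  qed
qed

theorem feasible_initial_segment:
  assumes r0: "realization {..<n} E0 f" and dom0: "dominates {..<n} E0 D0" and k: "card D0 = k"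
    and mono: "\<And>i j. i \<le> j \<Longrightarrow> j < n \<Longrightarrow> f j \<le> f i" and pos: "\<And>i. i < n \<Longrightarrow> 0 < f i"
  shows "feasible {..<k} {k..<n} f" "k \<le> n"
proof -
  have DV: "D \<subseteq> {..<n}" "finite D" if "dominates {..<n} E D" for E D
    using that finite_subset unfolding dominates_def by auto
  show kn: "k \<le> n" using DV[OF dom0] card_mono[of "{..<n}" D0] k by simp
  define ok where "ok p \<longleftrightarrow> realization {..<n} (fst p) f \<and> dominates {..<n} (fst p) (snd p) \<and> card (snd p) = k" for p
  \<comment> \<open>Lexicographic again: the degree sum of the set, which
    \<open>dominates_improve\<close> raises, and then its number of members below \<open>k\<close>,
    which is at most \<open>n\<close> and is raised by relabelling.\<close>
  define weight where "weight p = sum f (snd p) * Suc n + card (snd p \<inter> {..<k})" for p :: "nat set set \<times> nat set"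
  have sm: "card (D \<inter> {..<k}) \<le> n" for D
  proof -
    have "card (D \<inter> {..<k}) \<le> card {..<k}" by (intro card_mono) auto
    then show ?thesis using kn by simp
  qed
  have "weight p < Suc (sum f {..<n} * Suc n + n)" if "ok p" for p
  proof -
    have "sum f (snd p) \<le> sum f {..<n}" using DV that unfolding ok_def by (intro sum_mono2) auto
    then have "sum f (snd p) * Suc n \<le> sum f {..<n} * Suc n" by (rule mult_le_mono1)
    then show ?thesis using sm[of "snd p"] unfolding weight_def by linarith
  qed
  moreover have "ok (E0, D0)" using r0 dom0 k unfolding ok_def by simp
  ultimately obtain p where p: "ok p" and max: "\<And>q. ok q \<Longrightarrow> weight q \<le> weight p"
    using Lattices_Big.ex_has_greatest_nat[of ok "(E0, D0)" weight] by blast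
  obtain E D where pED: "p = (E, D)" by fastforce
  have r: "realization {..<n} E f" and dom: "dominates {..<n} E D" and cD: "card D = k"
    using p pED unfolding ok_def by auto
  note D = DV[OF dom]
  have card_swap: "card (insert y (D - {v})) = k" if "v \<in> D" "y \<notin> D" for v y
  proof -
    have "card (insert y (D - {v})) = Suc (card (D - {v}))" using that D by (intro card_insert_disjoint) auto
    then show ?thesis using card_Suc_Diff1[OF D(2) that(1)] cD by simp
  qed
  have no_lt: "f u \<le> f v" if v: "v \<in> D" and u: "u \<in> {..<n} - D" for u v
  proof (rule ccontr)
    assume "\<not> f u \<le> f v"
    then have lt: "f v < f u" by simp
    have "0 < f v" using pos v D by auto
    then obtain E' y where E': "realization {..<n} E' f" "dominates {..<n} E' (insert y (D - {v}))"
      "y \<in> {..<n} - D" "f v < f y"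
      using dominates_improve[OF r dom v u lt] by metis
    have "ok (E', insert y (D - {v}))" using E' card_swap[OF v, of y] unfolding ok_def by simp
    then have le: "weight (E', insert y (D - {v})) \<le> weight p" using max by blast
    have "sum f (insert y (D - {v})) = f y + sum f (D - {v})" using E' D by simp
    moreover have "sum f D = f v + sum f (D - {v})" using D v by (simp add: sum.remove)
    ultimately have "Suc (sum f D) \<le> sum f (insert y (D - {v}))" using E'(4) by simp
    then have "Suc (sum f D) * Suc n \<le> sum f (insert y (D - {v})) * Suc n" by (rule mult_le_mono1)
    moreover have "weight p < Suc (sum f D) * Suc n" using sm[of D] unfolding weight_def pED by simp
    ultimately show False using le unfolding weight_def by simp
  qed
  have "D = {..<k}"
  proof (rule ccontr)
    assume ne: "D \<noteq> {..<k}"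
    have "\<not> D \<subseteq> {..<k}" using card_subset_eq[of "{..<k}" D] ne cD by (metis card_lessThan finite_lessThan)
    then obtain v where "v \<in> D" "v \<notin> {..<k}" by blast
    then have v: "v \<in> D" "k \<le> v" "v < n" using D by auto
    have "\<not> {..<k} \<subseteq> D" using card_subset_eq[OF D(2), of "{..<k}"] ne cD by (metis card_lessThan)
    then obtain u where u: "u < k" "u \<notin> D" by blast
    have uV: "u \<in> {..<n} - D" "v \<in> {..<n}" "u \<in> {..<n}" using u kn v by auto
    have "f u = f v" using no_lt[OF v(1) uV(1)] mono[of u v] u v by simp
    note rl = realization_relabel[OF r uV(3,2) this]
    let ?\<tau> = "swap u v"
    have tD: "?\<tau> ` D = insert u (D - {v})"
    proof -
      have "?\<tau> w = w" if "w \<in> D - {v}" for w using that u by (auto simp: swap_def)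
      then have "?\<tau> ` (D - {v}) = id ` (D - {v})" by (intro image_cong) auto
      moreover have "?\<tau> v = u" by (simp add: swap_def)
      moreover have "?\<tau> ` D = ?\<tau> ` insert v (D - {v})" using v(1) by (simp add: insert_absorb)
      ultimately show ?thesis by (simp only: image_insert image_id id_apply image_ident)
    qed
    have "ok ((`) ?\<tau> ` E, insert u (D - {v}))"
      using rl(1) rl(2)[OF dom] card_swap[OF v(1) u(2)] unfolding ok_def tD by simp
    then have le: "weight ((`) ?\<tau> ` E, insert u (D - {v})) \<le> weight p" using max by blast
    have "sum f (insert u (D - {v})) = f u + sum f (D - {v})" using u D by simp
    moreover have "sum f D = f v + sum f (D - {v})" using D v by (simp add: sum.remove)
    ultimately have "sum f (insert u (D - {v})) = sum f D" using \<open>f u = f v\<close> by simp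
    moreover have "insert u (D - {v}) \<inter> {..<k} = insert u (D \<inter> {..<k})" using u v by auto
    then have "card (insert u (D - {v}) \<inter> {..<k}) = Suc (card (D \<inter> {..<k}))" using u by simp
    ultimately show False using le unfolding weight_def pED by simp
  qed
  moreover have "{..<k} \<union> {k..<n} = {..<n}" using kn by auto
  moreover have "{..<n} - {..<k} = {k..<n}" by auto
  ultimately have "dominated {..<k} {k..<n} f E"
    using r dom unfolding dominated_def dominates_def by auto
  then show "feasible {..<k} {k..<n} f" using feasible_iff by blast
qed

section \<open>Running times\<close>

text \<open>Total correctness with a time bound. Since \<open>exec\<close> is deterministic, the run
  that is asserted to exist is the only one.\<close>

definition runs :: "nat \<Rightarrow> com \<Rightarrow> state \<Rightarrow> nat \<Rightarrow> (state \<Rightarrow> bool) \<Rightarrow> bool" where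
  "runs w c s T Q \<longleftrightarrow> (\<exists>t s'. exec w c s t s' \<and> t \<le> T \<and> Q s')"

lemma runs_conseq:
  assumes "runs w c s T P" "T \<le> T'" "\<And>s'. P s' \<Longrightarrow> Q s'"
  shows "runs w c s T' Q"
  using assms unfolding runs_def by (meson le_trans)

lemma runs_Assign:
  assumes "fits w e s" "Q (s\<lparr>regs := (regs s)(x := eval e s)\<rparr>)" "1 + cost e \<le> T"
  shows "runs w (Assign x e) s T Q"
  using assms exec.Assign unfolding runs_def by blast

lemma runs_Store:
  assumes "fits w i s" "fits w e s"
    "Q (s\<lparr>arrs := (arrs s)(a := (arrs s a)(eval i s := eval e s))\<rparr>)" "1 + cost i + cost e \<le> T"
  shows "runs w (Store a i e) s T Q"
  using assms exec.Store unfolding runs_def by blast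

lemma runs_Skip: "Q s \<Longrightarrow> 1 \<le> T \<Longrightarrow> runs w Skip s T Q"
  using exec.Skip unfolding runs_def by blast

lemma runs_Seq:
  assumes "runs w c1 s Ta P" "\<And>s'. P s' \<Longrightarrow> runs w c2 s' Tc Q" "Ta + Tc \<le> T"
  shows "runs w (Seq c1 c2) s T Q"
proof -
  obtain t1 s1 where 1: "exec w c1 s t1 s1" "t1 \<le> Ta" "P s1" using assms(1) unfolding runs_def by blast
  obtain t2 s2 where 2: "exec w c2 s1 t2 s2" "t2 \<le> Tc" "Q s2" using assms(2)[OF 1(3)] unfolding runs_def by blast
  have "exec w (Seq c1 c2) s (t1 + t2) s2" using 1(1) 2(1) by (rule exec.Seq)
  moreover have "t1 + t2 \<le> T" using 1 2 assms(3) by simp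
  ultimately show ?thesis using 2(3) unfolding runs_def by blast
qed

lemma runs_Cond:
  assumes "bfits w b s" "beval b s \<Longrightarrow> runs w c1 s Ta Q" "\<not> beval b s \<Longrightarrow> runs w c2 s Ta Q"
    "1 + bcost b + Ta \<le> T"
  shows "runs w (Cond b c1 c2) s T Q"
proof (cases "beval b s")
  case True
  then obtain t s' where "exec w c1 s t s'" "t \<le> Ta" "Q s'" using assms(2) unfolding runs_def by blast
  then have "exec w (Cond b c1 c2) s (1 + bcost b + t) s'" "1 + bcost b + t \<le> T" "Q s'"
    using exec.CondTrue[OF assms(1) True] assms(4) by auto
  then show ?thesis unfolding runs_def by blast
next
  case False
  then obtain t s' where "exec w c2 s t s'" "t \<le> Ta" "Q s'" using assms(3) unfolding runs_def by blast
  then have "exec w (Cond b c1 c2) s (1 + bcost b + t) s'" "1 + bcost b + t \<le> T" "Q s'"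
    using exec.CondFalse[OF assms(1) False] assms(4) by auto
  then show ?thesis unfolding runs_def by blast
qed

text \<open>The variant \<open>m\<close> may drop by more than one in a pass; at most
  \<open>m + 1\<close> tests are charged.\<close>

lemma runs_While:
  assumes I: "I m s" and fit: "\<And>m s. I m s \<Longrightarrow> bfits w b s"
    and body: "\<And>m s. I m s \<Longrightarrow> beval b s \<Longrightarrow> runs w c s Tb (\<lambda>s'. \<exists>m'<m. I m' s')"
    and exit: "\<And>m s. I m s \<Longrightarrow> \<not> beval b s \<Longrightarrow> Q s"
    and T: "(m + 1) * (1 + bcost b + Tb) \<le> T"
  shows "runs w (While b c) s T Q"
proof -
  have "runs w (While b c) s ((m + 1) * (1 + bcost b + Tb)) Q" using I
  proof (induction m arbitrary: s rule: less_induct)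
    case (less m)
    show ?case
    proof (cases "beval b s")
      case True
      obtain t1 s1 m1 where 1: "exec w c s t1 s1" "t1 \<le> Tb" "m1 < m" "I m1 s1"
        using body[OF less.prems True] unfolding runs_def by blast
      obtain t2 s2 where 2: "exec w (While b c) s1 t2 s2" "t2 \<le> (m1 + 1) * (1 + bcost b + Tb)" "Q s2"
        using less.IH[OF 1(3,4)] unfolding runs_def by blast
      have "exec w (While b c) s (1 + bcost b + t1 + t2) s2"
        by (rule exec.WhileTrue[OF fit[OF less.prems] True 1(1) 2(1)])
      moreover have "(m1 + 1) * (1 + bcost b + Tb) \<le> m * (1 + bcost b + Tb)"
        using 1(3) by (intro mult_right_mono) auto
      then have "1 + bcost b + t1 + t2 \<le> (m + 1) * (1 + bcost b + Tb)"
        using 1(2) 2(2) by (simp add: algebra_simps)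
      ultimately show ?thesis using 2(3) unfolding runs_def by blast
    next
      case False
      have "exec w (While b c) s (1 + bcost b) s" by (rule exec.WhileFalse[OF fit[OF less.prems] False])
      then show ?thesis using exit[OF less.prems False] unfolding runs_def by (intro exI[of _ "1 + bcost b"]) auto
    qed
  qed
  then show ?thesis using T by (rule runs_conseq)
qed

definition For :: "nat \<Rightarrow> exp \<Rightarrow> exp \<Rightarrow> com \<Rightarrow> com" where
  "For i lo hi c = Seq (Assign i lo) (While (Less (Reg i) hi) (Seq c (Assign i (Plus (Reg i) (Const 1)))))"

text \<open>A pass costs \<open>3 + cost hi\<close> for the test, \<open>Tb\<close> for the body and
  4 for the increment. The invariant is required after the increment, so the body itself only has to
  leave the loop variable alone.\<close>

lemma runs_For:
  assumes lo: "fits w lo s" "eval lo s = l" "l \<le> h" "h \<le> w" "0 < w"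
    and I0: "I l (s\<lparr>regs := (regs s)(i := l)\<rparr>)"
    and hi: "\<And>j s'. I j s' \<Longrightarrow> fits w hi s' \<and> eval hi s' = h"
    and body: "\<And>j s'. I j s' \<Longrightarrow> regs s' i = j \<Longrightarrow> l \<le> j \<Longrightarrow> j < h \<Longrightarrow>
      runs w c s' Tb (\<lambda>s''. regs s'' i = j \<and> I (Suc j) (s''\<lparr>regs := (regs s'')(i := Suc j)\<rparr>))"
    and exit: "\<And>s'. I h s' \<Longrightarrow> Q s'"
    and T: "1 + cost lo + (h - l + 1) * (7 + cost hi + Tb) \<le> T"
  shows "runs w (For i lo hi c) s T Q"
  unfolding For_def
proof (rule runs_Seq[where P = "\<lambda>s'. s' = s\<lparr>regs := (regs s)(i := l)\<rparr>" and Ta = "1 + cost lo"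
      and Tc = "(h - l + 1) * (7 + cost hi + Tb)"])
  show "runs w (Assign i lo) s (1 + cost lo) (\<lambda>s'. s' = s\<lparr>regs := (regs s)(i := l)\<rparr>)"
    by (rule runs_Assign[OF lo(1)]) (use lo(2) in simp_all)
next
  fix s0 assume s0: "s0 = s\<lparr>regs := (regs s)(i := l)\<rparr>"
  let ?J = "\<lambda>m s'. I (regs s' i) s' \<and> l \<le> regs s' i \<and> regs s' i \<le> h \<and> m = h - regs s' i"
  show "runs w (While (Less (Reg i) hi) (Seq c (Assign i (Plus (Reg i) (Const 1))))) s0
      ((h - l + 1) * (7 + cost hi + Tb)) Q"
  proof (rule runs_While[where I = ?J and m = "h - l" and Tb = "Tb + 4"])
    show "?J (h - l) s0" using I0 lo(3) s0 by simp
    show "bfits w (Less (Reg i) hi) s'" if "?J m s'" for m s'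
      using hi that lo(4) by (auto intro: le_trans)
    show "Q s'" if "?J m s'" "\<not> beval (Less (Reg i) hi) s'" for m s'
      using that hi[of "regs s' i" s'] exit[of s'] by (auto dest: le_antisym)
    show "(h - l + 1) * (1 + bcost (Less (Reg i) hi) + (Tb + 4)) \<le> (h - l + 1) * (7 + cost hi + Tb)"
      by (simp add: algebra_simps)
    fix m s1 assume J: "?J m s1" and b: "beval (Less (Reg i) hi) s1"
    have lt: "regs s1 i < h" using b hi J by auto
    show "runs w (Seq c (Assign i (Plus (Reg i) (Const 1)))) s1 (Tb + 4) (\<lambda>s'. \<exists>m'<m. ?J m' s')"
    proof (rule runs_Seq[OF body[of "regs s1 i" s1]])
      fix s2 assume s2: "regs s2 i = regs s1 i \<and> I (Suc (regs s1 i)) (s2\<lparr>regs := (regs s2)(i := Suc (regs s1 i))\<rparr>)"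
      show "runs w (Assign i (Plus (Reg i) (Const 1))) s2 4 (\<lambda>s'. \<exists>m'<m. ?J m' s')"
        by (rule runs_Assign) (use s2 lt J lo(4,5) in auto)
    qed (use J lt in auto)
  qed
qed (use T in \<open>simp add: add.assoc\<close>)

text \<open>The frame condition for computations that do not write to memory; \<open>X\<close>
  collects their scratch registers.\<close>

definition agree :: "nat set \<Rightarrow> state \<Rightarrow> state \<Rightarrow> bool" where
  "agree X s s' \<longleftrightarrow> arrs s' = arrs s \<and> (\<forall>x. x \<notin> X \<longrightarrow> regs s' x = regs s x)"

lemma agree_refl: "agree X s s"
  by (simp add: agree_def)

lemma agree_trans: "agree X s s' \<Longrightarrow> agree X s' s'' \<Longrightarrow> agree X s s''"
  by (simp add: agree_def)

definition Sum :: "nat \<Rightarrow> exp \<Rightarrow> exp \<Rightarrow> exp \<Rightarrow> com" where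
  "Sum a lo hi e = Seq (Assign a (Const 0)) (For 4 lo hi (Assign a (Plus (Reg a) e)))"

lemma runs_Sum:
  fixes g :: "nat \<Rightarrow> nat"
  assumes a: "a \<noteq> 4" and l: "l \<le> h" "h \<le> w" "0 < w"
    and lo: "\<And>s'. agree {4, a} s s' \<Longrightarrow> fits w lo s' \<and> eval lo s' = l"
    and hi: "\<And>s'. agree {4, a} s s' \<Longrightarrow> fits w hi s' \<and> eval hi s' = h"
    and e: "\<And>s' i. agree {4, a} s s' \<Longrightarrow> regs s' 4 = i \<Longrightarrow> l \<le> i \<Longrightarrow> i < h \<Longrightarrow> fits w e s' \<and> eval e s' = g i"
    and small: "sum g {l..<h} \<le> w"
    and Q: "\<And>s'. agree {4, a} s s' \<Longrightarrow> regs s' a = sum g {l..<h} \<Longrightarrow> Q s'"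
    and T: "3 + cost lo + (h - l + 1) * (10 + cost hi + cost e) \<le> T"
  shows "runs w (Sum a lo hi e) s T Q"
  unfolding Sum_def
proof (rule runs_Seq[where P = "\<lambda>s'. s' = s\<lparr>regs := (regs s)(a := 0)\<rparr>" and Ta = 2
      and Tc = "1 + cost lo + (h - l + 1) * (7 + cost hi + (3 + cost e))"])
  show "runs w (Assign a (Const 0)) s 2 (\<lambda>s'. s' = s\<lparr>regs := (regs s)(a := 0)\<rparr>)"
    by (rule runs_Assign) auto
next
  fix s0 assume s0: "s0 = s\<lparr>regs := (regs s)(a := 0)\<rparr>"
  have ag0: "agree {4, a} s s0" using s0 by (auto simp: agree_def)
  let ?I = "\<lambda>j s'. agree {4, a} s s' \<and> regs s' a = sum g {l..<j}"
  show "runs w (For 4 lo hi (Assign a (Plus (Reg a) e))) s0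
      (1 + cost lo + (h - l + 1) * (7 + cost hi + (3 + cost e))) Q"
  proof (rule runs_For[where I = ?I and Tb = "3 + cost e" and l = l and h = h])
    show "?I l (s0\<lparr>regs := (regs s0)(4 := l)\<rparr>)" using ag0 s0 a by (auto simp: agree_def)
    fix j s' assume I: "?I j s'" and j: "regs s' 4 = j" "l \<le> j" "j < h"
    have ej: "fits w e s'" "eval e s' = g j" using e[of s' j] I j by auto
    have "sum g {l..<j} + g j = sum g {l..<Suc j}" using j by simp
    moreover have "sum g {l..<Suc j} \<le> sum g {l..<h}" using j by (intro sum_mono2) auto
    ultimately have le: "sum g {l..<j} + g j \<le> w" using small by simp
    show "runs w (Assign a (Plus (Reg a) e)) s' (3 + cost e)
       (\<lambda>s''. regs s'' 4 = j \<and> ?I (Suc j) (s''\<lparr>regs := (regs s'')(4 := Suc j)\<rparr>))"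
      by (rule runs_Assign) (use I j ej le a in \<open>auto simp: agree_def\<close>)
  qed (use ag0 lo hi l Q in auto)
qed (use T in \<open>simp add: add.assoc\<close>)

section \<open>Evaluating the two conditions\<close>

text \<open>The minimum of register 3 and \<open>e\<close>, by truncated subtraction.\<close>

definition min_exp :: "exp \<Rightarrow> exp" where
  "min_exp e = Minus (Reg 3) (Minus (Reg 3) e)"

text \<open>Registers: 0 holds \<open>n\<close>, 1 the size \<open>k\<close> of the dominating set, 2 the pivot, 3 the size of the
  set \<open>W\<close> whose inequality is tested, 4 a loop variable, 5 to 8 the sums in the inequalities,
  9 the degree of the pivot, 10 the number of its chosen neighbours, 11 and 12 the best degree
  found in a scan and its vertex. Array 0 holds the residual degrees, array 1 the graph.\<close>

definition Eval :: "exp \<Rightarrow> com" where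
  "Eval lo = Seq (Sum 5 lo (Plus lo (Reg 3)) (Load 0 (Reg 4)))
    (Seq (Sum 6 (Plus lo (Reg 3)) (Reg 0) (min_exp (Minus (Load 0 (Reg 4)) (Const 1))))
    (Seq (Sum 7 (Const 0) (Reg 1) (Load 0 (Reg 4)))
      (Sum 8 (Const 0) (Reg 1) (min_exp (Load 0 (Reg 4))))))"

definition evaluated :: "nat \<Rightarrow> nat \<Rightarrow> nat \<Rightarrow> nat \<Rightarrow> (nat \<Rightarrow> nat) \<Rightarrow> state \<Rightarrow> bool" where
  "evaluated n k l t r s \<longleftrightarrow> regs s 5 = sum r {l..<l + t} \<and>
    regs s 6 = (\<Sum>i\<in>{l + t..<n}. min t (r i - 1)) \<and>
    regs s 7 = sum r {0..<k} \<and> regs s 8 = (\<Sum>i\<in>{0..<k}. min t (r i))"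

lemma sum_le_square:
  assumes "\<And>i. i \<in> {a..<b} \<Longrightarrow> g i \<le> (n::nat)" "b \<le> n"
  shows "sum g {a..<b} \<le> n * n"
proof -
  have "sum g {a..<b} \<le> of_nat (card {a..<b}) * n" by (rule sum_bounded_above) (use assms in auto)
  also have "\<dots> \<le> n * n" using assms(2) by (intro mult_right_mono) auto
  finally show ?thesis .
qed

text \<open>The bound on \<open>w\<close> recurs throughout: a test adds up to three quantities of
  size at most \<open>n * n\<close>, and the matrix indices lie below \<open>n * n\<close>; the
  constants are generous.\<close>

lemma runs_Eval:
  assumes s: "regs s 0 = n" "regs s 1 = k" "regs s 3 = t" "\<And>i. i < n \<Longrightarrow> arrs s 0 i = r i"
    and r: "\<And>i. i < n \<Longrightarrow> r i \<le> n" and k: "k \<le> n" and lt: "l + t \<le> n"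
    and w: "4 * (n + 1) * (n + 1) + 20 \<le> w"
    and lo: "\<And>s'. agree {4, 5, 6, 7, 8} s s' \<Longrightarrow> fits w lo s' \<and> eval lo s' = l" and cost: "cost lo \<le> 3"
  shows "runs w (Eval lo) s (200 * (n + 1)) (\<lambda>s'. agree {4, 5, 6, 7, 8} s s' \<and> evaluated n k l t r s')"
proof -
  have nw: "n \<le> w" "n * n \<le> w" "0 < w" "1 \<le> w" using w by (auto simp: algebra_simps)
  let ?X = "{4, 5, 6, 7, 8} :: nat set"
  have ag: "regs s' 0 = n" "regs s' 1 = k" "regs s' 3 = t" "\<And>i. i < n \<Longrightarrow> arrs s' 0 i = r i"
    if "agree ?X s s'" for s'
    using that s by (auto simp: agree_def)
  have b1: "sum r {l..<l + t} \<le> w" using sum_le_square[of l "l + t" r n] r lt nw by auto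
  have b2: "(\<Sum>i\<in>{l + t..<n}. min t (r i - 1)) \<le> w"
    using sum_le_square[of "l + t" n "\<lambda>i. min t (r i - 1)" n] lt nw by (auto simp: min_le_iff_disj)
  have b3: "sum r {0..<k} \<le> w" using sum_le_square[of 0 k r n] r k nw by auto
  have b4: "(\<Sum>i\<in>{0..<k}. min t (r i)) \<le> w"
    using sum_le_square[of 0 k "\<lambda>i. min t (r i)" n] lt k nw by (auto simp: min_le_iff_disj)
  have rw: "r i \<le> w" if "i < n" for i using r[OF that] nw by simp
  \<comment> \<open>One estimate for all four sums, with 35 as a generous bound for the cost of a
    pass.\<close>
  have T: "3 + c + (b - a + 1) * y \<le> 50 * (n + 1)" if "y \<le> 35" "b \<le> n" "c \<le> 6" for a b c y :: nat
  proof -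
    have "(b - a + 1) * y \<le> (n + 1) * 35" using that by (intro mult_mono) auto
    then show ?thesis using that by simp
  qed
  show ?thesis unfolding Eval_def
  proof (rule runs_Seq[where Ta = "50 * (n + 1)" and Tc = "150 * (n + 1)" and
        P = "\<lambda>s'. agree ?X s s' \<and> regs s' 5 = sum r {l..<l + t}"])
    show "runs w (Sum 5 lo (Plus lo (Reg 3)) (Load 0 (Reg 4))) s (50 * (n + 1))
        (\<lambda>s'. agree ?X s s' \<and> regs s' 5 = sum r {l..<l + t})"
    proof (rule runs_Sum[where g = r and l = l and h = "l + t"])
      fix s' assume a: "agree {4, 5} s s'"
      then have a': "agree ?X s s'" by (auto simp: agree_def)
      show "fits w lo s' \<and> eval lo s' = l" using lo[OF a'] .
      show "fits w (Plus lo (Reg 3)) s' \<and> eval (Plus lo (Reg 3)) s' = l + t"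
        using lo[OF a'] ag[OF a'] lt nw by simp
      show "fits w (Load 0 (Reg 4)) s' \<and> eval (Load 0 (Reg 4)) s' = r i" if "regs s' 4 = i" "i < l + t" for i
        using ag(4)[OF a', of i] rw[of i] that lt nw by simp
    next
      show "3 + cost lo + (l + t - l + 1) * (10 + cost (Plus lo (Reg 3)) + cost (Load 0 (Reg 4))) \<le> 50 * (n + 1)"
        by (rule T) (use cost lt in auto)
    qed (use lt nw b1 in \<open>auto simp: agree_def\<close>)
  next
    fix s1 assume s1: "agree ?X s s1 \<and> regs s1 5 = sum r {l..<l + t}"
    show "runs w (Seq (Sum 6 (Plus lo (Reg 3)) (Reg 0) (min_exp (Minus (Load 0 (Reg 4)) (Const 1))))
        (Seq (Sum 7 (Const 0) (Reg 1) (Load 0 (Reg 4))) (Sum 8 (Const 0) (Reg 1) (min_exp (Load 0 (Reg 4))))))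
        s1 (150 * (n + 1)) (\<lambda>s'. agree ?X s s' \<and> evaluated n k l t r s')"
    proof (rule runs_Seq[where Ta = "50 * (n + 1)" and Tc = "100 * (n + 1)" and
        P = "\<lambda>s'. agree ?X s s' \<and> regs s' 5 = sum r {l..<l + t} \<and> regs s' 6 = (\<Sum>i\<in>{l + t..<n}. min t (r i - 1))"])
      show "runs w (Sum 6 (Plus lo (Reg 3)) (Reg 0) (min_exp (Minus (Load 0 (Reg 4)) (Const 1)))) s1 (50 * (n + 1))
        (\<lambda>s'. agree ?X s s' \<and> regs s' 5 = sum r {l..<l + t} \<and> regs s' 6 = (\<Sum>i\<in>{l + t..<n}. min t (r i - 1)))"
      proof (rule runs_Sum[where g = "\<lambda>i. min t (r i - 1)" and l = "l + t" and h = n])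
        fix s' assume a: "agree {4, 6} s1 s'"
        then have a': "agree ?X s s'" using s1 by (auto simp: agree_def)
        show "fits w (Plus lo (Reg 3)) s' \<and> eval (Plus lo (Reg 3)) s' = l + t"
          using lo[OF a'] ag[OF a'] lt nw by simp
        show "fits w (Reg 0) s' \<and> eval (Reg 0) s' = n" using ag[OF a'] nw by simp
        show "fits w (min_exp (Minus (Load 0 (Reg 4)) (Const 1))) s' \<and>
            eval (min_exp (Minus (Load 0 (Reg 4)) (Const 1))) s' = min t (r i - 1)"
          if "regs s' 4 = i" "i < n" for i
          using ag(3)[OF a'] ag(4)[OF a', of i] rw[of i] that lt nw by (auto simp: min_exp_def)
      next
        show "3 + cost (Plus lo (Reg 3)) + (n - (l + t) + 1) *
            (10 + cost (Reg 0) + cost (min_exp (Minus (Load 0 (Reg 4)) (Const 1)))) \<le> 50 * (n + 1)"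
          by (rule T) (use cost lt in \<open>auto simp: min_exp_def\<close>)
      qed (use s1 lt nw b2 in \<open>auto simp: agree_def\<close>)
    next
      fix s2 assume s2: "agree ?X s s2 \<and> regs s2 5 = sum r {l..<l + t} \<and> regs s2 6 = (\<Sum>i\<in>{l + t..<n}. min t (r i - 1))"
      show "runs w (Seq (Sum 7 (Const 0) (Reg 1) (Load 0 (Reg 4))) (Sum 8 (Const 0) (Reg 1) (min_exp (Load 0 (Reg 4)))))
        s2 (100 * (n + 1)) (\<lambda>s'. agree ?X s s' \<and> evaluated n k l t r s')"
      proof (rule runs_Seq[where Ta = "50 * (n + 1)" and Tc = "50 * (n + 1)" and
        P = "\<lambda>s'. agree ?X s s' \<and> regs s' 5 = sum r {l..<l + t} \<and>
          regs s' 6 = (\<Sum>i\<in>{l + t..<n}. min t (r i - 1)) \<and> regs s' 7 = sum r {0..<k}"])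
        show "runs w (Sum 7 (Const 0) (Reg 1) (Load 0 (Reg 4))) s2 (50 * (n + 1))
          (\<lambda>s'. agree ?X s s' \<and> regs s' 5 = sum r {l..<l + t} \<and>
            regs s' 6 = (\<Sum>i\<in>{l + t..<n}. min t (r i - 1)) \<and> regs s' 7 = sum r {0..<k})"
        proof (rule runs_Sum[where g = r and l = 0 and h = k])
          fix s' assume a: "agree {4, 7} s2 s'"
          then have a': "agree ?X s s'" using s2 by (auto simp: agree_def)
          show "fits w (Reg 1) s' \<and> eval (Reg 1) s' = k" using ag[OF a'] k nw by simp
          show "fits w (Load 0 (Reg 4)) s' \<and> eval (Load 0 (Reg 4)) s' = r i" if "regs s' 4 = i" "i < k" for i
            using ag(4)[OF a', of i] rw[of i] that k nw by simp
        next
          show "3 + cost (Const 0) + (k - 0 + 1) * (10 + cost (Reg 1) + cost (Load 0 (Reg 4))) \<le> 50 * (n + 1)"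
            by (rule T) (use k in auto)
        qed (use s2 k nw b3 in \<open>auto simp: agree_def\<close>)
      next
        fix s3 assume s3: "agree ?X s s3 \<and> regs s3 5 = sum r {l..<l + t} \<and>
          regs s3 6 = (\<Sum>i\<in>{l + t..<n}. min t (r i - 1)) \<and> regs s3 7 = sum r {0..<k}"
        show "runs w (Sum 8 (Const 0) (Reg 1) (min_exp (Load 0 (Reg 4)))) s3 (50 * (n + 1))
          (\<lambda>s'. agree ?X s s' \<and> evaluated n k l t r s')"
        proof (rule runs_Sum[where g = "\<lambda>i. min t (r i)" and l = 0 and h = k])
          fix s' assume a: "agree {4, 8} s3 s'"
          then have a': "agree ?X s s'" using s3 by (auto simp: agree_def)
          show "fits w (Reg 1) s' \<and> eval (Reg 1) s' = k" using ag[OF a'] k nw by simp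
          show "fits w (min_exp (Load 0 (Reg 4))) s' \<and> eval (min_exp (Load 0 (Reg 4))) s' = min t (r i)"
            if "regs s' 4 = i" "i < k" for i
            using ag(3)[OF a'] ag(4)[OF a', of i] rw[of i] that lt k nw by (auto simp: min_exp_def)
          assume "regs s' 8 = (\<Sum>i\<in>{0..<k}. min t (r i))"
          then show "agree ?X s s' \<and> evaluated n k l t r s'"
            using a a' s3 by (auto simp: agree_def evaluated_def)
        next
          show "3 + cost (Const 0) + (k - 0 + 1) * (10 + cost (Reg 1) + cost (min_exp (Load 0 (Reg 4)))) \<le> 50 * (n + 1)"
            by (rule T) (use k in \<open>auto simp: min_exp_def\<close>)
        qed (use k nw b4 in auto)
      qed simp
    qed simp
  qed simp
qed

text \<open>True on violation. The set \<open>W\<close> consists of the first \<open>Reg 3\<close>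
  vertices from \<open>lo\<close> on, so the truncated difference with \<open>Reg 0\<close> is
  \<open>card (C - W)\<close>.\<close>

definition test_A :: "exp \<Rightarrow> bexp" where
  "test_A lo = Less (Plus (Plus (Reg 6) (Reg 7)) (Times (Reg 3) (Minus (Reg 3) (Const 1))))
    (Plus (Reg 5) (Minus (Reg 0) (Plus lo (Reg 3))))"

definition test_B :: bexp where
  "test_B = Less (Plus (Plus (Reg 6) (Reg 8)) (Times (Reg 3) (Minus (Reg 3) (Const 1)))) (Reg 5)"

lemma tests:
  assumes s: "evaluated n k l t r s" "regs s 0 = n" "regs s 3 = t" "eval lo s = l" "fits w lo s"
    and r: "\<And>i. i < n \<Longrightarrow> r i \<le> n" and k: "k \<le> n" and lt: "l + t \<le> n"
    and w: "4 * (n + 1) * (n + 1) + 20 \<le> w"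
  shows "bfits w (test_A lo) s" "bfits w test_B s"
    "beval (test_A lo) s \<longleftrightarrow> \<not> cond_A {..<k} {l..<n} r {l..<l + t}"
    "beval test_B s \<longleftrightarrow> \<not> cond_B {..<k} {l..<n} r {l..<l + t}"
proof -
  have C: "{l..<n} - {l..<l + t} = {l + t..<n}" using lt by auto
  have b1: "sum r {l..<l + t} \<le> n * n" using sum_le_square[of l "l + t" r n] r lt by auto
  have b2: "(\<Sum>i\<in>{l + t..<n}. min t (r i - 1)) \<le> n * n"
    using sum_le_square[of "l + t" n "\<lambda>i. min t (r i - 1)" n] lt by (auto simp: min_le_iff_disj)
  have b3: "sum r {0..<k} \<le> n * n" using sum_le_square[of 0 k r n] r k by auto
  have b4: "(\<Sum>i\<in>{0..<k}. min t (r i)) \<le> n * n"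
    using sum_le_square[of 0 k "\<lambda>i. min t (r i)" n] lt k by (auto simp: min_le_iff_disj)
  have b5: "t * (t - 1) \<le> n * n" using lt by (intro mult_mono) auto
  have w': "4 * (n * n) + 8 * n + 24 \<le> w" using w by (simp add: algebra_simps)
  note ev = s(1)[unfolded evaluated_def]
  have bounds: "regs s 5 \<le> n * n" "regs s 6 \<le> n * n" "regs s 7 \<le> n * n" "regs s 8 \<le> n * n"
    using ev b1 b2 b3 b4 by auto
  show "bfits w (test_A lo) s" "bfits w test_B s"
    unfolding test_A_def test_B_def using s(2-5) bounds b5 w' lt by auto
  show "beval (test_A lo) s \<longleftrightarrow> \<not> cond_A {..<k} {l..<n} r {l..<l + t}"
    "beval test_B s \<longleftrightarrow> \<not> cond_B {..<k} {l..<n} r {l..<l + t}"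
    unfolding test_A_def test_B_def cond_A_def cond_B_def C
    using s(2-5) ev by (auto simp: lessThan_atLeast0)
qed

definition scan_step :: "(nat \<Rightarrow> nat \<Rightarrow> bool) \<Rightarrow> (nat \<Rightarrow> bool) \<Rightarrow> (nat \<Rightarrow> nat) \<Rightarrow> nat \<Rightarrow> nat \<times> nat \<Rightarrow> nat \<times> nat" where
  "scan_step le m r i b = (if m i \<and> le (fst b) (r i) then (r i, i) else b)"

text \<open>As ties move on to the later index, the winner is weakly better than the candidates
  before it and strictly better than those after it. The lists \<open>ys\<close> and
  \<open>zs\<close> keep this information for the tie-breaking order \<open>before\<close>.\<close>

lemma fold_scan_step:
  assumes trans: "\<And>x y z. le x y \<Longrightarrow> le y z \<Longrightarrow> le x z" and total: "\<And>x y. le x y \<or> le y x"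
    and ex: "\<exists>x\<in>set xs. m x" and init: "\<And>x. x \<in> set xs \<Longrightarrow> m x \<Longrightarrow> le a (r x)"
  obtains ys i zs where "xs = ys @ i # zs" "fold (scan_step le m r) xs (a, b) = (r i, i)" "m i"
    "\<And>y. y \<in> set ys \<Longrightarrow> m y \<Longrightarrow> le (r y) (r i)" "\<And>z. z \<in> set zs \<Longrightarrow> m z \<Longrightarrow> \<not> le (r i) (r z)"
proof -
  let ?fold = "\<lambda>xs. fold (scan_step le m r) xs (a, b)"
  define found where "found xs \<longleftrightarrow> (\<exists>ys i zs. xs = ys @ i # zs \<and> ?fold xs = (r i, i) \<and> m i \<and>
    (\<forall>y\<in>set ys. m y \<longrightarrow> le (r y) (r i)) \<and> (\<forall>z\<in>set zs. m z \<longrightarrow> \<not> le (r i) (r z)))" for xs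
  have "(\<forall>x\<in>set xs. \<not> m x) \<and> ?fold xs = (a, b) \<or> found xs" using init
  proof (induction xs rule: rev_induct)
    case (snoc x xs)
    have f: "?fold (xs @ [x]) = scan_step le m r x (?fold xs)" by simp
    have last: "found (xs @ [x])" if "m x" "?fold (xs @ [x]) = (r x, x)" "\<forall>y\<in>set xs. m y \<longrightarrow> le (r y) (r x)"
      unfolding found_def using that by (intro exI[of _ xs] exI[of _ x] exI[of _ "[]::nat list"]) simp
    have "(\<forall>x\<in>set xs. \<not> m x) \<and> ?fold xs = (a, b) \<or> found xs" using snoc by auto
    then show ?case
    proof
      assume none: "(\<forall>x\<in>set xs. \<not> m x) \<and> ?fold xs = (a, b)"
      then have f': "?fold (xs @ [x]) = scan_step le m r x (a, b)" using f by simp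
      show ?thesis
      proof (cases "m x")
        case True
        then have "?fold (xs @ [x]) = (r x, x)" unfolding f' scan_step_def using snoc.prems by simp
        then show ?thesis using last True none by blast
      next
        case False
        then have "?fold (xs @ [x]) = (a, b)" unfolding f' scan_step_def by simp
        then show ?thesis using False none by simp
      qed
    next
      assume "found xs"
      then obtain ys i zs where *: "xs = ys @ i # zs" "?fold xs = (r i, i)" "m i"
        "\<forall>y\<in>set ys. m y \<longrightarrow> le (r y) (r i)" "\<forall>z\<in>set zs. m z \<longrightarrow> \<not> le (r i) (r z)" unfolding found_def by blast
      have f': "?fold (xs @ [x]) = scan_step le m r x (r i, i)" using f *(2) by simp
      show ?thesis
      proof (cases "m x \<and> le (r i) (r x)")
        case True
        then have "?fold (xs @ [x]) = (r x, x)" unfolding f' scan_step_def by simp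
        moreover have "le (r y) (r x)" if y: "y \<in> set xs" "m y" for y
        proof -
          have "y \<in> set ys \<or> y = i \<or> y \<in> set zs" using y(1) unfolding *(1) by auto
          then have "le (r y) (r i)" using *(4,5) total y(2) by blast
          then show ?thesis using trans True by blast
        qed
        ultimately show ?thesis using last True by blast
      next
        case False
        then have "?fold (xs @ [x]) = (r i, i)" unfolding f' scan_step_def by auto
        moreover have "xs @ [x] = ys @ i # (zs @ [x])" using *(1) by simp
        moreover have "\<forall>z\<in>set (zs @ [x]). m z \<longrightarrow> \<not> le (r i) (r z)" using *(5) False by auto
        ultimately show ?thesis using *(3,4) unfolding found_def by blast
      qed
    qed
  qed simp
  then show ?thesis using ex that unfolding found_def by blast
qed

section \<open>Choosing single neighbours\<close>

definition adj_matrix :: "nat \<Rightarrow> nat set set \<Rightarrow> (nat \<Rightarrow> nat) \<Rightarrow> bool" where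
  "adj_matrix n E M \<longleftrightarrow> (\<forall>i<n. \<forall>j<n. M (i * n + j) = (if {i, j} \<in> E then 1 else 0))"

lemma index_inj:
  fixes i j i' j' n :: nat
  assumes "j < n" "j' < n"
  shows "i * n + j = i' * n + j' \<longleftrightarrow> i = i' \<and> j = j'"
proof
  assume e: "i * n + j = i' * n + j'"
  have "(i * n + j) div n = i" "(i' * n + j') div n = i'" "(i * n + j) mod n = j" "(i' * n + j') mod n = j'"
    using assms by auto
  then show "i = i' \<and> j = j'" using e by metis
qed simp

lemma index_less:
  fixes i j n :: nat
  assumes "i < n" "j < n"
  shows "i * n + j < n * n"
proof -
  have "i * n + j < i * n + n" using assms by simp
  also have "\<dots> = (i + 1) * n" by simp
  also have "\<dots> \<le> n * n" using assms by (intro mult_right_mono) auto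
  finally show ?thesis .
qed

lemma if_cong2: "(if P then x else if Q then x else y) = (if P \<or> Q then x else y)"
  by auto

lemma adj_matrix_update:
  assumes M: "adj_matrix n E M" and pb: "p < n" "b < n"
    and E': "\<And>i j. {i, j} \<in> E' \<longleftrightarrow> (if {i, j} = {p, b} then x = 1 else {i, j} \<in> E)" and x: "x = 0 \<or> x = (1::nat)"
  shows "adj_matrix n E' (M(p * n + b := x, b * n + p := x))"
  unfolding adj_matrix_def
proof (intro allI impI)
  fix i j assume ij: "i < n" "j < n"
  have "(M(p * n + b := x, b * n + p := x)) (i * n + j) =
      (if i = b \<and> j = p \<or> i = p \<and> j = b then x else M (i * n + j))"
  proof -
    have 1: "i * n + j = b * n + p \<longleftrightarrow> i = b \<and> j = p" by (rule index_inj[OF ij(2) pb(1)])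
    have 2: "i * n + j = p * n + b \<longleftrightarrow> i = p \<and> j = b" by (rule index_inj[OF ij(2) pb(2)])
    show ?thesis unfolding fun_upd_apply 1 2 by (rule if_cong2)
  qed
  also have "\<dots> = (if {i, j} \<in> E' then 1 else 0)"
  proof (cases "{i, j} = {p, b}")
    case True
    then have "i = b \<and> j = p \<or> i = p \<and> j = b" unfolding doubleton_eq_iff by blast
    then have "(if i = b \<and> j = p \<or> i = p \<and> j = b then x else M (i * n + j)) = x" by (rule if_P)
    moreover have "{i, j} \<in> E' \<longleftrightarrow> x = 1" using True unfolding E' by simp
    ultimately show ?thesis using x by auto
  next
    case False
    then have "\<not> (i = b \<and> j = p \<or> i = p \<and> j = b)" unfolding doubleton_eq_iff by blast
    then have "(if i = b \<and> j = p \<or> i = p \<and> j = b then x else M (i * n + j)) = M (i * n + j)" by (rule if_not_P)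
    moreover have "{i, j} \<in> E' \<longleftrightarrow> {i, j} \<in> E" using False unfolding E' by simp
    ultimately show ?thesis using M ij unfolding adj_matrix_def by simp
  qed
  finally show "(M(p * n + b := x, b * n + p := x)) (i * n + j) = (if {i, j} \<in> E' then 1 else 0)" .
qed

text \<open>\<open>current n k p r E s\<close>: in state \<open>s\<close> the residual degrees are \<open>r\<close>, the edges \<open>E\<close> have been built
  and \<open>p\<close> is the pivot.\<close>

definition current :: "nat \<Rightarrow> nat \<Rightarrow> nat \<Rightarrow> (nat \<Rightarrow> nat) \<Rightarrow> nat set set \<Rightarrow> state \<Rightarrow> bool" where
  "current n k p r E s \<longleftrightarrow> regs s 0 = n \<and> regs s 1 = k \<and> regs s 2 = p \<and>
    (\<forall>i<n. arrs s 0 i = r i) \<and> adj_matrix n E (arrs s 1)"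

lemma current_agree: "agree X s s' \<Longrightarrow> X \<inter> {0, 1, 2} = {} \<Longrightarrow> current n k p r E s' = current n k p r E s"
  by (auto simp: agree_def current_def)

definition entry :: "exp \<Rightarrow> exp \<Rightarrow> exp" where
  "entry i j = Plus (Times i (Reg 0)) j"

text \<open>\<open>c\<close> is the matrix entry relative to the pivot that qualifies a vertex: 0
  for non-neighbours, 1 for neighbours. Registers 11 and 12 are not initialised here, so that two
  scans can be chained over two ranges.\<close>

definition Scan :: "nat \<Rightarrow> bexp \<Rightarrow> exp \<Rightarrow> exp \<Rightarrow> com" where
  "Scan c b lo hi = For 4 lo hi (Cond (Conj (Equal (Load 1 (entry (Reg 2) (Reg 4))) (Const c)) b)
    (Seq (Assign 11 (Load 0 (Reg 4))) (Assign 12 (Reg 4))) Skip)"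

abbreviation "scratch \<equiv> {4, 11, 12} :: nat set"

lemma entry_fits:
  assumes s: "current n k p r E s" and agr: "agree X s s'" "X \<inter> {0, 1, 2} = {}" and p: "p < n" and i: "i < n" "regs s' x = i"
    and w: "4 * (n + 1) * (n + 1) + 20 \<le> w"
  shows "fits w (entry (Reg 2) (Reg x)) s'" "eval (entry (Reg 2) (Reg x)) s' = p * n + i"
    "fits w (entry (Reg x) (Reg 2)) s'" "eval (entry (Reg x) (Reg 2)) s' = i * n + p"
    "arrs s' 1 (p * n + i) = (if {p, i} \<in> E then 1 else 0)"
proof -
  have c: "current n k p r E s'" using current_agree[OF agr] s by simp
  then have c': "regs s' 0 = n" "regs s' 2 = p" by (auto simp: current_def)
  have l: "p * n + i < n * n" "i * n + p < n * n" using index_less p i by auto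
  have nw: "n \<le> w" "n * n \<le> w" using w by (auto simp: algebra_simps)
  have l': "p * n \<le> w" "i * n \<le> w" using l nw by linarith+
  show "fits w (entry (Reg 2) (Reg x)) s'" "eval (entry (Reg 2) (Reg x)) s' = p * n + i"
    "fits w (entry (Reg x) (Reg 2)) s'" "eval (entry (Reg x) (Reg 2)) s' = i * n + p"
    using c' i p l l' nw by (auto simp: entry_def)
  show "arrs s' 1 (p * n + i) = (if {p, i} \<in> E then 1 else 0)"
    using c p i unfolding current_def adj_matrix_def by blast
qed

lemma runs_Scan:
  assumes s: "current n k p r E s" and p: "p < n" and r: "\<And>i. i < n \<Longrightarrow> r i \<le> n"
    and w: "4 * (n + 1) * (n + 1) + 20 \<le> w" and l: "l \<le> h" "h \<le> n"
    and lo: "\<And>s'. agree scratch s s' \<Longrightarrow> fits w lo s' \<and> eval lo s' = l" and lo_cost: "cost lo \<le> 3"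
    and hi: "\<And>s'. agree scratch s s' \<Longrightarrow> fits w hi s' \<and> eval hi s' = h" and hi_cost: "cost hi \<le> 3"
    and s11: "regs s 11 \<le> n" and c: "c = 0 \<or> c = 1" and b_cost: "bcost b \<le> 5"
    and b: "\<And>s'. regs s' 4 < n \<Longrightarrow> arrs s' 0 (regs s' 4) \<le> n \<Longrightarrow> regs s' 11 \<le> n \<Longrightarrow>
      bfits w b s' \<and> (beval b s' \<longleftrightarrow> le (regs s' 11) (arrs s' 0 (regs s' 4)))"
  shows "runs w (Scan c b lo hi) s (40 * (n + 1))
    (\<lambda>s'. agree scratch s s' \<and> regs s' 11 \<le> n \<and>
      (regs s' 11, regs s' 12) = fold (scan_step le (\<lambda>i. {p, i} \<in> E \<longleftrightarrow> c = 1) r) [l..<h] (regs s 11, regs s 12))"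
proof -
  have nw: "n \<le> w" "0 < w" "1 \<le> w" using w by (auto simp: algebra_simps)
  let ?b = "Conj (Equal (Load 1 (entry (Reg 2) (Reg 4))) (Const c)) b"
  let ?st = "scan_step le (\<lambda>i. {p, i} \<in> E \<longleftrightarrow> c = 1) r"
  let ?I = "\<lambda>j s'. agree scratch s s' \<and> regs s' 11 \<le> n \<and>
      (regs s' 11, regs s' 12) = fold ?st [l..<j] (regs s 11, regs s 12)"
  have arr: "arrs s' 0 i = r i" if "agree scratch s s'" "i < n" for s' i
    using s that by (auto simp: agree_def current_def)
  show ?thesis unfolding Scan_def
  proof (rule runs_For[where I = ?I and Tb = 22 and l = l and h = h])
    show "?I l (s\<lparr>regs := (regs s)(4 := l)\<rparr>)" using s11 by (auto simp: agree_def)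
    show "fits w lo s" "eval lo s = l" using lo[OF agree_refl] by auto
    show "h \<le> w" "l \<le> h" "0 < w" using l nw by auto
    show "fits w hi s' \<and> eval hi s' = h" if "?I j s'" for j s' using hi that by blast
    have "(h - l + 1) * (7 + cost hi + 22) \<le> (n + 1) * 32" using l hi_cost by (intro mult_mono) auto
    then show "1 + cost lo + (h - l + 1) * (7 + cost hi + 22) \<le> 40 * (n + 1)" using lo_cost by simp
    fix j s' assume I: "?I j s'" and j: "regs s' 4 = j" "l \<le> j" "j < h"
    have jn: "j < n" using j l by simp
    have a: "arrs s' 0 j = r j" using arr I jn by blast
    have en: "fits w (entry (Reg 2) (Reg 4)) s'" "eval (entry (Reg 2) (Reg 4)) s' = p * n + j"
      "arrs s' 1 (p * n + j) = (if {p, j} \<in> E then 1 else 0)"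
      using entry_fits[OF s _ _ p jn j(1) w] I by auto
    have bj: "bfits w b s'" "beval b s' \<longleftrightarrow> le (regs s' 11) (r j)" using b[of s'] j(1) jn a r[OF jn] I by auto
    have bf: "bfits w ?b s'" using bj(1) en nw c by auto
    have st: "?st j (regs s' 11, regs s' 12) = (if beval ?b s' then (r j, j) else (regs s' 11, regs s' 12))"
      using bj(2) en c by (auto simp: scan_step_def)
    have upt: "[l..<Suc j] = [l..<j] @ [j]" using j by simp
    have fold: "fold ?st [l..<Suc j] (regs s 11, regs s 12) = ?st j (regs s' 11, regs s' 12)"
      using I unfolding upt by (simp del: upt_Suc)
    let ?Q = "\<lambda>s''. regs s'' 4 = j \<and> ?I (Suc j) (s''\<lparr>regs := (regs s'')(4 := Suc j)\<rparr>)"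
    show "runs w (Cond ?b (Seq (Assign 11 (Load 0 (Reg 4))) (Assign 12 (Reg 4))) Skip) s' 22 ?Q"
    proof (rule runs_Cond[where Ta = 6])
      assume t: "beval ?b s'"
      show "runs w (Seq (Assign 11 (Load 0 (Reg 4))) (Assign 12 (Reg 4))) s' 6 ?Q"
      proof (rule runs_Seq[where Ta = 3 and Tc = 3 and P = "\<lambda>s''. s'' = s'\<lparr>regs := (regs s')(11 := r j)\<rparr>"])
        show "runs w (Assign 11 (Load 0 (Reg 4))) s' 3 (\<lambda>s''. s'' = s'\<lparr>regs := (regs s')(11 := r j)\<rparr>)"
          by (rule runs_Assign) (use a j jn r[OF jn] nw in auto)
        fix s'' assume s'': "s'' = s'\<lparr>regs := (regs s')(11 := r j)\<rparr>"
        have st': "?st j (regs s' 11, regs s' 12) = (r j, j)" using st t by (simp only: if_True)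
        show "runs w (Assign 12 (Reg 4)) s'' 3 ?Q"
          by (rule runs_Assign) (use s'' I j jn r[OF jn] nw st' fold in \<open>auto simp: agree_def simp del: upt_Suc\<close>)
      qed simp
    next
      assume t: "\<not> beval ?b s'"
      have st': "?st j (regs s' 11, regs s' 12) = (regs s' 11, regs s' 12)" using st t by (simp only: if_False)
      show "runs w Skip s' 6 ?Q"
        by (rule runs_Skip) (use I j st' fold in \<open>auto simp: agree_def simp del: upt_Suc\<close>)
    next
      show "1 + bcost ?b + 6 \<le> 22" using b_cost by (simp add: entry_def)
    qed (rule bf)
  qed blast
qed

definition Scan_max :: "exp \<Rightarrow> exp \<Rightarrow> com" where
  "Scan_max = Scan 0 (Neg (Less (Load 0 (Reg 4)) (Reg 11)))"

definition Scan_min :: "exp \<Rightarrow> exp \<Rightarrow> com" where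
  "Scan_min = Scan 1 (Neg (Less (Reg 11) (Load 0 (Reg 4))))"

lemma runs_Scan_max:
  assumes s: "current n k p r E s" and p: "p < n" and r: "\<And>i. i < n \<Longrightarrow> r i \<le> n"
    and w: "4 * (n + 1) * (n + 1) + 20 \<le> w" and l: "l \<le> h" "h \<le> n"
    and lo: "\<And>s'. agree scratch s s' \<Longrightarrow> fits w lo s' \<and> eval lo s' = l" "cost lo \<le> 3"
    and hi: "\<And>s'. agree scratch s s' \<Longrightarrow> fits w hi s' \<and> eval hi s' = h" "cost hi \<le> 3"
    and b0: "regs s 11 \<le> n"
  shows "runs w (Scan_max lo hi) s (40 * (n + 1)) (\<lambda>s'. agree scratch s s' \<and> regs s' 11 \<le> n \<and>
      (regs s' 11, regs s' 12) = fold (scan_step (\<le>) (\<lambda>i. {p, i} \<notin> E) r) [l..<h] (regs s 11, regs s 12))"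
proof -
  have "n \<le> w" using w by (auto simp: algebra_simps)
  then have "runs w (Scan_max lo hi) s (40 * (n + 1)) (\<lambda>s'. agree scratch s s' \<and> regs s' 11 \<le> n \<and>
      (regs s' 11, regs s' 12) = fold (scan_step (\<le>) (\<lambda>i. {p, i} \<in> E \<longleftrightarrow> 0 = (1::nat)) r) [l..<h] (regs s 11, regs s 12))"
    unfolding Scan_max_def by (intro runs_Scan[OF s p r w l lo hi b0]) auto
  then show ?thesis by simp
qed

lemma runs_Scan_min:
  assumes s: "current n k p r E s" and p: "p < n" and r: "\<And>i. i < n \<Longrightarrow> r i \<le> n"
    and w: "4 * (n + 1) * (n + 1) + 20 \<le> w" and l: "l \<le> h" "h \<le> n"
    and lo: "\<And>s'. agree scratch s s' \<Longrightarrow> fits w lo s' \<and> eval lo s' = l" "cost lo \<le> 3"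
    and hi: "\<And>s'. agree scratch s s' \<Longrightarrow> fits w hi s' \<and> eval hi s' = h" "cost hi \<le> 3"
    and b0: "regs s 11 \<le> n"
  shows "runs w (Scan_min lo hi) s (40 * (n + 1)) (\<lambda>s'. agree scratch s s' \<and> regs s' 11 \<le> n \<and>
      (regs s' 11, regs s' 12) = fold (scan_step (\<ge>) (\<lambda>i. {p, i} \<in> E) r) [l..<h] (regs s 11, regs s 12))"
proof -
  have "n \<le> w" using w by (auto simp: algebra_simps)
  then have "runs w (Scan_min lo hi) s (40 * (n + 1)) (\<lambda>s'. agree scratch s s' \<and> regs s' 11 \<le> n \<and>
      (regs s' 11, regs s' 12) = fold (scan_step (\<ge>) (\<lambda>i. {p, i} \<in> E \<longleftrightarrow> 1 = (1::nat)) r) [l..<h] (regs s 11, regs s 12))"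
    unfolding Scan_min_def by (intro runs_Scan[OF s p r w l lo hi b0]) auto
  then show ?thesis by simp
qed

definition Update :: "exp \<Rightarrow> exp \<Rightarrow> com" where
  "Update v x = Seq (Store 0 (Reg 12) v)
    (Seq (Store 1 (entry (Reg 2) (Reg 12)) x) (Store 1 (entry (Reg 12) (Reg 2)) x))"

lemma runs_Update:
  assumes s: "current n k p r E s" and p: "p < n" and b: "regs s 12 = b" "b < n"
    and w: "4 * (n + 1) * (n + 1) + 20 \<le> w"
    and v: "fits w v s" "eval v s = y" "cost v \<le> 6" and x: "e = 0 \<or> e = 1"
    and E': "\<And>i j. {i, j} \<in> E' \<longleftrightarrow> (if {i, j} = {p, b} then e = 1 else {i, j} \<in> E)"
  shows "runs w (Update v (Const e)) s 30 (\<lambda>s'. current n k p (r(b := y)) E' s' \<and> regs s' = regs s)"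
proof -
  have nw: "1 \<le> w" using w by (auto simp: algebra_simps)
  let ?s1 = "s\<lparr>arrs := (arrs s)(0 := (arrs s 0)(b := y))\<rparr>"
  have c1: "current n k p (r(b := y)) E ?s1" using s b by (auto simp: current_def)
  note en = entry_fits[OF c1 agree_refl[of "{}"] _ p b(2) _ w, of 12]
  let ?s2 = "?s1\<lparr>arrs := (arrs ?s1)(1 := (arrs ?s1 1)(p * n + b := e))\<rparr>"
  let ?s3 = "?s2\<lparr>arrs := (arrs ?s2)(1 := (arrs ?s2 1)(b * n + p := e))\<rparr>"
  have c3: "current n k p (r(b := y)) E' ?s3"
    using c1 adj_matrix_update[OF _ p b(2) E' x, of "arrs s 1"] by (simp add: current_def)
  show ?thesis unfolding Update_def
  proof (rule runs_Seq[where Ta = 8 and Tc = 22 and P = "\<lambda>s'. s' = ?s1"])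
    show "runs w (Store 0 (Reg 12) v) s 8 (\<lambda>s'. s' = ?s1)"
      by (rule runs_Store) (use v b w in \<open>auto simp: algebra_simps\<close>)
    fix s1 assume s1: "s1 = ?s1"
    show "runs w (Seq (Store 1 (entry (Reg 2) (Reg 12)) (Const e)) (Store 1 (entry (Reg 12) (Reg 2)) (Const e))) s1 22
      (\<lambda>s'. current n k p (r(b := y)) E' s' \<and> regs s' = regs s)"
    proof (rule runs_Seq[where Ta = 11 and Tc = 11 and P = "\<lambda>s'. s' = ?s2"])
      show "runs w (Store 1 (entry (Reg 2) (Reg 12)) (Const e)) s1 11 (\<lambda>s'. s' = ?s2)"
        unfolding s1 by (rule runs_Store) (use en b x nw in \<open>auto simp: entry_def\<close>)
      fix s2 assume s2: "s2 = ?s2"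
      have f2: "fits w (entry (Reg 12) (Reg 2)) s2" "eval (entry (Reg 12) (Reg 2)) s2 = b * n + p"
        using en(3,4) b s2 by (simp_all add: entry_def)
      show "runs w (Store 1 (entry (Reg 12) (Reg 2)) (Const e)) s2 11
        (\<lambda>s'. current n k p (r(b := y)) E' s' \<and> regs s' = regs s)"
      proof (rule runs_Store[OF f2(1)])
        show "fits w (Const e) s2" using x nw by auto
        show "1 + cost (entry (Reg 12) (Reg 2)) + cost (Const e) \<le> 11" by (simp add: entry_def)
        have "s2\<lparr>arrs := (arrs s2)(1 := (arrs s2 1)(eval (entry (Reg 12) (Reg 2)) s2 := eval (Const e) s2))\<rparr> = ?s3"
          by (simp only: f2(2)) (simp add: s2)
        moreover have "regs ?s3 = regs s" by simp
        ultimately show "current n k p (r(b := y)) E' (s2\<lparr>arrs := (arrs s2)(1 := (arrs s2 1)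
            (eval (entry (Reg 12) (Reg 2)) s2 := eval (Const e) s2))\<rparr>) \<and>
          regs (s2\<lparr>arrs := (arrs s2)(1 := (arrs s2 1)
            (eval (entry (Reg 12) (Reg 2)) s2 := eval (Const e) s2))\<rparr>) = regs s" using c3 by presburger
      qed
    qed simp
  qed simp
qed

text \<open>The initial value 0 loses to every candidate because ties are taken over. When both
  sides are scanned, \<open>D\<close> is the second range and thereby wins ties.\<close>

definition Pick :: "exp \<Rightarrow> exp \<Rightarrow> exp \<Rightarrow> exp \<Rightarrow> com" where
  "Pick l1 h1 l2 h2 = Seq (Assign 11 (Const 0)) (Seq (Scan_max l1 h1) (Seq (Scan_max l2 h2)
    (Update (Minus (Load 0 (Reg 12)) (Const 1)) (Const 1))))"

lemma runs_Pick:
  assumes s: "current n k p r E s" and p: "p < n" and r: "\<And>i. i < n \<Longrightarrow> r i \<le> n"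
    and w: "4 * (n + 1) * (n + 1) + 20 \<le> w" and l: "l1 \<le> h1" "h1 \<le> n" "l2 \<le> h2" "h2 \<le> n"
    and e: "\<And>s'. agree scratch s s' \<Longrightarrow> fits w L1 s' \<and> eval L1 s' = l1 \<and> fits w H1 s' \<and> eval H1 s' = h1 \<and>
      fits w L2 s' \<and> eval L2 s' = l2 \<and> fits w H2 s' \<and> eval H2 s' = h2"
      "cost L1 \<le> 3" "cost H1 \<le> 3" "cost L2 \<le> 3" "cost H2 \<le> 3"
    and ex: "\<exists>x\<in>set ([l1..<h1] @ [l2..<h2]). {p, x} \<notin> E"
  shows "runs w (Pick L1 H1 L2 H2) s (150 * (n + 1)) (\<lambda>s'. \<exists>ys b zs. [l1..<h1] @ [l2..<h2] = ys @ b # zs \<and>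
    {p, b} \<notin> E \<and> (\<forall>y\<in>set ys. {p, y} \<notin> E \<longrightarrow> r y \<le> r b) \<and> (\<forall>z\<in>set zs. {p, z} \<notin> E \<longrightarrow> r z < r b) \<and>
    current n k p (r(b := r b - 1)) (insert {p, b} E) s' \<and> (\<forall>x. x \<notin> scratch \<longrightarrow> regs s' x = regs s x))"
proof -
  let ?m = "\<lambda>i. {p, i} \<notin> E"
  obtain ys b zs where f: "[l1..<h1] @ [l2..<h2] = ys @ b # zs"
    "fold (scan_step (\<le>) ?m r) ([l1..<h1] @ [l2..<h2]) (0, regs s 12) = (r b, b)" "?m b"
    "\<And>y. y \<in> set ys \<Longrightarrow> ?m y \<Longrightarrow> r y \<le> r b" "\<And>z. z \<in> set zs \<Longrightarrow> ?m z \<Longrightarrow> \<not> r b \<le> r z"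
    by (rule fold_scan_step[OF _ _ ex, of "(\<le>)" 0 r "regs s 12"]) (auto intro: that)
  have "b \<in> set ([l1..<h1] @ [l2..<h2])" unfolding f(1) by simp
  then have bn: "b < n" using l by auto
  let ?Q = "\<lambda>s'. current n k p (r(b := r b - 1)) (insert {p, b} E) s' \<and> (\<forall>x. x \<notin> scratch \<longrightarrow> regs s' x = regs s x)"
  have "runs w (Pick L1 H1 L2 H2) s (150 * (n + 1)) ?Q"
    unfolding Pick_def
  proof (rule runs_Seq[where Ta = 2 and Tc = "80 * (n + 1) + 30" and P = "\<lambda>s'. s' = s\<lparr>regs := (regs s)(11 := 0)\<rparr>"])
    show "runs w (Assign 11 (Const 0)) s 2 (\<lambda>s'. s' = s\<lparr>regs := (regs s)(11 := 0)\<rparr>)"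
      by (rule runs_Assign) auto
    fix s0 assume s0: "s0 = s\<lparr>regs := (regs s)(11 := 0)\<rparr>"
    have ag0: "agree scratch s s0" by (auto simp: s0 agree_def)
    have c0: "current n k p r E s0" using current_agree[OF ag0] s by simp
    have b0: "regs s0 11 \<le> n" "regs s0 11 = 0" "regs s0 12 = regs s 12" by (auto simp: s0)
    have e0: "agree scratch s s'" if "agree scratch s0 s'" for s' using agree_trans[OF ag0 that] .
    show "runs w (Seq (Scan_max L1 H1) (Seq (Scan_max L2 H2) (Update (Minus (Load 0 (Reg 12)) (Const 1)) (Const 1)))) s0
       (80 * (n + 1) + 30) ?Q"
    proof (rule runs_Seq[OF runs_Scan_max[OF c0 p r w l(1,2) _ e(2) _ e(3) b0(1)], where Tc = "40 * (n + 1) + 30"])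
      fix s1 assume s1: "agree scratch s0 s1 \<and> regs s1 11 \<le> n \<and>
        (regs s1 11, regs s1 12) = fold (scan_step (\<le>) ?m r) [l1..<h1] (regs s0 11, regs s0 12)"
      have ag1: "agree scratch s s1" using e0 s1 by blast
      have c1: "current n k p r E s1" using current_agree[OF ag1] s by simp
      have e1: "agree scratch s s'" if "agree scratch s1 s'" for s' using agree_trans[OF ag1 that] .
      show "runs w (Seq (Scan_max L2 H2) (Update (Minus (Load 0 (Reg 12)) (Const 1)) (Const 1))) s1 (40 * (n + 1) + 30) ?Q"
      proof (rule runs_Seq[OF runs_Scan_max[OF c1 p r w l(3,4) _ e(4) _ e(5)], where Tc = 30])
        fix s2 assume s2: "agree scratch s1 s2 \<and> regs s2 11 \<le> n \<and>
          (regs s2 11, regs s2 12) = fold (scan_step (\<le>) ?m r) [l2..<h2] (regs s1 11, regs s1 12)"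
        have ag2: "agree scratch s s2" using e1 s2 by blast
        have c2: "current n k p r E s2" using current_agree[OF ag2] s by simp
        have "(regs s2 11, regs s2 12) = (r b, b)" using s1 s2 b0 f(2) by simp
        then have b2: "regs s2 12 = b" by simp
        have a2: "arrs s2 0 b = r b" using c2 bn by (simp add: current_def)
        have "runs w (Update (Minus (Load 0 (Reg 12)) (Const 1)) (Const 1)) s2 30
          (\<lambda>s'. current n k p (r(b := r b - 1)) (insert {p, b} E) s' \<and> regs s' = regs s2)"
          by (rule runs_Update[OF c2 p b2 bn w]) (use a2 b2 bn r[OF bn] w in \<open>auto simp: algebra_simps\<close>)
        then show "runs w (Update (Minus (Load 0 (Reg 12)) (Const 1)) (Const 1)) s2 30 ?Q"
          by (rule runs_conseq) (use ag2 in \<open>auto simp: agree_def\<close>)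
      qed (use e e1 s1 in auto)
    qed (use e e0 in auto)
  qed simp
  moreover have "\<forall>z\<in>set zs. ?m z \<longrightarrow> r z < r b" using f(5) not_le by blast
  ultimately show ?thesis by (elim runs_conseq) (use f(1,3,4) in blast)+
qed

text \<open>\<open>n\<close> bounds all residual degrees, hence is a neutral start for a
  minimum.\<close>

definition Drop :: com where
  "Drop = Seq (Assign 11 (Reg 0)) (Seq (Scan_min (Const 0) (Reg 1))
    (Update (Plus (Load 0 (Reg 12)) (Const 1)) (Const 0)))"

lemma runs_Drop:
  assumes s: "current n k p r E s" and p: "p < n" and r: "\<And>i. i < n \<Longrightarrow> r i \<le> n"
    and w: "4 * (n + 1) * (n + 1) + 20 \<le> w" and k: "k \<le> n"
    and ex: "\<exists>x<k. {p, x} \<in> E"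
  shows "runs w Drop s (80 * (n + 1)) (\<lambda>s'. \<exists>b<k. {p, b} \<in> E \<and>
    (\<forall>y<k. {p, y} \<in> E \<longrightarrow> r b \<le> r y) \<and>
    current n k p (r(b := r b + 1)) (E - {{p, b}}) s' \<and> (\<forall>x. x \<notin> scratch \<longrightarrow> regs s' x = regs s x))"
proof -
  let ?m = "\<lambda>i. {p, i} \<in> E"
  have ex': "\<exists>x\<in>set [0..<k]. ?m x" using ex by auto
  obtain ys b zs where f: "[0..<k] = ys @ b # zs"
    "fold (scan_step (\<ge>) ?m r) [0..<k] (n, regs s 12) = (r b, b)" "?m b"
    "\<And>y. y \<in> set ys \<Longrightarrow> ?m y \<Longrightarrow> r b \<le> r y" "\<And>z. z \<in> set zs \<Longrightarrow> ?m z \<Longrightarrow> \<not> r z \<le> r b"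
    by (rule fold_scan_step[OF _ _ ex', of "(\<ge>)" n r "regs s 12"]) (use r k in \<open>auto intro: that\<close>)
  have "b \<in> set [0..<k]" unfolding f(1) by simp
  then have bk: "b < k" "b < n" using k by auto
  have min: "r b \<le> r y" if "y < k" "?m y" for y
  proof -
    have "y \<in> set [0..<k]" using that by simp
    then have "y \<in> set ys \<or> y = b \<or> y \<in> set zs" unfolding f(1) by auto
    then show ?thesis using f(4)[of y] f(5)[of y] that(2) by auto
  qed
  let ?Q = "\<lambda>s'. current n k p (r(b := r b + 1)) (E - {{p, b}}) s' \<and> (\<forall>x. x \<notin> scratch \<longrightarrow> regs s' x = regs s x)"
  have nw: "n \<le> w" "0 < w" using w by (auto simp: algebra_simps)
  have s0n: "regs s 0 = n" using s by (simp add: current_def)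
  have "runs w Drop s (80 * (n + 1)) ?Q"
    unfolding Drop_def
  proof (rule runs_Seq[where Ta = 2 and Tc = "40 * (n + 1) + 30" and P = "\<lambda>s'. s' = s\<lparr>regs := (regs s)(11 := n)\<rparr>"])
    show "runs w (Assign 11 (Reg 0)) s 2 (\<lambda>s'. s' = s\<lparr>regs := (regs s)(11 := n)\<rparr>)"
      by (rule runs_Assign) (use s0n nw in auto)
    fix s0 assume s0: "s0 = s\<lparr>regs := (regs s)(11 := n)\<rparr>"
    have ag0: "agree scratch s s0" by (auto simp: s0 agree_def)
    have c0: "current n k p r E s0" using current_agree[OF ag0] s by simp
    have b0: "regs s0 11 \<le> n" "regs s0 11 = n" "regs s0 12 = regs s 12" by (auto simp: s0)
    have e1: "fits w (Reg 1) s' \<and> eval (Reg 1) s' = k" if "agree scratch s0 s'" for s'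
      using that c0 k nw by (auto simp: agree_def current_def)
    show "runs w (Seq (Scan_min (Const 0) (Reg 1)) (Update (Plus (Load 0 (Reg 12)) (Const 1)) (Const 0))) s0
       (40 * (n + 1) + 30) ?Q"
    proof (rule runs_Seq[OF runs_Scan_min[OF c0 p r w le0 k _ _ e1 _ b0(1)], where Tc = 30])
      fix s2 assume s2: "agree scratch s0 s2 \<and> regs s2 11 \<le> n \<and>
        (regs s2 11, regs s2 12) = fold (scan_step (\<ge>) ?m r) [0..<k] (regs s0 11, regs s0 12)"
      have ag2: "agree scratch s s2" using agree_trans[OF ag0] s2 by blast
      have c2: "current n k p r E s2" using current_agree[OF ag2] s by simp
      have "(regs s2 11, regs s2 12) = (r b, b)" using s2 b0 f(2) by simp
      then have b2: "regs s2 12 = b" by simp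
      have a2: "arrs s2 0 b = r b" using c2 bk by (simp add: current_def)
      have "runs w (Update (Plus (Load 0 (Reg 12)) (Const 1)) (Const 0)) s2 30
        (\<lambda>s'. current n k p (r(b := r b + 1)) (E - {{p, b}}) s' \<and> regs s' = regs s2)"
        by (rule runs_Update[OF c2 p b2 bk(2) w]) (use a2 b2 bk r[OF bk(2)] w in \<open>auto simp: algebra_simps\<close>)
      then show "runs w (Update (Plus (Load 0 (Reg 12)) (Const 1)) (Const 0)) s2 30 ?Q"
        by (rule runs_conseq) (use ag2 in \<open>auto simp: agree_def\<close>)
    qed auto
  qed simp
  then show ?thesis by (rule runs_conseq) (use f(3) min bk in blast)+
qed

section \<open>The stage of a pivot\<close>

text \<open>\<open>W\<close> and the prefix differ by equally large sets; on the one every value is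
  at most, on the other at least, the value at the last prefix position.\<close>

lemma sum_le_prefix:
  fixes \<phi> :: "nat \<Rightarrow> nat"
  assumes mono: "\<And>i j. l \<le> i \<Longrightarrow> i \<le> j \<Longrightarrow> j < n \<Longrightarrow> \<phi> j \<le> \<phi> i" and W: "W \<subseteq> {l..<n}"
  shows "sum \<phi> W \<le> sum \<phi> {l..<l + card W}"
proof (cases "W = {}")
  case False
  let ?P = "{l..<l + card W}" and ?m = "\<phi> (l + card W - 1)"
  have fin: "finite W" using W finite_subset by blast
  have pos: "0 < card W" using False fin by (simp add: card_gt_0_iff)
  have "card W \<le> card {l..<n}" using W by (intro card_mono) auto
  then have le: "l + card W \<le> n" using pos by simp
  have "card (W - ?P) + card (W \<inter> ?P) = card (?P - W) + card (?P \<inter> W)"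
    using card_Int_Diff[OF fin, of ?P] card_Int_Diff[of ?P W] by simp
  then have c: "card (W - ?P) = card (?P - W)" by (simp add: Int_commute)
  have "sum \<phi> (W - ?P) \<le> of_nat (card (W - ?P)) * ?m"
  proof (rule sum_bounded_above)
    fix i assume "i \<in> W - ?P"
    then have "l + card W \<le> i" "i < n" using W by auto
    then show "\<phi> i \<le> ?m" using mono[of "l + card W - 1" i] pos by simp
  qed
  moreover have "of_nat (card (?P - W)) * ?m \<le> sum \<phi> (?P - W)"
    by (rule sum_bounded_below) (use mono le in auto)
  ultimately have "sum \<phi> (W - ?P) \<le> sum \<phi> (?P - W)" unfolding c by simp
  moreover have "sum \<phi> W = sum \<phi> (W \<inter> ?P) + sum \<phi> (W - ?P)" using fin by (rule sum.Int_Diff)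
  moreover have "sum \<phi> ?P = sum \<phi> (?P \<inter> W) + sum \<phi> (?P - W)" by (rule sum.Int_Diff) simp
  ultimately show ?thesis by (simp add: Int_commute)
qed simp

text \<open>The sum over \<open>C - W\<close> is the sum over \<open>C\<close> minus that over
  \<open>W\<close>. For fixed \<open>card W\<close>, the conditions thus bound the sum over
  \<open>W\<close> of \<open>f j + min (card W) (f j - 1)\<close>, which grows with
  \<open>f j\<close>.\<close>

lemma cond_prefix:
  assumes mono: "\<And>i j. l \<le> i \<Longrightarrow> i \<le> j \<Longrightarrow> j < n \<Longrightarrow> f j \<le> f i" and W: "W \<subseteq> {l..<n}"
  shows "cond_A D {l..<n} f {l..<l + card W} \<Longrightarrow> cond_A D {l..<n} f W"
    "cond_B D {l..<n} f {l..<l + card W} \<Longrightarrow> cond_B D {l..<n} f W"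
proof -
  let ?C = "{l..<n}" and ?P = "{l..<l + card W}" and ?g = "\<lambda>j. min (card W) (f j - 1)"
  have fin: "finite W" using W finite_subset by blast
  have "card W \<le> card {l..<n}" using W by (intro card_mono) auto
  then have P: "?P \<subseteq> ?C" by auto
  have "sum (\<lambda>j. f j + ?g j) W \<le> sum (\<lambda>j. f j + ?g j) ?P"
  proof (rule sum_le_prefix[OF _ W])
    fix i j assume "l \<le> i" "i \<le> j" "j < n"
    then have "f j \<le> f i" by (rule mono)
    then show "f j + ?g j \<le> f i + ?g i" by (intro add_mono min.mono diff_le_mono) auto
  qed
  then have le: "sum f W + sum ?g W \<le> sum f ?P + sum ?g ?P" by (simp add: sum.distrib)
  have split: "sum ?g X + sum ?g (?C - X) = sum ?g ?C" if "X \<subseteq> ?C" for X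
    using sum.subset_diff[OF that, of ?g] by simp
  have c: "card (?C - W) = card (?C - ?P)"
    using W P fin card_Diff_subset[of W ?C] card_Diff_subset[of ?P ?C] by simp
  show "cond_A D ?C f W" if "cond_A D ?C f ?P"
    using that le split[OF W] split[OF P] c unfolding cond_A_def by simp
  show "cond_B D ?C f W" if "cond_B D ?C f ?P"
    using that le split[OF W] split[OF P] unfolding cond_B_def by simp
qed

lemma cond_A_cong:
  assumes "\<And>i. i \<in> D \<union> C \<Longrightarrow> f i = g i" "W \<subseteq> C"
  shows "cond_A D C f W = cond_A D C g W"
proof -
  have "sum f W = sum g W" "sum f D = sum g D"
    "(\<Sum>j\<in>C - W. min (card W) (f j - 1)) = (\<Sum>j\<in>C - W. min (card W) (g j - 1))"
    using assms by (auto intro!: sum.cong)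
  then show ?thesis unfolding cond_A_def by simp
qed

definition star :: "nat \<Rightarrow> nat set \<Rightarrow> nat set set" where
  "star p S = (\<lambda>x. {p, x}) ` S"

lemma edge_star: "{a, b} \<in> star p S \<longleftrightarrow> a = p \<and> b \<in> S \<or> b = p \<and> a \<in> S"
  unfolding star_def image_iff doubleton_eq_iff by blast

lemma in_star: "{p, x} \<in> star p S \<longleftrightarrow> x \<in> S"
  unfolding edge_star by blast

lemma nbrs_star:
  assumes "p \<notin> S"
  shows "nbrs (B \<union> star p S) p = nbrs B p \<union> S"
    "v \<noteq> p \<Longrightarrow> nbrs (B \<union> star p S) v = nbrs B v \<union> (if v \<in> S then {p} else {})"
proof -
  have "x \<in> nbrs (B \<union> star p S) v \<longleftrightarrow> x \<in> nbrs B v \<or> x = p \<and> v \<in> S \<or> v = p \<and> x \<in> S" for x v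
    unfolding nbrs_iff Un_iff edge_star ..
  then show "nbrs (B \<union> star p S) p = nbrs B p \<union> S"
    "v \<noteq> p \<Longrightarrow> nbrs (B \<union> star p S) v = nbrs B v \<union> (if v \<in> S then {p} else {})"
    using assms by auto
qed

definition built :: "nat \<Rightarrow> (nat \<Rightarrow> nat) \<Rightarrow> nat set set \<Rightarrow> (nat \<Rightarrow> nat) \<Rightarrow> bool" where
  "built n d B r \<longleftrightarrow> graph_on {..<n} B \<and> (\<forall>v<n. r v + card (nbrs B v) = d v)"

lemma built_star:
  assumes b: "built n d B f" and p: "p < n" and S: "S \<subseteq> {..<n} - {p}" "card S = f p"
    "\<And>x. x \<in> S \<Longrightarrow> 0 < f x" "\<And>x. x \<in> S \<Longrightarrow> {p, x} \<notin> B"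
  shows "built n d (B \<union> star p S) ((dec f S)(p := 0))"
proof -
  have g: "graph_on {..<n} B" and deg: "\<And>v. v < n \<Longrightarrow> f v + card (nbrs B v) = d v"
    using b unfolding built_def by auto
  have pS: "p \<notin> S" and finS: "finite S" using S(1) finite_subset by auto
  note ns = nbrs_star[OF pS]
  have "graph_on {..<n} (B \<union> star p S)"
    using g S(1) p unfolding graph_on_def star_def by (auto simp: card_insert_if)
  moreover have "((dec f S)(p := 0)) v + card (nbrs (B \<union> star p S) v) = d v" if v: "v < n" for v
  proof (cases "v = p")
    case True
    have "nbrs B p \<inter> S = {}" using S(4) by (auto simp: nbrs_iff insert_commute)
    then have "card (nbrs B p \<union> S) = card (nbrs B p) + card S"
      using finite_nbrs[OF g] finS by (intro card_Un_disjoint) auto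
    then show ?thesis using True ns(1) deg[OF p] S(2) by simp
  next
    case False
    show ?thesis
    proof (cases "v \<in> S")
      case True
      have "p \<notin> nbrs B v" using S(4)[OF True] by (simp add: nbrs_iff)
      then have "card (insert p (nbrs B v)) = Suc (card (nbrs B v))" using finite_nbrs[OF g] by simp
      then show ?thesis using ns(2)[OF False] True False deg[OF v] S(3)[OF True] by (simp add: dec_def)
    qed (use ns(2)[OF False] False deg[OF v] in \<open>simp add: dec_def\<close>)
  qed
  ultimately show ?thesis unfolding built_def by blast
qed

text \<open>Among the candidates of largest degree the program takes the last one, where the
  candidates outside \<open>D\<close> precede those in \<open>D = {..<k}\<close>.\<close>

definition before :: "nat \<Rightarrow> nat \<Rightarrow> nat \<Rightarrow> bool" where
  "before k x y \<longleftrightarrow> k \<le> x \<and> y < k \<or> (x < k \<longleftrightarrow> y < k) \<and> x < y"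

definition picked :: "nat \<Rightarrow> (nat \<Rightarrow> nat) \<Rightarrow> nat set \<Rightarrow> nat \<Rightarrow> bool" where
  "picked k f A b \<longleftrightarrow> b \<in> A \<and> (\<forall>y\<in>A. y \<noteq> b \<longrightarrow> f y < f b \<or> f y = f b \<and> before k y b)"

lemma picked_le: "picked k f A b \<Longrightarrow> y \<in> A \<Longrightarrow> f y \<le> f b"
  unfolding picked_def by (metis le_less order_refl)

lemma pickedI:
  assumes cs: "cs = ys @ b # zs" "sorted_wrt (before k) cs" and b: "b \<notin> S"
    and ys: "\<And>y. y \<in> set ys - S \<Longrightarrow> f y \<le> f b" and zs: "\<And>z. z \<in> set zs - S \<Longrightarrow> f z < f b"
  shows "picked k f (set cs - S) b"
  unfolding picked_def
proof (intro conjI ballI impI)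
  show "b \<in> set cs - S" using cs(1) b by simp
  fix y assume y: "y \<in> set cs - S" "y \<noteq> b"
  then have "y \<in> set ys - S \<or> y \<in> set zs - S" unfolding cs(1) by auto
  then show "f y < f b \<or> f y = f b \<and> before k y b"
  proof
    assume y: "y \<in> set ys - S"
    then have "before k y b" using cs(2) unfolding cs(1) sorted_wrt_append by simp
    then show ?thesis using ys[OF y] by (simp add: le_less)
  qed (use zs in blast)
qed

lemma sorted_candidates:
  assumes "k \<le> l"
  shows "sorted_wrt (before k) ([l..<n] @ [0..<k])" "sorted_wrt (before k) [l..<n]"
    "sorted_wrt (before k) [0..<k]"
proof -
  have s: "sorted_wrt (<) [l..<n]" "sorted_wrt (<) [0..<k]" by simp_all
  show 1: "sorted_wrt (before k) [l..<n]"
    by (rule sorted_wrt_mono_rel[OF _ s(1)]) (use assms in \<open>auto simp: before_def\<close>)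
  show 2: "sorted_wrt (before k) [0..<k]"
    by (rule sorted_wrt_mono_rel[OF _ s(2)]) (auto simp: before_def)
  show "sorted_wrt (before k) ([l..<n] @ [0..<k])"
    unfolding sorted_wrt_append using 1 2 assms by (auto simp: before_def)
qed

text \<open>The state while the neighbourhood of the pivot \<open>p\<close> is being chosen: \<open>S\<close> is the current choice,
  \<open>f\<close> and \<open>B\<close> are the residual degrees and the edges before the choice.\<close>

definition choosing :: "nat \<Rightarrow> nat \<Rightarrow> nat \<Rightarrow> (nat \<Rightarrow> nat) \<Rightarrow> nat set set \<Rightarrow> nat set \<Rightarrow> state \<Rightarrow> bool" where
  "choosing n k p f B S s \<longleftrightarrow> current n k p ((dec f S)(p := 0)) (B \<union> star p S) s"

text \<open>Unchosen candidates still carry their degree \<open>f\<close>. Listing them in the order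
  \<open>before\<close> makes the last optimum of the scan the vertex that \<open>picked\<close>
  names.\<close>

lemma runs_choose:
  assumes s: "choosing n k p f B S s" and p: "p < n" "p \<notin> set cs" and r: "\<And>i. i < n \<Longrightarrow> f i \<le> n"
    and w: "4 * (n + 1) * (n + 1) + 20 \<le> w" and l: "l1 \<le> h1" "h1 \<le> n" "l2 \<le> h2" "h2 \<le> n"
    and cs: "cs = [l1..<h1] @ [l2..<h2]" "sorted_wrt (before k) cs"
    and e: "\<And>s'. agree scratch s s' \<Longrightarrow> fits w L1 s' \<and> eval L1 s' = l1 \<and> fits w H1 s' \<and> eval H1 s' = h1 \<and>
      fits w L2 s' \<and> eval L2 s' = l2 \<and> fits w H2 s' \<and> eval H2 s' = h2"
      "cost L1 \<le> 3" "cost H1 \<le> 3" "cost L2 \<le> 3" "cost H2 \<le> 3"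
    and B: "\<And>x. x \<in> set cs \<Longrightarrow> {p, x} \<notin> B"
    and ex: "set cs - S \<noteq> {}"
  shows "runs w (Pick L1 H1 L2 H2) s (150 * (n + 1)) (\<lambda>s'. \<exists>b. picked k f (set cs - S) b \<and>
    choosing n k p f B (insert b S) s' \<and> (\<forall>x. x \<notin> scratch \<longrightarrow> regs s' x = regs s x))"
proof -
  let ?r = "(dec f S)(p := 0)" and ?E = "B \<union> star p S"
  have m: "{p, x} \<in> ?E \<longleftrightarrow> x \<in> S" if "x \<in> set cs" for x using B[OF that] in_star by simp
  have r': "?r i \<le> n" if "i < n" for i using r[OF that] by (auto simp: dec_def)
  have ex': "\<exists>x\<in>set ([l1..<h1] @ [l2..<h2]). {p, x} \<notin> ?E" using ex m cs(1) by blast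
  have s': "current n k p ?r ?E s" using s unfolding choosing_def .
  show ?thesis
  proof (rule runs_conseq[OF runs_Pick[OF s' p(1) r' w l e ex']])
    fix s' assume "\<exists>ys b zs. [l1..<h1] @ [l2..<h2] = ys @ b # zs \<and> {p, b} \<notin> ?E \<and>
      (\<forall>y\<in>set ys. {p, y} \<notin> ?E \<longrightarrow> ?r y \<le> ?r b) \<and> (\<forall>z\<in>set zs. {p, z} \<notin> ?E \<longrightarrow> ?r z < ?r b) \<and>
      current n k p (?r(b := ?r b - 1)) (insert {p, b} ?E) s' \<and> (\<forall>x. x \<notin> scratch \<longrightarrow> regs s' x = regs s x)"
    then obtain ys b zs where b: "cs = ys @ b # zs" "{p, b} \<notin> ?E"
      "\<And>y. y \<in> set ys \<Longrightarrow> {p, y} \<notin> ?E \<Longrightarrow> ?r y \<le> ?r b" "\<And>z. z \<in> set zs \<Longrightarrow> {p, z} \<notin> ?E \<Longrightarrow> ?r z < ?r b"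
      "current n k p (?r(b := ?r b - 1)) (insert {p, b} ?E) s'" "\<forall>x. x \<notin> scratch \<longrightarrow> regs s' x = regs s x"
      unfolding cs(1) by blast
    have in_cs: "b \<in> set cs" "set ys \<subseteq> set cs" "set zs \<subseteq> set cs" unfolding b(1) by auto
    have bS: "b \<notin> S" "b \<noteq> p" using m[OF in_cs(1)] b(2) in_cs(1) p(2) by auto
    have rf: "?r x = f x" if "x \<in> set cs" "x \<notin> S" for x using that p(2) by (auto simp: dec_def)
    have "picked k f (set cs - S) b"
    proof (rule pickedI[OF b(1) cs(2) bS(1)])
      show "f y \<le> f b" if "y \<in> set ys - S" for y
        using b(3)[of y] m[of y] rf[of y] rf[of b] in_cs that bS by auto
      show "f z < f b" if "z \<in> set zs - S" for z
        using b(4)[of z] m[of z] rf[of z] rf[of b] in_cs that bS by auto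
    qed
    moreover have "?r(b := ?r b - 1) = (dec f (insert b S))(p := 0)" using bS by (auto simp: dec_def fun_eq_iff)
    moreover have "insert {p, b} ?E = B \<union> star p (insert b S)" by (auto simp: star_def)
    ultimately show "\<exists>b. picked k f (set cs - S) b \<and>
      choosing n k p f B (insert b S) s' \<and> (\<forall>x. x \<notin> scratch \<longrightarrow> regs s' x = regs s x)"
      using b(5,6) unfolding choosing_def by metis
  qed simp_all
qed

lemma runs_unchoose:
  assumes s: "choosing n k p f B S s" and p: "p < n" "k \<le> p" and r: "\<And>i. i < n \<Longrightarrow> f i \<le> n"
    and w: "4 * (n + 1) * (n + 1) + 20 \<le> w"
    and B: "\<And>x. x < k \<Longrightarrow> {p, x} \<notin> B"
    and S: "S \<inter> {..<k} \<noteq> {}" "\<And>x. x \<in> S \<Longrightarrow> 0 < f x"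
  shows "runs w Drop s (80 * (n + 1)) (\<lambda>s'. \<exists>b\<in>S \<inter> {..<k}. (\<forall>y\<in>S \<inter> {..<k}. f b \<le> f y) \<and>
    choosing n k p f B (S - {b}) s' \<and> (\<forall>x. x \<notin> scratch \<longrightarrow> regs s' x = regs s x))"
proof -
  let ?r = "(dec f S)(p := 0)" and ?E = "B \<union> star p S"
  have m: "{p, x} \<in> ?E \<longleftrightarrow> x \<in> S" if "x < k" for x using B[OF that] in_star by simp
  have r': "?r i \<le> n" if "i < n" for i using r[OF that] by (auto simp: dec_def)
  have ex': "\<exists>x<k. {p, x} \<in> ?E" using S(1) m by auto
  \<comment> \<open>All chosen vertices are lowered by exactly one, so the smallest residual degree
    in memory belongs to the smallest \<open>f\<close>.\<close>
  have rf: "?r x = f x - 1" if "x < k" "x \<in> S" for x using that p(2) by (auto simp: dec_def)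
  have s': "current n k p ?r ?E s" using s unfolding choosing_def .
  have kn: "k \<le> n" using p by simp
  show ?thesis
  proof (rule runs_conseq[OF runs_Drop[OF s' p(1) r' w kn ex']])
    fix s' assume "\<exists>b<k. {p, b} \<in> ?E \<and> (\<forall>y<k. {p, y} \<in> ?E \<longrightarrow> ?r b \<le> ?r y) \<and>
      current n k p (?r(b := ?r b + 1)) (?E - {{p, b}}) s' \<and> (\<forall>x. x \<notin> scratch \<longrightarrow> regs s' x = regs s x)"
    then obtain b where b: "b < k" "{p, b} \<in> ?E" "\<And>y. y < k \<Longrightarrow> {p, y} \<in> ?E \<Longrightarrow> ?r b \<le> ?r y"
      "current n k p (?r(b := ?r b + 1)) (?E - {{p, b}}) s'" "\<forall>x. x \<notin> scratch \<longrightarrow> regs s' x = regs s x"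
      by blast
    have bS: "b \<in> S" "b \<noteq> p" using m[OF b(1)] b(1,2) p(2) by auto
    have "f b \<le> f y" if y: "y \<in> S \<inter> {..<k}" for y
    proof -
      have "f b - 1 \<le> f y - 1" using b(3)[of y] m[of y] rf[of y] rf[of b] y bS b(1) by auto
      then show ?thesis using S(2)[of y] y by auto
    qed
    moreover have "?r(b := ?r b + 1) = (dec f (S - {b}))(p := 0)"
      using bS S(2)[of b] by (auto simp: dec_def fun_eq_iff)
    moreover have "?E - {{p, b}} = B \<union> star p (S - {b})"
      using B[OF b(1)] by (auto simp: star_def doubleton_eq_iff)
    ultimately show "\<exists>b\<in>S \<inter> {..<k}. (\<forall>y\<in>S \<inter> {..<k}. f b \<le> f y) \<and>
      choosing n k p f B (S - {b}) s' \<and> (\<forall>x. x \<notin> scratch \<longrightarrow> regs s' x = regs s x)"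
      using b(1,4,5) bS(1) unfolding choosing_def by (metis IntI lessThan_iff)
  qed simp_all
qed

lemma feasible_cong:
  assumes "\<And>v. v \<in> D \<union> C \<Longrightarrow> f v = g v"
  shows "feasible D C f \<longleftrightarrow> feasible D C g"
proof -
  have "realization (D \<union> C) E f \<longleftrightarrow> realization (D \<union> C) E g" for E
    unfolding realization_def using assms by simp
  then show ?thesis unfolding feasible_def by simp
qed

text \<open>\<open>f\<close> is the function of residual degrees. It is sorted from the pivot on,
  while the vertices of \<open>D\<close> may have fallen out of order; the conditions depend on
  these only through sums.\<close>

locale stage =
  fixes n k p :: nat and f :: "nat \<Rightarrow> nat"
  assumes kp: "k \<le> p" and pn: "p < n" and feas: "feasible {..<k} {p..<n} f"
    and sorted: "\<And>i j. p \<le> i \<Longrightarrow> i \<le> j \<Longrightarrow> j < n \<Longrightarrow> f j \<le> f i"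
begin

lemma disjoint: "{..<k} \<inter> {p..<n} = {}"
  using kp by auto

lemma others: "{p..<n} - {p} = {p + 1..<n}"
  by auto

lemma neighbourhood:
  obtains N where "N \<subseteq> {..<k} \<union> {p + 1..<n}" "card N = f p" "finite N" "N \<inter> {..<k} \<noteq> {}"
    "\<And>x. x \<in> N \<Longrightarrow> 0 < f x"
proof -
  obtain E where d: "dominated {..<k} {p..<n} f E" using feas feasible_iff by blast
  then have r: "realization ({..<k} \<union> {p..<n}) E f" unfolding dominated_def by blast
  have g: "graph_on ({..<k} \<union> {p..<n}) E" using realization_graph[OF r] .
  have p: "p \<in> {p..<n}" using pn by simp
  have sub: "nbrs E p \<subseteq> {..<k} \<union> {p + 1..<n}"
  proof
    fix x assume x: "x \<in> nbrs E p"
    then have "x \<noteq> p" using nbrs_irrefl[OF g, of p] by metis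
    moreover have "x \<in> {..<k} \<union> {p..<n}" using nbrs_subset[OF g, of p] x by blast
    ultimately show "x \<in> {..<k} \<union> {p + 1..<n}" by auto
  qed
  moreover have "nbrs E p \<inter> {..<k} \<noteq> {}" using d p unfolding dominated_def nbrs_def by blast
  moreover have "0 < f x" if "x \<in> nbrs E p" for x
  proof -
    have "p \<in> nbrs E x" using that by (simp add: nbrs_sym)
    then have "0 < card (nbrs E x)" using finite_nbrs[OF g] by (auto simp: card_gt_0_iff)
    moreover have "card (nbrs E x) = f x" using realization_card[OF r] that sub by auto
    ultimately show ?thesis by simp
  qed
  ultimately show ?thesis using that[of "nbrs E p"] realization_card[OF r, of p] p finite_nbrs[OF g] by blast
qed

lemma pos: "j \<in> {p..<n} \<Longrightarrow> 0 < f j"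
proof -
  assume j: "j \<in> {p..<n}"
  obtain E where E: "realization ({..<k} \<union> {p..<n}) E f" "nbrs E j \<inter> {..<k} \<noteq> {}"
    using feas j unfolding feasible_def by auto
  then have "0 < card (nbrs E j)" using finite_nbrs[OF realization_graph[OF E(1)], of j] by (auto simp: card_gt_0_iff)
  then show ?thesis using realization_card[OF E(1), of j] j by simp
qed

text \<open>The invariant of the greedy phase and of the repairs. On the outer side ties are decided
  by the index, for the sake of \<open>dec_sorted\<close>. The last clause spares a single vertex of
  \<open>D\<close> because the first choice is forced into \<open>D\<close> whatever its
  degree.\<close>

definition valid :: "nat set \<Rightarrow> bool" where
  "valid S \<longleftrightarrow> S \<subseteq> {..<k} \<union> {p + 1..<n} \<and> S \<inter> {..<k} \<noteq> {} \<and> (\<forall>x\<in>S. 0 < f x) \<and>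
    (\<forall>x\<in>S \<inter> {..<k}. \<forall>y\<in>{..<k} - S. f y \<le> f x) \<and>
    (\<forall>x\<in>S \<inter> {p + 1..<n}. \<forall>y\<in>{p + 1..<n} - S. f y < f x \<or> f y = f x \<and> y < x) \<and>
    (2 \<le> card (S \<inter> {..<k}) \<longrightarrow> (\<forall>x\<in>S \<inter> {..<k}. \<forall>y\<in>{p + 1..<n} - S. f y \<le> f x))"

text \<open>Strict because \<open>D\<close> wins ties. It yields the first alternative of
  \<open>maximal\<close> in \<open>pivot.ex_pivot\<close>; after an exchange,
  \<open>justified\<close> offers the second one instead.\<close>

definition greedy :: "nat set \<Rightarrow> bool" where
  "greedy S \<longleftrightarrow> (\<forall>x\<in>{..<k} - S. \<forall>y\<in>S \<inter> {p + 1..<n}. f x < f y)"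

lemma validD:
  assumes "valid S"
  shows "S \<subseteq> {..<k} \<union> {p + 1..<n}" "finite S" "S \<inter> {..<k} \<noteq> {}" "\<And>x. x \<in> S \<Longrightarrow> 0 < f x"
    "\<And>x y. x \<in> S \<Longrightarrow> x < k \<Longrightarrow> y < k \<Longrightarrow> y \<notin> S \<Longrightarrow> f y \<le> f x"
    "\<And>x y. x \<in> S \<Longrightarrow> x \<in> {p + 1..<n} \<Longrightarrow> y \<in> {p + 1..<n} \<Longrightarrow> y \<notin> S \<Longrightarrow> f y < f x \<or> f y = f x \<and> y < x"
    "\<And>x y. 2 \<le> card (S \<inter> {..<k}) \<Longrightarrow> x \<in> S \<Longrightarrow> x < k \<Longrightarrow> y \<in> {p + 1..<n} \<Longrightarrow> y \<notin> S \<Longrightarrow> f y \<le> f x"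
proof -
  show sub: "S \<subseteq> {..<k} \<union> {p + 1..<n}" "S \<inter> {..<k} \<noteq> {}" using assms unfolding valid_def by blast+
  show "finite S" by (rule finite_subset[OF sub(1)]) simp
  show "0 < f x" if "x \<in> S" for x using assms that unfolding valid_def by blast
  show "f y \<le> f x" if "x \<in> S" "x < k" "y < k" "y \<notin> S" for x y
  proof -
    have "x \<in> S \<inter> {..<k}" "y \<in> {..<k} - S" using that by auto
    then show ?thesis using assms unfolding valid_def by blast
  qed
  show "f y < f x \<or> f y = f x \<and> y < x" if "x \<in> S" "x \<in> {p + 1..<n}" "y \<in> {p + 1..<n}" "y \<notin> S" for x y
  proof -
    have "x \<in> S \<inter> {p + 1..<n}" "y \<in> {p + 1..<n} - S" using that by blast+
    then show ?thesis using assms unfolding valid_def by blast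
  qed
  show "f y \<le> f x" if "2 \<le> card (S \<inter> {..<k})" "x \<in> S" "x < k" "y \<in> {p + 1..<n}" "y \<notin> S" for x y
  proof -
    have "x \<in> S \<inter> {..<k}" "y \<in> {p + 1..<n} - S" using that by auto
    then show ?thesis using assms that(1) unfolding valid_def by blast
  qed
qed

lemma validI:
  assumes "S \<subseteq> {..<k} \<union> {p + 1..<n}" "S \<inter> {..<k} \<noteq> {}" "\<And>x. x \<in> S \<Longrightarrow> 0 < f x"
    "\<And>x y. x \<in> S \<Longrightarrow> x < k \<Longrightarrow> y < k \<Longrightarrow> y \<notin> S \<Longrightarrow> f y \<le> f x"
    "\<And>x y. x \<in> S \<Longrightarrow> x \<in> {p + 1..<n} \<Longrightarrow> y \<in> {p + 1..<n} \<Longrightarrow> y \<notin> S \<Longrightarrow> f y < f x \<or> f y = f x \<and> y < x"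
    "\<And>x y. 2 \<le> card (S \<inter> {..<k}) \<Longrightarrow> x \<in> S \<Longrightarrow> x < k \<Longrightarrow> y \<in> {p + 1..<n} \<Longrightarrow> y \<notin> S \<Longrightarrow> f y \<le> f x"
  shows "valid S"
  unfolding valid_def
proof (intro conjI ballI impI)
  show "S \<subseteq> {..<k} \<union> {p + 1..<n}" "S \<inter> {..<k} \<noteq> {}" by (fact assms)+
  show "0 < f x" if "x \<in> S" for x using assms(3)[OF that] .
  show "f y \<le> f x" if "x \<in> S \<inter> {..<k}" "y \<in> {..<k} - S" for x y
    using assms(4)[of x y] that by simp
  show "f y < f x \<or> f y = f x \<and> y < x" if "x \<in> S \<inter> {p + 1..<n}" "y \<in> {p + 1..<n} - S" for x y
    using assms(5)[of x y] that by blast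
  show "f y \<le> f x" if "2 \<le> card (S \<inter> {..<k})" "x \<in> S \<inter> {..<k}" "y \<in> {p + 1..<n} - S" for x y
    using assms(6)[of x y] that by blast
qed

lemma valid_first:
  assumes b: "picked k f {..<k} b"
  shows "valid {b}" "greedy {b}"
proof -
  have bk: "b < k" using b unfolding picked_def by simp
  obtain N where N: "N \<inter> {..<k} \<noteq> {}" "\<And>x. x \<in> N \<Longrightarrow> 0 < f x" using neighbourhood by metis
  then obtain x where x: "x \<in> N" "x < k" by auto
  then have "0 < f b" using picked_le[OF b, of x] N(2)[of x] by simp
  then show "valid {b}"
    by (intro validI) (use bk kp picked_le[OF b] in auto)
  show "greedy {b}" using bk kp unfolding greedy_def by auto
qed

lemma ex_unchosen:
  assumes S: "finite S" "card S < f p"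
  obtains x where "x \<in> {p + 1..<n} \<union> {..<k} - S" "0 < f x"
proof -
  obtain N where N: "N \<subseteq> {..<k} \<union> {p + 1..<n}" "card N = f p" "\<And>x. x \<in> N \<Longrightarrow> 0 < f x"
    using neighbourhood by metis
  have "\<not> N \<subseteq> S" using card_mono[OF S(1), of N] N(2) S(2) by auto
  then show ?thesis using that N by blast
qed

lemma valid_next:
  assumes S: "valid S" "greedy S" "card S < f p" and b: "picked k f ({p + 1..<n} \<union> {..<k} - S) b"
  shows "valid (insert b S)" "greedy (insert b S)"
proof -
  note v = validD[OF S(1)]
  have bA: "b \<in> {p + 1..<n} \<union> {..<k} - S" using b unfolding picked_def by blast
  have le: "f y \<le> f b" if "y \<in> {p + 1..<n} \<union> {..<k}" "y \<notin> S" for y using picked_le[OF b] that by blast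
  have lt: "f y < f b \<or> f y = f b \<and> before k y b" if "y \<in> {p + 1..<n} \<union> {..<k}" "y \<notin> insert b S" for y
    using b that unfolding picked_def by blast
  obtain x where "x \<in> {p + 1..<n} \<union> {..<k} - S" "0 < f x" using ex_unchosen[OF v(2) S(3)] .
  then have fb: "0 < f b" using le[of x] by simp
  have C: "k \<le> x" if "x \<in> {p + 1..<n}" for x using that kp by simp
  \<comment> \<open>A vertex of \<open>D\<close> that wins against both sides is at least every
    unchosen vertex, and the members of \<open>D\<close> chosen before it are at least as
    large.\<close>
  have DC: "f y \<le> f x" if "x \<in> insert b S" "x < k" "y \<in> {p + 1..<n}" "y \<notin> insert b S" "b < k" for x y
  proof -
    have "f b \<le> f x"
      by (cases "x = b") (use v(5)[of x b] that bA in auto)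
    then show ?thesis using le[of y] that by auto
  qed
  show "valid (insert b S)"
  proof (rule validI)
    show "insert b S \<subseteq> {..<k} \<union> {p + 1..<n}" "insert b S \<inter> {..<k} \<noteq> {}" using v bA by auto
    show "0 < f x" if "x \<in> insert b S" for x using that v(4) fb by auto
    show "f y \<le> f x" if "x \<in> insert b S" "x < k" "y < k" "y \<notin> insert b S" for x y
      using that v(5)[of x y] le[of y] by auto
    show "f y < f x \<or> f y = f x \<and> y < x"
      if "x \<in> insert b S" "x \<in> {p + 1..<n}" "y \<in> {p + 1..<n}" "y \<notin> insert b S" for x y
    proof (cases "x = b")
      case True
      then show ?thesis using lt[of y] that C[of x] C[of y] by (auto simp: before_def)
    next
      case False
      then show ?thesis using v(6)[of x y] that by blast
    qed
    show "f y \<le> f x" if "2 \<le> card (insert b S \<inter> {..<k})" "x \<in> insert b S" "x < k"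
      "y \<in> {p + 1..<n}" "y \<notin> insert b S" for x y
    proof (cases "b < k")
      case True
      then show ?thesis using DC[OF that(2-5)] by blast
    next
      case False
      then have "insert b S \<inter> {..<k} = S \<inter> {..<k}" "x \<in> S" using that(2,3) by auto
      then show ?thesis using v(7)[of x y] that by auto
    qed
  qed
  show "greedy (insert b S)" unfolding greedy_def
  proof (intro ballI)
    fix x y assume x: "x \<in> {..<k} - insert b S" and y: "y \<in> insert b S \<inter> {p + 1..<n}"
    show "f x < f y"
    proof (cases "y = b")
      case True
      then show ?thesis using lt[of x] x y C[of y] by (auto simp: before_def)
    next
      case False
      then show ?thesis using S(2) x y unfolding greedy_def by blast
    qed
  qed
qed

text \<open>Once the greedy choice is complete, only exchanges of a vertex of \<open>D\<close> for one outside \<open>D\<close>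
  that repair a violated inequality are made.\<close>

definition justified :: "nat set \<Rightarrow> bool" where
  "justified S \<longleftrightarrow> greedy S \<or> (\<exists>x\<in>{..<k} - S. \<exists>y\<in>S \<inter> {p + 1..<n}.
    (\<forall>x'\<in>{..<k} - S. f x' \<le> f x) \<and> (\<forall>y'\<in>S \<inter> {p + 1..<n}. f y \<le> f y') \<and>
    (\<exists>W \<subseteq> {p + 1..<n}. \<not> cond_A {..<k} {p + 1..<n} (dec f (insert x S - {y})) W))"

lemma valid_pivot:
  assumes S: "valid S" "card S = f p"
  shows "pivot {..<k} {p..<n} f p (S \<inter> {..<k}) (S \<inter> {p + 1..<n})"
    "(S \<inter> {..<k}) \<union> (S \<inter> {p + 1..<n}) = S"
proof -
  note v = validD[OF S(1)]
  show Seq: "(S \<inter> {..<k}) \<union> (S \<inter> {p + 1..<n}) = S" using v(1) by blast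
  have "card (S \<inter> {..<k}) + card (S \<inter> {p + 1..<n}) = card ((S \<inter> {..<k}) \<union> (S \<inter> {p + 1..<n}))"
    using v(2) kp by (intro card_Un_disjoint[symmetric]) auto
  then have c: "card (S \<inter> {..<k}) + card (S \<inter> {p + 1..<n}) = f p" using Seq S(2) by simp
  show "pivot {..<k} {p..<n} f p (S \<inter> {..<k}) (S \<inter> {p + 1..<n})"
  proof
    fix x y assume "x \<in> S \<inter> {p + 1..<n}" "y \<in> {p..<n} - {p} - S \<inter> {p + 1..<n}"
    then show "f y \<le> f x" using v(6)[of x y] unfolding others by auto
  qed (use disjoint feas pn sorted v c others in auto)
qed

lemma violation_movable:
  assumes S: "valid S" "card S = f p" and W: "W \<subseteq> {p + 1..<n}"
    and viol: "\<not> cond_A {..<k} {p + 1..<n} (dec f S) W"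
  shows "2 \<le> card (S \<inter> {..<k})" "{p + 1..<n} - S \<noteq> {}"
  using pivot.violation_imp_movable[OF valid_pivot(1)[OF S], unfolded others valid_pivot(2)[OF S], OF W viol]
  by auto

text \<open>Dropping a smallest vertex on one side and adding a largest on the other keeps the
  choice extreme on both sides. Undoing the exchange gives back the violating \<open>S\<close>,
  which is the justification required. By \<open>cond_A_mono\<close> no inequality that held is
  lost, so the tests need not start over.\<close>

lemma valid_exchange:
  assumes S: "valid S" "card S = f p" and W: "W \<subseteq> {p + 1..<n}"
    and viol: "\<not> cond_A {..<k} {p + 1..<n} (dec f S) W"
    and b: "b \<in> S \<inter> {..<k}" "\<And>y. y \<in> S \<inter> {..<k} \<Longrightarrow> f b \<le> f y"
    and c: "picked k f ({p + 1..<n} - (S - {b})) c"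
  defines "S' \<equiv> insert c (S - {b})"
  shows "valid S'" "card S' = f p" "justified S'" "card (S' \<inter> {..<k}) < card (S \<inter> {..<k})"
    "\<And>W. W \<subseteq> {p + 1..<n} \<Longrightarrow> cond_A {..<k} {p + 1..<n} (dec f S) W \<Longrightarrow> cond_A {..<k} {p + 1..<n} (dec f S') W"
proof -
  note v = validD[OF S(1)]
  note mv = violation_movable[OF S W viol]
  have bC: "b \<notin> {p + 1..<n}" "b < k" "b \<in> S" using b kp by auto
  have cA: "c \<in> {p + 1..<n}" "c \<notin> S" "c \<noteq> b" using c bC unfolding picked_def by auto
  have cD: "\<not> c < k" using cA kp by auto
  have ck: "before k y c \<longleftrightarrow> y < c" if "y \<in> {p + 1..<n}" for y using that cD kp unfolding before_def by auto
  have lt: "f y < f c \<or> f y = f c \<and> y < c" if "y \<in> {p + 1..<n}" "y \<notin> S'" for y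
    using c that bC ck[of y] unfolding picked_def S'_def by blast
  have SD: "S' \<inter> {..<k} = S \<inter> {..<k} - {b}" using cD unfolding S'_def by auto
  have SC: "S' \<inter> {p + 1..<n} = insert c (S \<inter> {p + 1..<n})" using cA bC unfolding S'_def by auto
  have card_D: "Suc (card (S' \<inter> {..<k})) = card (S \<inter> {..<k})"
    unfolding SD by (rule card_Suc_Diff1) (use v(2) b in auto)
  then show "card (S' \<inter> {..<k}) < card (S \<inter> {..<k})" by simp
  have "Suc (card (S - {b})) = card S" by (rule card_Suc_Diff1) (use v(2) b in auto)
  then show card: "card S' = f p" unfolding S'_def using v(2) cA S(2) by simp
  have sub: "S' \<subseteq> {..<k} \<union> {p + 1..<n}" using v(1) cA unfolding S'_def by auto
  have inS: "x \<in> S" if "x \<in> S'" "x \<noteq> c" for x using that unfolding S'_def by blast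
  have notS: "y \<notin> S" if "y \<notin> S'" "y \<in> {p + 1..<n}" for y using that bC unfolding S'_def by blast
  show valid: "valid S'"
  proof (rule validI[OF sub])
    show "S' \<inter> {..<k} \<noteq> {}" using card_D mv(1) by auto
    show "0 < f x" if "x \<in> S'" for x using that v(4)[of x] pos[of c] cA inS[of x] by auto
    show "f y \<le> f x" if "x \<in> S'" "x < k" "y < k" "y \<notin> S'" for x y
    proof -
      have x: "x \<in> S" using inS[OF that(1)] that(2) cD by blast
      show ?thesis
      proof (cases "y = b")
        case True
        then show ?thesis using b(2)[of x] x that by simp
      next
        case False
        then have "y \<notin> S" using that(4) unfolding S'_def by blast
        then show ?thesis using v(5)[OF x that(2,3)] by blast
      qed
    qed
    show "f y < f x \<or> f y = f x \<and> y < x" if "x \<in> S'" "x \<in> {p + 1..<n}" "y \<in> {p + 1..<n}" "y \<notin> S'" for x y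
    proof (cases "x = c")
      case True
      then show ?thesis using lt[OF that(3,4)] by simp
    next
      case False
      then show ?thesis using v(6)[OF inS[OF that(1)] that(2,3) notS[OF that(4,3)]] by blast
    qed
    show "f y \<le> f x" if "2 \<le> card (S' \<inter> {..<k})" "x \<in> S'" "x < k" "y \<in> {p + 1..<n}" "y \<notin> S'" for x y
    proof -
      have "x \<noteq> c" using that(3) cD by blast
      then show ?thesis using v(7)[OF _ inS[OF that(2)] that(3,4) notS[OF that(5,4)]] that(1) card_D by simp
    qed
  qed
  show "justified S'"
    unfolding justified_def
  proof (rule disjI2, rule bexI[of _ b], rule bexI[of _ c], intro conjI ballI)
    show "b \<in> {..<k} - S'" using bC cA unfolding S'_def by auto
    show "c \<in> S' \<inter> {p + 1..<n}" using cA unfolding S'_def by auto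
    show "f x' \<le> f b" if x': "x' \<in> {..<k} - S'" for x'
    proof (cases "x' = b")
      case False
      then have "x' \<notin> S" "x' < k" using x' unfolding S'_def by auto
      then show ?thesis using v(5)[OF bC(3,2)] by blast
    qed simp
    show "f c \<le> f y'" if y': "y' \<in> S' \<inter> {p + 1..<n}" for y'
    proof (cases "y' = c")
      case False
      then have "y' \<in> S" "y' \<in> {p + 1..<n}" using inS y' by auto
      then show ?thesis using v(6)[of y' c] cA by auto
    qed simp
    have "insert b S' - {c} = S" using cA bC unfolding S'_def by auto
    then show "\<exists>W\<subseteq>{p + 1..<n}. \<not> cond_A {..<k} {p + 1..<n} (dec f (insert b S' - {c})) W" using W viol by auto
  qed
  fix W' assume W': "W' \<subseteq> {p + 1..<n}" "cond_A {..<k} {p + 1..<n} (dec f S) W'"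
  show "cond_A {..<k} {p + 1..<n} (dec f S') W'"
  proof (rule cond_A_mono[OF W'(2,1)])
    show "{..<k} \<inter> {p + 1..<n} = {}" using kp by auto
    show "S \<inter> {p + 1..<n} \<subseteq> S'" using SC by auto
    show "card S = card S'" using card S(2) by simp
  qed (use v sub pos in auto)
qed

text \<open>Only equal degrees could get out of order, and among these the later vertices are chosen
  first.\<close>

lemma dec_sorted:
  assumes S: "valid S" and ij: "p + 1 \<le> i" "i \<le> j" "j < n"
  shows "dec f S j \<le> dec f S i"
proof -
  have le: "f j \<le> f i" using sorted ij by simp
  show ?thesis
  proof (cases "i \<in> S \<and> j \<notin> S")
    case True
    then have "f j < f i \<or> f j = f i \<and> j < i" using validD(6)[OF S, of i j] ij by auto
    then show ?thesis using True ij by (auto simp: dec_def)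
  qed (use le in \<open>auto simp: dec_def\<close>)
qed

text \<open>Prefixes suffice because the new residual degrees are sorted. Maximality in
  \<open>pivot.ex_pivot\<close> comes from the largest unchosen and smallest chosen degree if
  \<open>S\<close> is greedy, and from the last exchange otherwise.\<close>

lemma stage_step:
  assumes S: "valid S" "card S = f p" "justified S"
    and A: "\<And>t. p + 1 + t \<le> n \<Longrightarrow> cond_A {..<k} {p + 1..<n} (dec f S) {p + 1..<p + 1 + t}"
  shows "feasible {..<k} {p + 1..<n} (dec f S)"
proof -
  note Seq = valid_pivot(2)[OF S(1,2)] and v = validD[OF S(1)]
  have A': "cond_A {..<k} {p + 1..<n} (dec f S) W" if W: "W \<subseteq> {p + 1..<n}" for W
  proof (rule cond_prefix(1)[OF _ W])
    show "dec f S j \<le> dec f S i" if "p + 1 \<le> i" "i \<le> j" "j < n" for i j by (rule dec_sorted[OF S(1) that])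
    have "card W \<le> card {p + 1..<n}" using W by (intro card_mono) auto
    then show "cond_A {..<k} {p + 1..<n} (dec f S) {p + 1..<p + 1 + card W}" by (intro A) (use pn in simp)
  qed
  have max: "\<exists>x\<in>{..<k} - S \<inter> {..<k}. \<exists>y\<in>S \<inter> {p + 1..<n}. (\<forall>x'\<in>{..<k} - S \<inter> {..<k}. f x' \<le> f x) \<and>
      (\<forall>y'\<in>S \<inter> {p + 1..<n}. f y \<le> f y') \<and> (f x < f y \<or>
      (\<exists>W \<subseteq> {p + 1..<n}. \<not> cond_A {..<k} {p + 1..<n} (dec f (insert x S - {y})) W))"
    if ne: "{..<k} - S \<inter> {..<k} \<noteq> {}" "S \<inter> {p + 1..<n} \<noteq> {}"
  proof -
    have D: "{..<k} - S \<inter> {..<k} = {..<k} - S" by blast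
    show ?thesis unfolding D
    proof (cases "greedy S")
      case True
      have "Max (f ` ({..<k} - S)) \<in> f ` ({..<k} - S)" using ne(1) unfolding D by (intro Max_in) auto
      then obtain x where x: "x \<in> {..<k} - S" "f x = Max (f ` ({..<k} - S))" by auto
      then have max: "f x' \<le> f x" if "x' \<in> {..<k} - S" for x' using that by (auto intro: Max_ge)
      have "Min (f ` (S \<inter> {p + 1..<n})) \<in> f ` (S \<inter> {p + 1..<n})" using ne(2) by (intro Min_in) auto
      then obtain y where y: "y \<in> S \<inter> {p + 1..<n}" "f y = Min (f ` (S \<inter> {p + 1..<n}))" by auto
      then have min: "f y \<le> f y'" if "y' \<in> S \<inter> {p + 1..<n}" for y' using that by (auto intro: Min_le)
      have "f x < f y" using True x y unfolding greedy_def by blast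
      then show "\<exists>x\<in>{..<k} - S. \<exists>y\<in>S \<inter> {p + 1..<n}. (\<forall>x'\<in>{..<k} - S. f x' \<le> f x) \<and>
        (\<forall>y'\<in>S \<inter> {p + 1..<n}. f y \<le> f y') \<and> (f x < f y \<or>
        (\<exists>W \<subseteq> {p + 1..<n}. \<not> cond_A {..<k} {p + 1..<n} (dec f (insert x S - {y})) W))"
        using x(1) y(1) max min by blast
    next
      case False
      then show "\<exists>x\<in>{..<k} - S. \<exists>y\<in>S \<inter> {p + 1..<n}. (\<forall>x'\<in>{..<k} - S. f x' \<le> f x) \<and>
        (\<forall>y'\<in>S \<inter> {p + 1..<n}. f y \<le> f y') \<and> (f x < f y \<or>
        (\<exists>W \<subseteq> {p + 1..<n}. \<not> cond_A {..<k} {p + 1..<n} (dec f (insert x S - {y})) W))"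
        using S(3) unfolding justified_def by blast
    qed
  qed
  have order: "f y \<le> f x" if "2 \<le> card (S \<inter> {..<k})" "x \<in> S \<inter> {..<k}" "y \<in> {p + 1..<n} - S \<inter> {p + 1..<n}" for x y
    using v(7)[OF that(1), of x y] that by auto
  obtain E where E: "dominated {..<k} {p..<n} f E" "nbrs E p = S"
    using pivot.ex_pivot[OF valid_pivot(1)[OF S(1,2)], unfolded others Seq, OF A' order max] by auto
  show ?thesis using feasible_delete[OF E(1) disjoint, of p] pn E(2) others by simp
qed

end

section \<open>The algorithm\<close>

lemma current_upd: "x \<notin> {0, 1, 2} \<Longrightarrow> current n k p r E (s\<lparr>regs := (regs s)(x := v)\<rparr>) = current n k p r E s"
  by (simp add: current_def)

lemma choosing_upd: "x \<notin> {0, 1, 2} \<Longrightarrow> choosing n k p f B S (s\<lparr>regs := (regs s)(x := v)\<rparr>) = choosing n k p f B S s"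
  unfolding choosing_def by (rule current_upd)

lemma choosing_regs:
  assumes "choosing n k p f B S s"
  shows "regs s 0 = n" "regs s (Suc 0) = k" "regs s 2 = p"
  using assms unfolding choosing_def current_def by auto

lemma agree_scratch_regs:
  assumes "agree scratch s s'"
  shows "regs s' 0 = regs s 0" "regs s' (Suc 0) = regs s (Suc 0)" "regs s' 2 = regs s 2"
  using assms unfolding agree_def by auto

section \<open>The programs that treat one pivot\<close>

definition Start :: com where
  "Start = Seq (Assign 9 (Load 0 (Reg 2))) (Store 0 (Reg 2) (Const 0))"

lemma runs_Start:
  assumes s: "current n k p f B s" and p: "p < n" and w: "n \<le> w" and f: "f p \<le> n"
  shows "runs w Start s 6 (\<lambda>s'. choosing n k p f B {} s' \<and> regs s' 9 = f p)"
proof -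
  have s2: "regs s 2 = p" "arrs s 0 p = f p" using s p by (auto simp: current_def)
  show ?thesis unfolding Start_def
  proof (rule runs_Seq[where Ta = 3 and Tc = 3 and P = "\<lambda>s'. s' = s\<lparr>regs := (regs s)(9 := f p)\<rparr>"])
    show "runs w (Assign 9 (Load 0 (Reg 2))) s 3 (\<lambda>s'. s' = s\<lparr>regs := (regs s)(9 := f p)\<rparr>)"
      by (rule runs_Assign) (use s2 p w f in auto)
    show "runs w (Store 0 (Reg 2) (Const 0)) s' 3 (\<lambda>s'. choosing n k p f B {} s' \<and> regs s' 9 = f p)"
      if s': "s' = s\<lparr>regs := (regs s)(9 := f p)\<rparr>" for s'
    proof (rule runs_Store)
      show "fits w (Reg 2) s'" "fits w (Const 0) s'" using s2 p w s' by auto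
      show "choosing n k p f B {} (s'\<lparr>arrs := (arrs s')(0 := (arrs s' 0)(eval (Reg 2) s' := eval (Const 0) s'))\<rparr>) \<and>
        regs (s'\<lparr>arrs := (arrs s')(0 := (arrs s' 0)(eval (Reg 2) s' := eval (Const 0) s'))\<rparr>) 9 = f p"
        using s s' by (auto simp: choosing_def current_def star_def dec_def)
    qed simp_all
  qed simp_all
qed

abbreviation after_pivot :: exp where
  "after_pivot \<equiv> Plus (Reg 2) (Const 1)"

context stage
begin

context
  fixes B :: "nat set set" and w :: nat
  assumes fn: "\<And>i. i < n \<Longrightarrow> f i \<le> n" and fresh: "\<And>x. x \<in> {..<k} \<union> {p + 1..<n} \<Longrightarrow> {p, x} \<notin> B"
    and w: "4 * (n + 1) * (n + 1) + 20 \<le> w"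
begin

lemma word: "n + 1 \<le> w" "k \<le> w" "p + 1 \<le> w" "0 < w" "1 \<le> w"
  using w kp pn by (auto simp: algebra_simps)

lemma runs_pick_first:
  assumes s: "choosing n k p f B {} s"
  shows "runs w (Pick (Const 0) (Reg 1) (Const 0) (Const 0)) s (150 * (n + 1)) (\<lambda>s'. \<exists>b.
    picked k f {..<k} b \<and> choosing n k p f B {b} s' \<and> (\<forall>x. x \<notin> scratch \<longrightarrow> regs s' x = regs s x))"
proof -
  obtain N where "N \<inter> {..<k} \<noteq> {}" using neighbourhood by metis
  then have ex: "set [0..<k] - {} \<noteq> {}" by auto
  have cs: "[0..<k] = [0..<k] @ [0..<0]" by simp
  have set: "set [0..<k] - {} = {..<k}" by auto
  note r = choosing_regs[OF s]
  have "runs w (Pick (Const 0) (Reg 1) (Const 0) (Const 0)) s (150 * (n + 1)) (\<lambda>s'. \<exists>b.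
    picked k f (set [0..<k] - {}) b \<and> choosing n k p f B {b} s' \<and> (\<forall>x. x \<notin> scratch \<longrightarrow> regs s' x = regs s x))"
    by (rule runs_choose[OF s pn _ fn w _ _ _ _ cs sorted_candidates(3)[OF order_refl] _ _ _ _ _ _ ex])
      (use r kp pn word fresh agree_scratch_regs in auto)
  then show ?thesis unfolding set .
qed

lemma runs_pick_any:
  assumes s: "choosing n k p f B S s" and ex: "{p + 1..<n} \<union> {..<k} - S \<noteq> {}"
  shows "runs w (Pick after_pivot (Reg 0) (Const 0) (Reg 1)) s (150 * (n + 1)) (\<lambda>s'. \<exists>b.
    picked k f ({p + 1..<n} \<union> {..<k} - S) b \<and> choosing n k p f B (insert b S) s' \<and>
    (\<forall>x. x \<notin> scratch \<longrightarrow> regs s' x = regs s x))"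
proof -
  let ?cs = "[p + 1..<n] @ [0..<k]"
  have set: "{p + 1..<n} \<union> {..<k} = set ?cs" by auto
  have so: "sorted_wrt (before k) ?cs" by (rule sorted_candidates(1)) (use kp in simp)
  note r = choosing_regs[OF s]
  show ?thesis unfolding set
    by (rule runs_choose[OF s pn _ fn w _ _ _ _ refl so _ _ _ _ _ _ ex[unfolded set]])
      (use r kp pn word fresh agree_scratch_regs in auto)
qed

lemma runs_pick_outer:
  assumes s: "choosing n k p f B S s" and ex: "{p + 1..<n} - S \<noteq> {}"
  shows "runs w (Pick after_pivot (Reg 0) (Const 0) (Const 0)) s (150 * (n + 1)) (\<lambda>s'. \<exists>b.
    picked k f ({p + 1..<n} - S) b \<and> choosing n k p f B (insert b S) s' \<and>
    (\<forall>x. x \<notin> scratch \<longrightarrow> regs s' x = regs s x))"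
proof -
  have cs: "[p + 1..<n] = [p + 1..<n] @ [0..<0]" by simp
  have so: "sorted_wrt (before k) [p + 1..<n]" by (rule sorted_candidates(2)) (use kp in simp)
  note r = choosing_regs[OF s]
  show ?thesis unfolding set_upt[symmetric]
    by (rule runs_choose[OF s pn _ fn w _ _ _ _ cs so _ _ _ _ _ _ ex[folded set_upt]])
      (use r kp pn word fresh agree_scratch_regs in auto)
qed

lemma runs_unchoose_stage:
  assumes s: "choosing n k p f B S s" and S: "valid S"
  shows "runs w Drop s (80 * (n + 1)) (\<lambda>s'. \<exists>b\<in>S \<inter> {..<k}. (\<forall>y\<in>S \<inter> {..<k}. f b \<le> f y) \<and>
    choosing n k p f B (S - {b}) s' \<and> (\<forall>x. x \<notin> scratch \<longrightarrow> regs s' x = regs s x))"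
  by (rule runs_unchoose[OF s pn kp fn w]) (use validD(3,4)[OF S] fresh in auto)

end

end

text \<open>The first neighbour is sought in \<open>D\<close> only, which secures the domination of
  the pivot; hence the counter starts at 1.\<close>

definition Greedy :: com where
  "Greedy = Seq (Pick (Const 0) (Reg 1) (Const 0) (Const 0))
    (For 10 (Const 1) (Reg 9) (Pick after_pivot (Reg 0) (Const 0) (Reg 1)))"

lemma (in stage) runs_Greedy:
  assumes fn: "\<And>i. i < n \<Longrightarrow> f i \<le> n" and fresh: "\<And>x. x \<in> {..<k} \<union> {p + 1..<n} \<Longrightarrow> {p, x} \<notin> B"
    and w: "4 * (n + 1) * (n + 1) + 20 \<le> w"
    and s: "choosing n k p f B {} s" "regs s 9 = f p"
  shows "runs w Greedy s (320 * ((n + 1) * (n + 1))) (\<lambda>s'. \<exists>S. valid S \<and> greedy S \<and> card S = f p \<and> choosing n k p f B S s')"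
  unfolding Greedy_def
proof (rule runs_Seq[where Ta = "150 * (n + 1)" and Tc = "160 * ((n + 1) * (n + 1))"])
  note word = word[OF fn fresh w]
  have fp: "1 \<le> f p" "f p \<le> n" using pos[of p] fn[OF pn] pn by auto
  show "runs w (Pick (Const 0) (Reg 1) (Const 0) (Const 0)) s (150 * (n + 1)) (\<lambda>s'. \<exists>b.
    picked k f {..<k} b \<and> choosing n k p f B {b} s' \<and> (\<forall>x. x \<notin> scratch \<longrightarrow> regs s' x = regs s x))"
    by (rule runs_pick_first[OF fn fresh w s(1)])
  fix s1 assume "\<exists>b. picked k f {..<k} b \<and> choosing n k p f B {b} s1 \<and> (\<forall>x. x \<notin> scratch \<longrightarrow> regs s1 x = regs s x)"
  then obtain b where b: "picked k f {..<k} b" "choosing n k p f B {b} s1" "regs s1 9 = f p"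
    using s(2) by auto
  let ?I = "\<lambda>j s. \<exists>S. valid S \<and> greedy S \<and> card S = j \<and> choosing n k p f B S s \<and> regs s 9 = f p"
  show "runs w (For 10 (Const 1) (Reg 9) (Pick after_pivot (Reg 0) (Const 0) (Reg 1))) s1 (160 * ((n + 1) * (n + 1)))
    (\<lambda>s'. \<exists>S. valid S \<and> greedy S \<and> card S = f p \<and> choosing n k p f B S s')"
  proof (rule runs_For[where I = ?I and l = 1 and h = "f p" and Tb = "150 * (n + 1)"])
    show "?I 1 (s1\<lparr>regs := (regs s1)(10 := 1)\<rparr>)"
      using valid_first[OF b(1)] b(2,3) by (intro exI[of _ "{b}"]) (simp add: choosing_upd)
    show "f p \<le> w" using fp word by simp
    show "fits w (Reg 9) s' \<and> eval (Reg 9) s' = f p" if "?I j s'" for j s' using that fp word by auto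
    show "runs w (Pick after_pivot (Reg 0) (Const 0) (Reg 1)) s' (150 * (n + 1))
      (\<lambda>s''. regs s'' 10 = j \<and> ?I (Suc j) (s''\<lparr>regs := (regs s'')(10 := Suc j)\<rparr>))"
      if I: "?I j s'" and j: "regs s' 10 = j" "j < f p" for j s'
    proof -
      obtain S where S: "valid S" "greedy S" "card S = j" "choosing n k p f B S s'" "regs s' 9 = f p" using I by blast
      note v = validD[OF S(1)]
      have lt: "card S < f p" using S(3) j by simp
      obtain x where "x \<in> {p + 1..<n} \<union> {..<k} - S" using ex_unchosen[OF v(2) lt] by metis
      then have ne: "{p + 1..<n} \<union> {..<k} - S \<noteq> {}" by blast
      show ?thesis
      proof (rule runs_conseq[OF runs_pick_any[OF fn fresh w S(4) ne]])
        fix s'' assume "\<exists>b. picked k f ({p + 1..<n} \<union> {..<k} - S) b \<and> choosing n k p f B (insert b S) s'' \<and>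
          (\<forall>x. x \<notin> scratch \<longrightarrow> regs s'' x = regs s' x)"
        then obtain b where b: "picked k f ({p + 1..<n} \<union> {..<k} - S) b" "choosing n k p f B (insert b S) s''"
          "\<forall>x. x \<notin> scratch \<longrightarrow> regs s'' x = regs s' x" by blast
        have "b \<notin> S" using b(1) unfolding picked_def by blast
        then have "card (insert b S) = Suc j" using v(2) S(3) by simp
        then have "?I (Suc j) (s''\<lparr>regs := (regs s'')(10 := Suc j)\<rparr>)"
          using valid_next[OF S(1,2) lt b(1)] b(2,3) S(5)
          by (intro exI[of _ "insert b S"]) (simp add: choosing_upd)
        then show "regs s'' 10 = j \<and> ?I (Suc j) (s''\<lparr>regs := (regs s'')(10 := Suc j)\<rparr>)"
          using b(3) j by simp
      qed simp_all
    qed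
    have "(f p - 1 + 1) * (7 + 1 + 150 * (n + 1)) \<le> n * (158 * (n + 1))"
      using fp by (intro mult_mono) auto
    moreover have "n * (158 * (n + 1)) + 2 \<le> 160 * ((n + 1) * (n + 1))" by (simp add: algebra_simps)
    ultimately show "1 + cost (Const 1) + (f p - 1 + 1) * (7 + cost (Reg 9) + 150 * (n + 1)) \<le> 160 * ((n + 1) * (n + 1))"
      by simp
  qed (use word fp in auto)
qed simp_all

definition Repair_step :: com where
  "Repair_step = Seq (Eval after_pivot) (Cond (test_A after_pivot)
    (Seq Drop (Pick after_pivot (Reg 0) (Const 0) (Const 0)))
    (Assign 3 (Plus (Reg 3) (Const 1))))"

definition Repair :: com where
  "Repair = Seq (Assign 3 (Const 0)) (While (Less (Plus (Reg 2) (Reg 3)) (Reg 0)) Repair_step)"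

context stage
begin

text \<open>\<open>t\<close> is the size of the prefix under test and never decreases. A step
  advances \<open>t\<close> or moves one neighbour out of \<open>D\<close>, and the variant counts
  both resources.\<close>

definition repairing :: "nat set set \<Rightarrow> nat \<Rightarrow> state \<Rightarrow> bool" where
  "repairing B m s \<longleftrightarrow> (\<exists>S t. valid S \<and> card S = f p \<and> justified S \<and> choosing n k p f B S s \<and> regs s 3 = t \<and> p + t \<le> n \<and>
    (\<forall>t'<t. cond_A {..<k} {p + 1..<n} (dec f S) {p + 1..<p + 1 + t'}) \<and> m = (n - p - t) + card (S \<inter> {..<k}))"

lemma runs_repair_step:
  assumes fn: "\<And>i. i < n \<Longrightarrow> f i \<le> n" and fresh: "\<And>x. x \<in> {..<k} \<union> {p + 1..<n} \<Longrightarrow> {p, x} \<notin> B"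
    and w: "4 * (n + 1) * (n + 1) + 20 \<le> w"
    and I: "repairing B m s" and b: "regs s 2 + regs s 3 < regs s 0"
  shows "runs w Repair_step s (450 * (n + 1)) (\<lambda>s'. \<exists>m'<m. repairing B m' s')"
proof -
  note word = word[OF fn fresh w]
  obtain S t where S: "valid S" "card S = f p" "justified S" "choosing n k p f B S s" "regs s 3 = t" "p + t \<le> n"
    "\<And>t'. t' < t \<Longrightarrow> cond_A {..<k} {p + 1..<n} (dec f S) {p + 1..<p + 1 + t'}" "m = (n - p - t) + card (S \<inter> {..<k})"
    using I unfolding repairing_def by blast
  let ?r = "(dec f S)(p := 0)" and ?X = "{4, 5, 6, 7, 8} :: nat set"
  have cur: "current n k p ?r (B \<union> star p S) s" using S(4) unfolding choosing_def .
  have r0: "regs s 0 = n" "regs s 1 = k" "regs s 2 = p" "\<And>i. i < n \<Longrightarrow> arrs s 0 i = ?r i"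
    using cur unfolding current_def by auto
  have lt: "p + 1 + t \<le> n" using b r0 S(5) by simp
  have rn: "?r i \<le> n" if "i < n" for i using fn[OF that] by (auto simp: dec_def)
  have kn: "k \<le> n" using kp pn by simp
  have ap: "fits w after_pivot s' \<and> eval after_pivot s' = p + 1" if "agree ?X s s'" for s'
    using that r0 word by (auto simp: agree_def)
  show ?thesis unfolding Repair_step_def
  proof (rule runs_Seq[OF runs_Eval[OF r0(1,2) S(5) r0(4) rn kn lt w ap], where Tc = "250 * (n + 1)"])
    fix s1 assume s1: "agree ?X s s1 \<and> evaluated n k (p + 1) t ?r s1"
    then have ag: "agree ?X s s1" and ev: "evaluated n k (p + 1) t ?r s1" by auto
    have r1: "regs s1 0 = n" "regs s1 3 = t" using ag r0 S(5) by (auto simp: agree_def)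
    have c1: "choosing n k p f B S s1" using S(4) current_agree[OF ag] unfolding choosing_def by simp
    note T = tests[OF ev r1 _ _ rn kn lt w, of after_pivot]
    have ap1: "eval after_pivot s1 = p + 1" "fits w after_pivot s1" using ap[OF ag] by auto
    \<comment> \<open>In memory the pivot has residual degree 0, but it belongs to neither side of
      the condition.\<close>
    have cong: "cond_A {..<k} {p + 1..<n} ?r {p + 1..<p + 1 + t} =
      cond_A {..<k} {p + 1..<n} (dec f S) {p + 1..<p + 1 + t}"
      by (rule cond_A_cong) (use kp lt in auto)
    have tA: "beval (test_A after_pivot) s1 \<longleftrightarrow> \<not> cond_A {..<k} {p + 1..<n} (dec f S) {p + 1..<p + 1 + t}"
      using T(3)[OF ap1] cong by blast
    have W: "{p + 1..<p + 1 + t} \<subseteq> {p + 1..<n}" using lt by auto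
    show "runs w (Cond (test_A after_pivot) (Seq Drop (Pick after_pivot (Reg 0) (Const 0) (Const 0)))
      (Assign 3 (Plus (Reg 3) (Const 1)))) s1 (250 * (n + 1)) (\<lambda>s'. \<exists>m'<m. repairing B m' s')"
    proof (rule runs_Cond[OF T(1)[OF ap1], where Ta = "230 * (n + 1)"])
      assume "beval (test_A after_pivot) s1"
      then have viol: "\<not> cond_A {..<k} {p + 1..<n} (dec f S) {p + 1..<p + 1 + t}" using tA by blast
      show "runs w (Seq Drop (Pick after_pivot (Reg 0) (Const 0) (Const 0))) s1 (230 * (n + 1)) (\<lambda>s'. \<exists>m'<m. repairing B m' s')"
      proof (rule runs_Seq[OF runs_unchoose_stage[OF fn fresh w c1 S(1)], where Tc = "150 * (n + 1)"])
        fix s2 assume "\<exists>b\<in>S \<inter> {..<k}. (\<forall>y\<in>S \<inter> {..<k}. f b \<le> f y) \<and>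
          choosing n k p f B (S - {b}) s2 \<and> (\<forall>x. x \<notin> scratch \<longrightarrow> regs s2 x = regs s1 x)"
        then obtain b where b: "b \<in> S \<inter> {..<k}" "\<And>y. y \<in> S \<inter> {..<k} \<Longrightarrow> f b \<le> f y"
          "choosing n k p f B (S - {b}) s2" "regs s2 3 = t" using r1 by auto
        have ne: "{p + 1..<n} - (S - {b}) \<noteq> {}" using violation_movable(2)[OF S(1,2) W viol] by blast
        show "runs w (Pick after_pivot (Reg 0) (Const 0) (Const 0)) s2 (150 * (n + 1)) (\<lambda>s'. \<exists>m'<m. repairing B m' s')"
        proof (rule runs_conseq[OF runs_pick_outer[OF fn fresh w b(3) ne]])
          fix s3 assume "\<exists>c. picked k f ({p + 1..<n} - (S - {b})) c \<and> choosing n k p f B (insert c (S - {b})) s3 \<and>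
            (\<forall>x. x \<notin> scratch \<longrightarrow> regs s3 x = regs s2 x)"
          then obtain c where c: "picked k f ({p + 1..<n} - (S - {b})) c" "choosing n k p f B (insert c (S - {b})) s3"
            "regs s3 3 = t" using b(4) by auto
          let ?S = "insert c (S - {b})"
          have ex: "valid ?S" "card ?S = f p" "justified ?S" "card (?S \<inter> {..<k}) < card (S \<inter> {..<k})"
            by (rule valid_exchange[OF S(1,2) W viol b(1) _ c(1)]; rule b(2); assumption)+
          have pre: "cond_A {..<k} {p + 1..<n} (dec f ?S) {p + 1..<p + 1 + t'}" if "t' < t" for t'
            by (rule valid_exchange(5)[OF S(1,2) W viol b(1) _ c(1) _ S(7)[OF that]]) (use b(2) that lt in auto)
          have "repairing B ((n - p - t) + card (?S \<inter> {..<k})) s3"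
            unfolding repairing_def using ex(1-3) c(2,3) S(6) pre by blast
          then show "\<exists>m'<m. repairing B m' s3" using ex(4) S(8) by (metis add_less_cancel_left)
        qed simp_all
      qed simp_all
    next
      assume "\<not> beval (test_A after_pivot) s1"
      then have ok: "cond_A {..<k} {p + 1..<n} (dec f S) {p + 1..<p + 1 + t}" using tA by blast
      have pre: "cond_A {..<k} {p + 1..<n} (dec f S) {p + 1..<p + 1 + t'}" if "t' < t + 1" for t'
        using that ok S(7)[of t'] by (cases "t' = t") auto
      let ?s = "s1\<lparr>regs := (regs s1)(3 := t + 1)\<rparr>"
      have "choosing n k p f B S ?s" using c1 by (simp add: choosing_upd)
      moreover have "regs ?s 3 = t + 1" "p + (t + 1) \<le> n" using lt by simp_all
      ultimately have "repairing B ((n - p - (t + 1)) + card (S \<inter> {..<k})) ?s"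
        unfolding repairing_def using S(1-3) pre by blast
      moreover have "(n - p - (t + 1)) + card (S \<inter> {..<k}) < m" using S(8) lt by simp
      ultimately have "\<exists>m'<m. repairing B m' ?s" by blast
      then show "runs w (Assign 3 (Plus (Reg 3) (Const 1))) s1 (230 * (n + 1)) (\<lambda>s'. \<exists>m'<m. repairing B m' s')"
        by (intro runs_Assign) (use r1 lt word in auto)
    qed (simp_all add: test_A_def)
  qed auto
qed

lemma runs_Repair:
  assumes fn: "\<And>i. i < n \<Longrightarrow> f i \<le> n" and fresh: "\<And>x. x \<in> {..<k} \<union> {p + 1..<n} \<Longrightarrow> {p, x} \<notin> B"
    and w: "4 * (n + 1) * (n + 1) + 20 \<le> w"
    and S: "valid S" "greedy S" "card S = f p" "choosing n k p f B S s"
  shows "runs w Repair s (920 * ((n + 1) * (n + 1))) (\<lambda>s'. \<exists>S. valid S \<and> card S = f p \<and>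
    feasible {..<k} {p + 1..<n} (dec f S) \<and> choosing n k p f B S s')"
  unfolding Repair_def
proof (rule runs_Seq[where Ta = 2 and Tc = "912 * ((n + 1) * (n + 1))" and P = "\<lambda>s'. s' = s\<lparr>regs := (regs s)(3 := 0)\<rparr>"])
  note word = word[OF fn fresh w]
  show "runs w (Assign 3 (Const 0)) s 2 (\<lambda>s'. s' = s\<lparr>regs := (regs s)(3 := 0)\<rparr>)"
    by (rule runs_Assign) auto
  fix s1 assume s1: "s1 = s\<lparr>regs := (regs s)(3 := 0)\<rparr>"
  have c1: "choosing n k p f B S s1" "regs s1 3 = 0" using S(4) s1 by (simp_all add: choosing_upd)
  have "repairing B ((n - p - 0) + card (S \<inter> {..<k})) s1"
    unfolding repairing_def
    by (intro exI[of _ S] exI[of _ 0]) (use S(1-3) c1 pn in \<open>auto simp: justified_def\<close>)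
  then show "runs w (While (Less (Plus (Reg 2) (Reg 3)) (Reg 0)) Repair_step) s1
    (912 * ((n + 1) * (n + 1))) (\<lambda>s'. \<exists>S. valid S \<and> card S = f p \<and>
    feasible {..<k} {p + 1..<n} (dec f S) \<and> choosing n k p f B S s')"
  proof (rule runs_While[where I = "repairing B" and Tb = "450 * (n + 1)"])
    fix m s' assume I: "repairing B m s'"
    then obtain S t where S: "valid S" "card S = f p" "justified S" "choosing n k p f B S s'" "regs s' 3 = t" "p + t \<le> n"
      "\<And>t'. t' < t \<Longrightarrow> cond_A {..<k} {p + 1..<n} (dec f S) {p + 1..<p + 1 + t'}"
      unfolding repairing_def by blast
    note r = choosing_regs[OF S(4)]
    show "bfits w (Less (Plus (Reg 2) (Reg 3)) (Reg 0)) s'" using r S(5,6) word by simp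
    show "runs w Repair_step s'
      (450 * (n + 1)) (\<lambda>s'. \<exists>m'<m. repairing B m' s')" if "beval (Less (Plus (Reg 2) (Reg 3)) (Reg 0)) s'"
      by (rule runs_repair_step[OF fn fresh w I]) (use that in simp_all)
    assume "\<not> beval (Less (Plus (Reg 2) (Reg 3)) (Reg 0)) s'"
    \<comment> \<open>All sizes below \<open>n - p\<close> have been tested, and
      \<open>{p + 1..<n}\<close> has \<open>n - p - 1\<close> elements.\<close>
    then have "p + t = n" using r S(5,6) by simp
    then have "feasible {..<k} {p + 1..<n} (dec f S)"
      by (intro stage_step[OF S(1-3)] S(7)) simp
    then show "\<exists>S. valid S \<and> card S = f p \<and> feasible {..<k} {p + 1..<n} (dec f S) \<and> choosing n k p f B S s'"
      using S by blast
  next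
    \<comment> \<open>At most \<open>n - p\<close> increments and \<open>k\<close> exchanges, and
      \<open>k \<le> p\<close>: altogether at most \<open>n\<close> steps of linear time.\<close>
    have "card (S \<inter> {..<k}) \<le> card {..<k}" by (intro card_mono) auto
    then have "n - p - 0 + card (S \<inter> {..<k}) \<le> n" using kp pn by simp
    then have "(n - p - 0 + card (S \<inter> {..<k}) + 1) * (6 + 450 * (n + 1)) \<le> (n + 1) * (456 * (n + 1))"
      by (intro mult_mono) auto
    then show "(n - p - 0 + card (S \<inter> {..<k}) + 1) * (1 + bcost (Less (Plus (Reg 2) (Reg 3)) (Reg 0)) + 450 * (n + 1))
        \<le> 912 * ((n + 1) * (n + 1))" by (simp add: algebra_simps)
  qed
qed simp_all

lemma runs_stage:
  assumes fn: "\<And>i. i < n \<Longrightarrow> f i \<le> n" and fresh: "\<And>x. x \<in> {..<k} \<union> {p + 1..<n} \<Longrightarrow> {p, x} \<notin> B"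
    and w: "4 * (n + 1) * (n + 1) + 20 \<le> w" and s: "current n k p f B s"
  shows "runs w (Seq Start (Seq Greedy Repair)) s (1300 * ((n + 1) * (n + 1))) (\<lambda>s'. \<exists>S. valid S \<and> card S = f p \<and>
    feasible {..<k} {p + 1..<n} (dec f S) \<and> choosing n k p f B S s')"
proof (rule runs_Seq[OF runs_Start[OF s pn _ fn[OF pn]], where Tc = "1240 * ((n + 1) * (n + 1))"])
  show "n \<le> w" using word[OF fn fresh w] by simp
  fix s1 assume s1: "choosing n k p f B {} s1 \<and> regs s1 9 = f p"
  show "runs w (Seq Greedy Repair) s1 (1240 * ((n + 1) * (n + 1))) (\<lambda>s'. \<exists>S. valid S \<and> card S = f p \<and>
    feasible {..<k} {p + 1..<n} (dec f S) \<and> choosing n k p f B S s')"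
  proof (rule runs_Seq[OF runs_Greedy[OF fn fresh w], where Tc = "920 * ((n + 1) * (n + 1))"])
    fix s2 assume "\<exists>S. valid S \<and> greedy S \<and> card S = f p \<and> choosing n k p f B S s2"
    then obtain S where S: "valid S" "greedy S" "card S = f p" "choosing n k p f B S s2" by blast
    show "runs w Repair s2 (920 * ((n + 1) * (n + 1))) (\<lambda>s'. \<exists>S. valid S \<and> card S = f p \<and>
      feasible {..<k} {p + 1..<n} (dec f S) \<and> choosing n k p f B S s')" by (rule runs_Repair[OF fn fresh w S])
  qed (use s1 in auto)
qed simp_all

end

section \<open>The search for the least feasible size\<close>

definition Search_step :: com where
  "Search_step = Seq (Eval (Reg 1)) (Cond (Conj (Neg (test_A (Reg 1))) (Neg test_B))
    (Assign 3 (Plus (Reg 3) (Const 1)))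
    (Seq (Assign 1 (Plus (Reg 1) (Const 1))) (Assign 3 (Const 0))))"

definition Find_size :: com where
  "Find_size = While (Less (Plus (Reg 1) (Reg 3)) (Plus (Reg 0) (Const 1))) Search_step"

text \<open>The value \<open>k + t = n + 1\<close> signals that all prefix sizes have passed for
  \<open>k\<close>. The variant is lexicographic: its second part is at most \<open>n + 1\<close>,
  whence the factor \<open>n + 2\<close>.\<close>

definition searching :: "nat \<Rightarrow> (nat \<Rightarrow> nat) \<Rightarrow> nat \<Rightarrow> state \<Rightarrow> bool" where
  "searching n f m s \<longleftrightarrow> (\<exists>k t. current n k 0 f {} s \<and> regs s 3 = t \<and> k \<le> n \<and> k + t \<le> n + 1 \<and>
    (\<forall>t'<t. cond_A {..<k} {k..<n} f {k..<k + t'} \<and> cond_B {..<k} {k..<n} f {k..<k + t'}) \<and>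
    (\<forall>k'\<le>n. feasible {..<k'} {k'..<n} f \<longrightarrow> k \<le> k') \<and> m = (n - k) * (n + 2) + (n + 1 - t))"

lemma runs_search_step:
  assumes fn: "\<And>i. i < n \<Longrightarrow> f i \<le> n" and w: "4 * (n + 1) * (n + 1) + 20 \<le> w"
    and all: "feasible {..<n} {n..<n} f"
    and I: "searching n f m s" and b: "regs s 1 + regs s 3 < regs s 0 + 1"
  shows "runs w Search_step s (250 * (n + 1)) (\<lambda>s'. \<exists>m'<m. searching n f m' s')"
proof -
  have word: "n + 1 \<le> w" "1 \<le> w" using w by (auto simp: algebra_simps)
  obtain k t where k: "current n k 0 f {} s" "regs s 3 = t" "k \<le> n"
    "\<And>t'. t' < t \<Longrightarrow> cond_A {..<k} {k..<n} f {k..<k + t'} \<and> cond_B {..<k} {k..<n} f {k..<k + t'}"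
    "\<And>k'. k' \<le> n \<Longrightarrow> feasible {..<k'} {k'..<n} f \<Longrightarrow> k \<le> k'" "m = (n - k) * (n + 2) + (n + 1 - t)"
    using I unfolding searching_def by blast
  let ?X = "{4, 5, 6, 7, 8} :: nat set"
  have r0: "regs s 0 = n" "regs s 1 = k" "regs s 2 = 0" "\<And>i. i < n \<Longrightarrow> arrs s 0 i = f i"
    using k(1) unfolding current_def by auto
  have lt: "k + t \<le> n" using b r0 k(2) by simp
  have lo: "fits w (Reg 1) s' \<and> eval (Reg 1) s' = k" if "agree ?X s s'" for s'
    using that r0 word k(3) by (auto simp: agree_def)
  show ?thesis unfolding Search_step_def
  proof (rule runs_Seq[OF runs_Eval[OF r0(1,2) k(2) r0(4) fn k(3) lt w lo], where Tc = "50 * (n + 1)"])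
    fix s1 assume s1: "agree ?X s s1 \<and> evaluated n k k t f s1"
    then have ag: "agree ?X s s1" and ev: "evaluated n k k t f s1" by auto
    have r1: "regs s1 0 = n" "regs s1 3 = t" "regs s1 1 = k" using ag r0 k(2) by (auto simp: agree_def)
    have c1: "current n k 0 f {} s1" using k(1) current_agree[OF ag] by simp
    have lo1: "eval (Reg 1) s1 = k" "fits w (Reg 1) s1" using lo[OF ag] by auto
    note T = tests[OF ev r1(1,2) lo1 fn k(3) lt w]
    show "runs w (Cond (Conj (Neg (test_A (Reg 1))) (Neg test_B)) (Assign 3 (Plus (Reg 3) (Const 1)))
      (Seq (Assign 1 (Plus (Reg 1) (Const 1))) (Assign 3 (Const 0)))) s1 (50 * (n + 1)) (\<lambda>s'. \<exists>m'<m. searching n f m' s')"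
    proof (rule runs_Cond[where Ta = 6])
      show "bfits w (Conj (Neg (test_A (Reg 1))) (Neg test_B)) s1" using T(1,2) by simp
      assume "beval (Conj (Neg (test_A (Reg 1))) (Neg test_B)) s1"
      then have ok: "cond_A {..<k} {k..<n} f {k..<k + t} \<and> cond_B {..<k} {k..<n} f {k..<k + t}" using T(3,4) by simp
      let ?s = "s1\<lparr>regs := (regs s1)(3 := t + 1)\<rparr>"
      have "\<forall>t'<t + 1. cond_A {..<k} {k..<n} f {k..<k + t'} \<and> cond_B {..<k} {k..<n} f {k..<k + t'}"
        using ok k(4) by (metis Suc_eq_plus1 less_Suc_eq)
      moreover have "current n k 0 f {} ?s" "regs ?s 3 = t + 1" "k + (t + 1) \<le> n + 1"
        using c1 lt by (simp_all add: current_upd)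
      ultimately have "searching n f ((n - k) * (n + 2) + (n + 1 - (t + 1))) ?s"
        unfolding searching_def using k(3,5) by blast
      moreover have "(n - k) * (n + 2) + (n + 1 - (t + 1)) < m" using k(6) lt by simp
      ultimately have "\<exists>m'<m. searching n f m' ?s" by blast
      then show "runs w (Assign 3 (Plus (Reg 3) (Const 1))) s1 6 (\<lambda>s'. \<exists>m'<m. searching n f m' s')"
        by (intro runs_Assign) (use r1 lt word in auto)
    next
      assume "\<not> beval (Conj (Neg (test_A (Reg 1))) (Neg test_B)) s1"
      then have viol: "\<not> (cond_A {..<k} {k..<n} f {k..<k + t} \<and> cond_B {..<k} {k..<n} f {k..<k + t})" using T(3,4) by simp
      have W: "{k..<k + t} \<subseteq> {k..<n}" "{..<k} \<inter> {k..<n} = {}" using lt by auto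
      have nf: "\<not> feasible {..<k} {k..<n} f"
        using viol feasible_imp_cond_A[OF _ W(2,1)] feasible_imp_cond_B[OF _ W(2,1)] by blast
      \<comment> \<open>All vertices together form a feasible dominating set, so the search cannot
        run past \<open>n\<close>.\<close>
      then have "k \<noteq> n" using all by auto
      then have kn: "k + 1 \<le> n" using k(3) by simp
      have min: "\<forall>k'\<le>n. feasible {..<k'} {k'..<n} f \<longrightarrow> k + 1 \<le> k'"
      proof (intro allI impI)
        fix k' assume "k' \<le> n" "feasible {..<k'} {k'..<n} f"
        moreover from this have "k \<noteq> k'" using nf by blast
        ultimately show "k + 1 \<le> k'" using k(5)[of k'] by simp
      qed
      let ?s = "s1\<lparr>regs := (regs s1)(1 := k + 1)\<rparr>"
      let ?t = "?s\<lparr>regs := (regs ?s)(3 := 0)\<rparr>"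
      have "current n (k + 1) 0 f {} ?t" "regs ?t 3 = 0" using c1 by (simp_all add: current_def)
      then have "searching n f ((n - (k + 1)) * (n + 2) + (n + 1 - 0)) ?t"
        unfolding searching_def using kn min by (intro exI[of _ "k + 1"] exI[of _ 0]) simp
      moreover have "(n - (k + 1)) * (n + 2) + (n + 1 - 0) < m"
      proof -
        have "n - k = Suc (n - (k + 1))" using kn by simp
        then show ?thesis using k(6) lt by simp
      qed
      ultimately have ex: "\<exists>m'<m. searching n f m' ?t" by blast
      show "runs w (Seq (Assign 1 (Plus (Reg 1) (Const 1))) (Assign 3 (Const 0))) s1 6 (\<lambda>s'. \<exists>m'<m. searching n f m' s')"
      proof (rule runs_Seq[where Ta = 4 and Tc = 2 and P = "\<lambda>s'. s' = ?s"])
        show "runs w (Assign 1 (Plus (Reg 1) (Const 1))) s1 4 (\<lambda>s'. s' = ?s)"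
          by (rule runs_Assign) (use r1 kn word in auto)
        show "runs w (Assign 3 (Const 0)) s' 2 (\<lambda>s'. \<exists>m'<m. searching n f m' s')" if "s' = ?s" for s'
          by (rule runs_Assign) (use that ex in auto)
      qed simp
    qed (simp add: test_A_def test_B_def)
  qed auto
qed

lemma runs_Find_size:
  assumes fn: "\<And>i. i < n \<Longrightarrow> f i \<le> n" and w: "4 * (n + 1) * (n + 1) + 20 \<le> w"
    and r: "realization {..<n} E f" and pos: "\<And>i. i < n \<Longrightarrow> 0 < f i"
    and sorted: "\<And>i j. i \<le> j \<Longrightarrow> j < n \<Longrightarrow> f j \<le> f i"
    and s: "current n 0 0 f {} s" "regs s 3 = 0"
  shows "runs w Find_size s (600 * ((n + 1) * (n + 1) * (n + 1))) (\<lambda>s'. \<exists>k\<le>n. current n k 0 f {} s' \<and>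
    feasible {..<k} {k..<n} f \<and> (\<forall>k'\<le>n. feasible {..<k'} {k'..<n} f \<longrightarrow> k \<le> k'))"
  unfolding Find_size_def
proof (rule runs_While[where I = "searching n f" and m = "(n - 0) * (n + 2) + (n + 1 - 0)" and Tb = "250 * (n + 1)"])
  have word: "n + 1 \<le> w" "1 \<le> w" using w by (auto simp: algebra_simps)
  have all: "feasible {..<n} {n..<n} f" using r unfolding feasible_def by auto
  show "searching n f ((n - 0) * (n + 2) + (n + 1 - 0)) s"
    unfolding searching_def using s by (intro exI[of _ 0]) simp
  fix m s' assume I: "searching n f m s'"
  then obtain k t where k: "current n k 0 f {} s'" "regs s' 3 = t" "k \<le> n" "k + t \<le> n + 1"
    "\<And>t'. t' < t \<Longrightarrow> cond_A {..<k} {k..<n} f {k..<k + t'} \<and> cond_B {..<k} {k..<n} f {k..<k + t'}"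
    "\<And>k'. k' \<le> n \<Longrightarrow> feasible {..<k'} {k'..<n} f \<Longrightarrow> k \<le> k'"
    unfolding searching_def by blast
  have r0: "regs s' 0 = n" "regs s' (Suc 0) = k" using k(1) unfolding current_def by auto
  show "bfits w (Less (Plus (Reg 1) (Reg 3)) (Plus (Reg 0) (Const 1))) s'" using r0 k(2,4) k(3) word by simp
  show "runs w Search_step s' (250 * (n + 1)) (\<lambda>s'. \<exists>m'<m. searching n f m' s')"
    if "beval (Less (Plus (Reg 1) (Reg 3)) (Plus (Reg 0) (Const 1))) s'"
    by (rule runs_search_step[OF fn w all I]) (use that in simp_all)
  assume "\<not> beval (Less (Plus (Reg 1) (Reg 3)) (Plus (Reg 0) (Const 1))) s'"
  then have kt: "k + t = n + 1" using r0 k(2,4) by simp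
  have pre: "cond_A {..<k} {k..<n} f {k..<k + card W} \<and> cond_B {..<k} {k..<n} f {k..<k + card W}"
    if "W \<subseteq> {k..<n}" for W
  proof -
    have "card W \<le> card {k..<n}" using that by (intro card_mono) auto
    then show ?thesis using k(5)[of "card W"] kt k(3) by simp
  qed
  have "feasible {..<k} {k..<n} f"
  proof (rule feasible_if_conds)
    have "{..<k} \<union> {k..<n} = {..<n}" using k(3) by auto
    then show "\<exists>E. realization ({..<k} \<union> {k..<n}) E f" using r by auto
    show "cond_A {..<k} {k..<n} f W" if "W \<subseteq> {k..<n}" for W
      by (rule cond_prefix(1)[OF sorted that]) (use pre[OF that] in auto)
    show "cond_B {..<k} {k..<n} f W" if "W \<subseteq> {k..<n}" for W
      by (rule cond_prefix(2)[OF sorted that]) (use pre[OF that] in auto)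
  qed (use pos in auto)
  then show "\<exists>k\<le>n. current n k 0 f {} s' \<and> feasible {..<k} {k..<n} f \<and> (\<forall>k'\<le>n. feasible {..<k'} {k'..<n} f \<longrightarrow> k \<le> k')"
    using k(1,3,6) by blast
next
  have "((n - 0) * (n + 2) + (n + 1 - 0) + 1) * (1 + bcost (Less (Plus (Reg 1) (Reg 3)) (Plus (Reg 0) (Const 1))) + 250 * (n + 1))
      \<le> (2 * ((n + 1) * (n + 1))) * (258 * (n + 1))"
    by (intro mult_mono) (auto simp: algebra_simps)
  then show "((n - 0) * (n + 2) + (n + 1 - 0) + 1) * (1 + bcost (Less (Plus (Reg 1) (Reg 3)) (Plus (Reg 0) (Const 1))) + 250 * (n + 1))
      \<le> 600 * ((n + 1) * (n + 1) * (n + 1))" by (simp add: algebra_simps)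
qed

section \<open>Attaching the vertices outside \<open>D\<close>\<close>

definition Attach :: com where
  "Attach = For 2 (Reg 1) (Reg 0) (Seq Start (Seq Greedy Repair))"

text \<open>Every edge built so far meets a treated vertex in \<open>{k..<p}\<close>. Consequently
  the pivot has no edge yet to a vertex it may choose, and the pairs inside \<open>D\<close> stay
  free for the completion.\<close>

definition attached :: "nat \<Rightarrow> nat \<Rightarrow> (nat \<Rightarrow> nat) \<Rightarrow> nat \<Rightarrow> state \<Rightarrow> bool" where
  "attached n k d p s \<longleftrightarrow> (\<exists>r B. current n k p r B s \<and> built n d B r \<and> (\<forall>e\<in>B. e \<inter> {k..<p} \<noteq> {}) \<and>
    feasible {..<k} {p..<n} r \<and> (\<forall>i j. p \<le> i \<longrightarrow> i \<le> j \<longrightarrow> j < n \<longrightarrow> r j \<le> r i) \<and>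
    (\<forall>v\<in>{k..<p}. r v = 0 \<and> (\<exists>a<k. {a, v} \<in> B)) \<and> k \<le> p)"

lemma runs_attach_step:
  assumes dn: "\<And>i. i < n \<Longrightarrow> d i \<le> n" and w: "4 * (n + 1) * (n + 1) + 20 \<le> w"
    and I: "attached n k d p s" and p: "p < n"
  shows "runs w (Seq Start (Seq Greedy Repair)) s (1300 * ((n + 1) * (n + 1)))
    (\<lambda>s'. regs s' 2 = p \<and> attached n k d (Suc p) (s'\<lparr>regs := (regs s')(2 := Suc p)\<rparr>))"
proof -
  obtain f B where B: "current n k p f B s" "built n d B f" "\<forall>e\<in>B. e \<inter> {k..<p} \<noteq> {}"
    "feasible {..<k} {p..<n} f" "\<forall>i j. p \<le> i \<longrightarrow> i \<le> j \<longrightarrow> j < n \<longrightarrow> f j \<le> f i"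
    "\<forall>v\<in>{k..<p}. f v = 0 \<and> (\<exists>a<k. {a, v} \<in> B)" "k \<le> p"
    using I unfolding attached_def by (elim exE conjE)
  note B = B(1,2) B(3)[rule_format] B(4) B(5)[rule_format] B(6)[rule_format] B(7)
  interpret stage n k p f by unfold_locales (use B(4,5,7) p in auto)
  have fn: "f i \<le> n" if "i < n" for i using B(2) dn[OF that] that unfolding built_def by (metis add_leD1 le_trans order_refl)
  have fresh: "{p, x} \<notin> B" if "x \<in> {..<k} \<union> {p + 1..<n}" for x
    using B(3)[of "{p, x}"] that B(7) by auto
  show ?thesis
  proof (rule runs_conseq[OF runs_stage[OF fn fresh w B(1)]])
    fix s' assume "\<exists>S. valid S \<and> card S = f p \<and> feasible {..<k} {p + 1..<n} (dec f S) \<and> choosing n k p f B S s'"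
    then obtain S where S: "valid S" "card S = f p" "feasible {..<k} {p + 1..<n} (dec f S)" "choosing n k p f B S s'" by blast
    note v = validD[OF S(1)]
    let ?r = "(dec f S)(p := 0)" and ?B = "B \<union> star p S" and ?s = "s'\<lparr>regs := (regs s')(2 := Suc p)\<rparr>"
    have cur: "current n k (Suc p) ?r ?B ?s" using S(4) unfolding choosing_def current_def by simp
    have bu: "built n d ?B ?r"
    proof (rule built_star[OF B(2) p _ S(2) v(4)])
      show "S \<subseteq> {..<n} - {p}" using v(1) kp pn by fastforce
      show "{p, x} \<notin> B" if "x \<in> S" for x using fresh[of x] v(1) that by blast
    qed
    have e: "e \<inter> {k..<Suc p} \<noteq> {}" if "e \<in> ?B" for e
    proof (cases "e \<in> B")
      case True
      then show ?thesis using B(3)[of e] by fastforce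
    next
      case False
      then have "p \<in> e" using that by (auto simp: star_def)
      then show ?thesis using kp by auto
    qed
    have "?r v = dec f S v" if "v \<in> {..<k} \<union> {p + 1..<n}" for v using that kp by auto
    then have "feasible {..<k} {p + 1..<n} ?r \<longleftrightarrow> feasible {..<k} {p + 1..<n} (dec f S)" by (rule feasible_cong)
    then have fe: "feasible {..<k} {Suc p..<n} ?r" using S(3) by simp
    have so: "?r j \<le> ?r i" if "Suc p \<le> i" "i \<le> j" "j < n" for i j using dec_sorted[OF S(1), of i j] that by simp
    have dom: "?r x = 0 \<and> (\<exists>a<k. {a, x} \<in> ?B)" if x: "x \<in> {k..<Suc p}" for x
    proof (cases "x = p")
      case True
      obtain a where "a \<in> S" "a < k" using v(3) by auto
      then have "{a, p} \<in> ?B" by (simp add: edge_star)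
      then show ?thesis using True \<open>a < k\<close> by auto
    next
      case False
      then have "x \<in> {k..<p}" using x by auto
      then have "f x = 0 \<and> (\<exists>a<k. {a, x} \<in> B)" by (rule B(6))
      then show ?thesis using False by (auto simp: dec_def)
    qed
    have "attached n k d (Suc p) ?s" unfolding attached_def
      using cur bu e fe so dom B(7) le_SucI by blast
    then show "regs s' 2 = p \<and> attached n k d (Suc p) ?s" using choosing_regs(3)[OF S(4)] by blast
  qed simp_all
qed

lemma runs_Attach:
  assumes dn: "\<And>i. i < n \<Longrightarrow> d i \<le> n" and w: "4 * (n + 1) * (n + 1) + 20 \<le> w"
    and s: "current n k 0 d {} s" and k: "k \<le> n" "feasible {..<k} {k..<n} d"
    and sorted: "\<And>i j. i \<le> j \<Longrightarrow> j < n \<Longrightarrow> d j \<le> d i"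
  shows "runs w Attach s (1400 * ((n + 1) * (n + 1) * (n + 1))) (attached n k d n)"
  unfolding Attach_def
proof (rule runs_For[where I = "attached n k d" and l = k and h = n and Tb = "1300 * ((n + 1) * (n + 1))"])
  have word: "n + 1 \<le> w" "1 \<le> w" using w by (auto simp: algebra_simps)
  have r: "regs s (Suc 0) = k" using s by (simp add: current_def)
  show "fits w (Reg 1) s" "eval (Reg 1) s = k" "k \<le> n" "n \<le> w" "0 < w" using r word k by auto
  show "attached n k d k (s\<lparr>regs := (regs s)(2 := k)\<rparr>)"
    unfolding attached_def
  proof (intro exI[of _ d] exI[of _ "{}"] conjI)
    show "current n k k d {} (s\<lparr>regs := (regs s)(2 := k)\<rparr>)" using s by (simp add: current_def)
    show "built n d {} d" by (simp add: built_def graph_on_def nbrs_def)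
  qed (use k sorted in auto)
  show "fits w (Reg 0) s' \<and> eval (Reg 0) s' = n" if "attached n k d j s'" for j s'
    using that word unfolding attached_def current_def by auto
  show "runs w (Seq Start (Seq Greedy Repair)) s' (1300 * ((n + 1) * (n + 1)))
    (\<lambda>s''. regs s'' 2 = j \<and> attached n k d (Suc j) (s''\<lparr>regs := (regs s'')(2 := Suc j)\<rparr>))"
    if "attached n k d j s'" "j < n" for j s' by (rule runs_attach_step[OF dn w that])
  have "(n - k + 1) * (8 + 1300 * ((n + 1) * (n + 1))) \<le> (n + 1) * (1308 * ((n + 1) * (n + 1)))"
    by (intro mult_mono) auto
  then show "1 + cost (Reg 1) + (n - k + 1) * (7 + cost (Reg 0) + 1300 * ((n + 1) * (n + 1))) \<le> 1400 * ((n + 1) * (n + 1) * (n + 1))"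
    by (simp add: algebra_simps)
qed

section \<open>Completing the graph inside \<open>D\<close>\<close>

definition Complete_step :: com where
  "Complete_step = Seq Start (For 10 (Const 0) (Reg 9) (Pick after_pivot (Reg 1) (Const 0) (Const 0)))"

definition Complete :: com where
  "Complete = For 2 (Const 0) (Reg 1) Complete_step"

text \<open>Domination is already secured by the edges in \<open>B\<close>, which are never removed;
  only realizability on the rest of \<open>D\<close> has to be carried along. The pivots can be
  taken in index order since the Havel-Hakimi step allows any pivot.\<close>

definition completing :: "nat \<Rightarrow> nat \<Rightarrow> (nat \<Rightarrow> nat) \<Rightarrow> nat \<Rightarrow> state \<Rightarrow> bool" where
  "completing n k d p s \<longleftrightarrow> (\<exists>r B. current n k p r B s \<and> built n d B r \<and> (\<forall>e\<in>B. e \<inter> ({k..<n} \<union> {..<p}) \<noteq> {}) \<and>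
    (\<exists>E. realization {p..<k} E r) \<and> (\<forall>v\<in>{k..<n} \<union> {..<p}. r v = 0) \<and> (\<forall>v\<in>{k..<n}. \<exists>a<k. {a, v} \<in> B))"

lemma runs_complete_step:
  assumes dn: "\<And>i. i < n \<Longrightarrow> d i \<le> n" and w: "4 * (n + 1) * (n + 1) + 20 \<le> w" and k: "k \<le> n"
    and I: "completing n k d p s" and p: "p < k"
  shows "runs w Complete_step s
    (200 * ((n + 1) * (n + 1)))
    (\<lambda>s'. regs s' 2 = p \<and> completing n k d (Suc p) (s'\<lparr>regs := (regs s')(2 := Suc p)\<rparr>))"
proof -
  have word: "n + 1 \<le> w" "1 \<le> w" using w by (auto simp: algebra_simps)
  obtain f B E where B: "current n k p f B s" "built n d B f" "\<forall>e\<in>B. e \<inter> ({k..<n} \<union> {..<p}) \<noteq> {}"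
    "realization {p..<k} E f" "\<forall>v\<in>{k..<n} \<union> {..<p}. f v = 0" "\<forall>v\<in>{k..<n}. \<exists>a<k. {a, v} \<in> B"
    using I unfolding completing_def by (elim exE conjE)
  note B = B(1,2) B(3)[rule_format] B(4) B(5)[rule_format] B(6)[rule_format]
  have pn: "p < n" using p k by simp
  have fn: "f i \<le> n" if "i < n" for i using B(2) dn[OF that] that unfolding built_def by (metis add_leD1 le_trans order_refl)
  have fresh: "{p, x} \<notin> B" if "x \<in> {p + 1..<k}" for x
    using B(3)[of "{p, x}"] that p by auto
  have g: "graph_on {p..<k} E" using realization_graph[OF B(4)] .
  have N: "nbrs E p \<subseteq> {p + 1..<k}"
  proof
    fix x assume x: "x \<in> nbrs E p"
    then have "x \<noteq> p" using nbrs_irrefl[OF g, of p] by metis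
    moreover have "x \<in> {p..<k}" using nbrs_subset[OF g, of p] x by blast
    ultimately show "x \<in> {p + 1..<k}" by auto
  qed
  have cN: "card (nbrs E p) = f p" using realization_card[OF B(4), of p] p by simp
  have Npos: "0 < f x" if x: "x \<in> nbrs E p" for x
  proof -
    have "p \<in> nbrs E x" using x by (simp add: nbrs_sym)
    then have "0 < card (nbrs E x)" using finite_nbrs[OF g] by (auto simp: card_gt_0_iff)
    moreover have "card (nbrs E x) = f x" using realization_card[OF B(4), of x] x N by auto
    ultimately show ?thesis by simp
  qed
  let ?I = "\<lambda>j s. \<exists>S. S \<subseteq> {p + 1..<k} \<and> card S = j \<and> (\<forall>x\<in>S. 0 < f x) \<and>
    (\<forall>x\<in>S. \<forall>y\<in>{p + 1..<k} - S. f y \<le> f x) \<and> choosing n k p f B S s \<and> regs s 9 = f p"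
  have "runs w Complete_step s
    (200 * ((n + 1) * (n + 1))) (?I (f p))"
    unfolding Complete_step_def
  proof (rule runs_Seq[OF runs_Start[OF B(1) pn _ fn[OF pn]], where Tc = "160 * ((n + 1) * (n + 1))"])
    fix s1 assume s1: "choosing n k p f B {} s1 \<and> regs s1 9 = f p"
    show "runs w (For 10 (Const 0) (Reg 9) (Pick after_pivot (Reg 1) (Const 0) (Const 0))) s1 (160 * ((n + 1) * (n + 1))) (?I (f p))"
    proof (rule runs_For[where I = ?I and l = 0 and h = "f p" and Tb = "150 * (n + 1)"])
      show "?I 0 (s1\<lparr>regs := (regs s1)(10 := 0)\<rparr>)"
        using s1 by (intro exI[of _ "{}"]) (simp add: choosing_upd)
      show "f p \<le> w" using fn[OF pn] word by simp
      show "fits w (Reg 9) s' \<and> eval (Reg 9) s' = f p" if "?I j s'" for j s' using that fn[OF pn] word by auto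
      show "runs w (Pick after_pivot (Reg 1) (Const 0) (Const 0)) s' (150 * (n + 1))
        (\<lambda>s''. regs s'' 10 = j \<and> ?I (Suc j) (s''\<lparr>regs := (regs s'')(10 := Suc j)\<rparr>))"
        if I: "?I j s'" and j: "regs s' 10 = j" "j < f p" for j s'
      proof -
        obtain S where S: "S \<subseteq> {p + 1..<k}" "card S = j" "\<And>x. x \<in> S \<Longrightarrow> 0 < f x"
          "\<And>x y. x \<in> S \<Longrightarrow> y \<in> {p + 1..<k} - S \<Longrightarrow> f y \<le> f x" "choosing n k p f B S s'" "regs s' 9 = f p" using I by blast
        have finS: "finite S" using S(1) finite_subset by blast
        have "\<not> nbrs E p \<subseteq> S" using card_mono[OF finS, of "nbrs E p"] cN S(2) j(2) by auto
        then obtain x where x: "x \<in> nbrs E p" "x \<notin> S" by blast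
        have ex: "set [p + 1..<k] - S \<noteq> {}" using x N by auto
        have cs: "[p + 1..<k] = [p + 1..<k] @ [0..<0]" by simp
        have "sorted_wrt (<) [p + 1..<k]" by simp
        then have so: "sorted_wrt (before k) [p + 1..<k]"
          by (rule sorted_wrt_mono_rel[rotated]) (auto simp: before_def)
        note r = choosing_regs[OF S(5)]
        show ?thesis
        proof (rule runs_conseq[OF runs_choose[OF S(5) pn _ fn w _ _ _ _ cs so _ _ _ _ _ _ ex]])
          fix s'' assume "\<exists>b. picked k f (set [p + 1..<k] - S) b \<and> choosing n k p f B (insert b S) s'' \<and>
            (\<forall>x. x \<notin> scratch \<longrightarrow> regs s'' x = regs s' x)"
          then obtain b where b: "picked k f ({p + 1..<k} - S) b" "choosing n k p f B (insert b S) s''"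
            "\<forall>x. x \<notin> scratch \<longrightarrow> regs s'' x = regs s' x" unfolding set_upt by blast
          have bS: "b \<in> {p + 1..<k}" "b \<notin> S" using b(1) unfolding picked_def by auto
          have le: "f y \<le> f b" if "y \<in> {p + 1..<k} - S" for y using picked_le[OF b(1) that] .
          have "0 < f b" using le[of x] Npos[OF x(1)] x N by auto
          then have "?I (Suc j) (s''\<lparr>regs := (regs s'')(10 := Suc j)\<rparr>)"
            using S b(2,3) finS le bS
            by (intro exI[of _ "insert b S"]) (auto simp: choosing_upd)
          then show "regs s'' 10 = j \<and> ?I (Suc j) (s''\<lparr>regs := (regs s'')(10 := Suc j)\<rparr>)"
            using b(3) j by simp
        qed (use r p k word fresh agree_scratch_regs in auto)
      qed
      have "(f p - 0 + 1) * (8 + 150 * (n + 1)) \<le> (n + 1) * (158 * (n + 1))"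
        using fn[OF pn] by (intro mult_mono) auto
      then show "1 + cost (Const 0) + (f p - 0 + 1) * (7 + cost (Reg 9) + 150 * (n + 1)) \<le> 160 * ((n + 1) * (n + 1))"
        by (simp add: algebra_simps)
    qed (use word in auto)
  qed (use word in simp_all)
  then show ?thesis
  proof (rule runs_conseq)
    fix s' assume "?I (f p) s'"
    then obtain S where S: "S \<subseteq> {p + 1..<k}" "card S = f p" "\<And>x. x \<in> S \<Longrightarrow> 0 < f x"
      "\<And>x y. x \<in> S \<Longrightarrow> y \<in> {p + 1..<k} - S \<Longrightarrow> f y \<le> f x" "choosing n k p f B S s'" by blast
    have others: "{p..<k} - {p} = {p + 1..<k}" by auto
    have "\<exists>E. realization {p..<k} E f \<and> nbrs E p = S"
      by (rule ex_pivot_neighbourhood[OF B(4)]) (use S p others in auto)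
    then obtain E' where "realization {p..<k} E' f" "nbrs E' p = S" by blast
    then have r': "realization {p + 1..<k} (delete p E') (dec f S)"
      using realization_delete[of "{p..<k}" E' f p] others by simp
    let ?r = "(dec f S)(p := 0)" and ?B = "B \<union> star p S" and ?s = "s'\<lparr>regs := (regs s')(2 := Suc p)\<rparr>"
    have cur: "current n k (Suc p) ?r ?B ?s" using S(5) unfolding choosing_def current_def by simp
    have bu: "built n d ?B ?r"
    proof (rule built_star[OF B(2) pn _ S(2,3)])
      show "S \<subseteq> {..<n} - {p}" using S(1) k by fastforce
      show "{p, x} \<notin> B" if "x \<in> S" for x using fresh[of x] S(1) that by blast
    qed
    have e: "e \<inter> ({k..<n} \<union> {..<Suc p}) \<noteq> {}" if "e \<in> ?B" for e
    proof (cases "e \<in> B")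
      case True
      then show ?thesis using B(3)[of e] by fastforce
    next
      case False
      then have "p \<in> e" using that by (auto simp: star_def)
      then show ?thesis by auto
    qed
    have re: "realization {Suc p..<k} (delete p E') ?r" using r' unfolding realization_def by simp
    have z: "?r v = 0" if "v \<in> {k..<n} \<union> {..<Suc p}" for v
    proof (cases "v = p")
      case False
      then have "f v = 0" using B(5)[of v] that by auto
      then show ?thesis using False by (simp add: dec_def)
    qed simp
    have dom: "\<exists>a<k. {a, v} \<in> ?B" if "v \<in> {k..<n}" for v using B(6)[OF that] by blast
    have "completing n k d (Suc p) ?s" unfolding completing_def using cur bu e re z dom by blast
    then show "regs s' 2 = p \<and> completing n k d (Suc p) ?s" using choosing_regs(3)[OF S(5)] by blast
  qed simp
qed

lemma runs_Complete:
  assumes dn: "\<And>i. i < n \<Longrightarrow> d i \<le> n" and w: "4 * (n + 1) * (n + 1) + 20 \<le> w" and k: "k \<le> n"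
    and s: "attached n k d n s"
  shows "runs w Complete s (300 * ((n + 1) * (n + 1) * (n + 1))) (completing n k d k)"
  unfolding Complete_def
proof (rule runs_For[where I = "completing n k d" and l = 0 and h = k and Tb = "200 * ((n + 1) * (n + 1))"])
  have word: "n + 1 \<le> w" "1 \<le> w" using w by (auto simp: algebra_simps)
  show "fits w (Const 0) s" "eval (Const 0) s = 0" "0 \<le> k" "k \<le> w" "0 < w" using word k by auto
  obtain f B where B: "current n k n f B s" "built n d B f" "\<forall>e\<in>B. e \<inter> {k..<n} \<noteq> {}"
    "feasible {..<k} {n..<n} f" "\<forall>v\<in>{k..<n}. f v = 0 \<and> (\<exists>a<k. {a, v} \<in> B)"
    using s unfolding attached_def by (elim exE conjE)
  note B = B(1,2) B(3)[rule_format] B(4) B(5)[rule_format]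
  show "completing n k d 0 (s\<lparr>regs := (regs s)(2 := 0)\<rparr>)"
    unfolding completing_def
  proof (rule exI[of _ f], rule exI[of _ B], intro conjI)
    show "current n k 0 f B (s\<lparr>regs := (regs s)(2 := 0)\<rparr>)" using B(1) by (simp add: current_def)
    show "\<exists>E. realization {0..<k} E f" using B(4) unfolding feasible_def by (auto simp: lessThan_atLeast0)
  qed (use B(2,3,5) in auto)
  show "fits w (Reg 1) s' \<and> eval (Reg 1) s' = k" if "completing n k d j s'" for j s'
    using that word k unfolding completing_def current_def by auto
  show "runs w Complete_step s'
      (200 * ((n + 1) * (n + 1)))
    (\<lambda>s''. regs s'' 2 = j \<and> completing n k d (Suc j) (s''\<lparr>regs := (regs s'')(2 := Suc j)\<rparr>))"
    if "completing n k d j s'" "j < k" for j s' by (rule runs_complete_step[OF dn w k that])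
  have "(k - 0 + 1) * (8 + 200 * ((n + 1) * (n + 1))) \<le> (n + 1) * (208 * ((n + 1) * (n + 1)))"
    using k by (intro mult_mono) auto
  then show "1 + cost (Const 0) + (k - 0 + 1) * (7 + cost (Reg 1) + 200 * ((n + 1) * (n + 1))) \<le> 300 * ((n + 1) * (n + 1) * (n + 1))"
    by (simp add: algebra_simps)
qed

definition Realize :: com where
  "Realize = Seq Find_size (Seq Attach Complete)"

lemma runs_Realize:
  assumes dn: "\<And>i. i < n \<Longrightarrow> d i \<le> n" and w: "4 * (n + 1) * (n + 1) + 20 \<le> w"
    and r: "realization {..<n} E d" and pos: "\<And>i. i < n \<Longrightarrow> 0 < d i"
    and sorted: "\<And>i j. i \<le> j \<Longrightarrow> j < n \<Longrightarrow> d j \<le> d i"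
    and s: "current n 0 0 d {} s" "regs s 3 = 0"
  shows "runs w Realize s (2300 * ((n + 1) * (n + 1) * (n + 1))) (\<lambda>s'. \<exists>B k. realization {..<n} B d \<and>
    adj_matrix n B (arrs s' 1) \<and> k \<le> n \<and> dominates {..<n} B {..<k} \<and>
    (\<forall>k'\<le>n. feasible {..<k'} {k'..<n} d \<longrightarrow> k \<le> k'))"
  unfolding Realize_def
\<comment> \<open>2300 leaves 600 for the search, 1400 for attaching and 300 for completing.\<close>
proof (rule runs_Seq[OF runs_Find_size[OF dn w r pos sorted s], where Tc = "1700 * ((n + 1) * (n + 1) * (n + 1))"])
  fix s1 assume "\<exists>k\<le>n. current n k 0 d {} s1 \<and> feasible {..<k} {k..<n} d \<and>
    (\<forall>k'\<le>n. feasible {..<k'} {k'..<n} d \<longrightarrow> k \<le> k')"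
  then obtain k where k: "k \<le> n" "current n k 0 d {} s1" "feasible {..<k} {k..<n} d"
    "\<forall>k'\<le>n. feasible {..<k'} {k'..<n} d \<longrightarrow> k \<le> k'" by blast
  show "runs w (Seq Attach Complete) s1 (1700 * ((n + 1) * (n + 1) * (n + 1))) (\<lambda>s'. \<exists>B k. realization {..<n} B d \<and>
    adj_matrix n B (arrs s' 1) \<and> k \<le> n \<and> dominates {..<n} B {..<k} \<and>
    (\<forall>k'\<le>n. feasible {..<k'} {k'..<n} d \<longrightarrow> k \<le> k'))"
  proof (rule runs_Seq[OF runs_Attach[OF dn w k(2,1,3) sorted], where Tc = "300 * ((n + 1) * (n + 1) * (n + 1))"])
    fix s2 assume s2: "attached n k d n s2"
    show "runs w Complete s2 (300 * ((n + 1) * (n + 1) * (n + 1))) (\<lambda>s'. \<exists>B k. realization {..<n} B d \<and>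
      adj_matrix n B (arrs s' 1) \<and> k \<le> n \<and> dominates {..<n} B {..<k} \<and>
      (\<forall>k'\<le>n. feasible {..<k'} {k'..<n} d \<longrightarrow> k \<le> k'))"
    proof (rule runs_conseq[OF runs_Complete[OF dn w k(1) s2]])
      fix s3 assume "completing n k d k s3"
      then obtain f B where B: "current n k k f B s3" "built n d B f" "\<And>v. v \<in> {k..<n} \<union> {..<k} \<Longrightarrow> f v = 0"
        "\<And>v. v \<in> {k..<n} \<Longrightarrow> \<exists>a<k. {a, v} \<in> B" unfolding completing_def by blast
      have "card (nbrs B v) = d v" if "v < n" for v
      proof -
        have "v \<in> {k..<n} \<union> {..<k}" using that by auto
        then have "f v = 0" by (rule B(3))
        then show ?thesis using B(2) that unfolding built_def by (metis add_0)
      qed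
      then have "realization {..<n} B d" using B(2) unfolding realization_def built_def by auto
      moreover have "\<exists>a\<in>{..<k}. {a, v} \<in> B" if "v \<in> {..<n} - {..<k}" for v
        using B(4)[of v] that by auto
      then have "dominates {..<n} B {..<k}" using k(1) unfolding dominates_def by auto
      moreover have "adj_matrix n B (arrs s3 1)" using B(1) unfolding current_def by blast
      ultimately show "\<exists>B k. realization {..<n} B d \<and>
        adj_matrix n B (arrs s3 1) \<and> k \<le> n \<and> dominates {..<n} B {..<k} \<and>
        (\<forall>k'\<le>n. feasible {..<k'} {k'..<n} d \<longrightarrow> k \<le> k')" using k(1,4) by blast
    qed simp_all
  qed simp_all
qed simp_all

section \<open>Translation to the notions of the statement\<close>

lemma realizes_iff: "realizes E d \<longleftrightarrow> realization {..<length d} E (\<lambda>i. d ! i)"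
  unfolding realizes_def realization_def simple_graph_def graph_on_def degree_def nbrs_def by auto

lemma dominating_set_iff: "dominating_set n E D \<longleftrightarrow> dominates {..<n} E D"
  unfolding dominating_set_def dominates_def ..

lemma domination_number_witness:
  obtains D where "dominating_set n E D" "card D = domination_number n E"
proof -
  have "dominating_set n E {..<n}" by (simp add: dominating_set_def)
  then have "card ` {D. dominating_set n E D} \<noteq> {}" by blast
  then have "Inf (card ` {D. dominating_set n E D}) \<in> card ` {D. dominating_set n E D}" by (rule Inf_nat_def1)
  then show ?thesis using that unfolding domination_number_def by auto
qed

lemma MDS_witness:
  assumes "graphic d"
  obtains E D where "realizes E d" "dominating_set (length d) E D" "card D = MDS d"
proof -
  have "domination_number (length d) ` {E. realizes E d} \<noteq> {}" using assms unfolding graphic_def by blast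
  then have "MDS d \<in> domination_number (length d) ` {E. realizes E d}" unfolding MDS_def by (rule Inf_nat_def1)
  then obtain E where E: "realizes E d" "MDS d = domination_number (length d) E" by auto
  obtain D where "dominating_set (length d) E D" "card D = domination_number (length d) E"
    by (rule domination_number_witness)
  then show ?thesis using that E by metis
qed

lemma MDS_le:
  assumes "realizes E d" "dominating_set (length d) E D"
  shows "MDS d \<le> card D"
proof -
  have "MDS d \<le> domination_number (length d) E"
    unfolding MDS_def by (rule cINF_lower) (use assms in auto)
  also have "\<dots> \<le> card D"
    unfolding domination_number_def by (rule cINF_lower) (use assms in auto)
  finally show ?thesis .
qed

theorem theorem3:
  "\<exists>(P :: com) (k :: nat) (T :: nat \<Rightarrow> nat).
     (\<lambda>n. real (T n)) \<in> O(\<lambda>n. real n ^ 3) \<and>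
     (\<forall>d :: nat list. degree_sequence d \<and> graphic d \<longrightarrow>
       (\<exists>t s E.
          exec (max_word k (length d)) P (input_state d) t s \<and>
          t \<le> T (length d) \<and>
          outputs_graph (length d) s E \<and>
          realizes E d \<and>
          (\<exists>D. dominating_set (length d) E D \<and> card D = MDS d)))"
proof (rule exI[of _ Realize], rule exI[of _ 100], rule exI[of _ "\<lambda>n. 2300 * ((n + 1) * (n + 1) * (n + 1))"],
    intro conjI allI impI)
  let ?T = "\<lambda>n::nat. 2300 * ((n + 1) * (n + 1) * (n + 1))"
  show "(\<lambda>n. real (?T n)) \<in> O(\<lambda>n. real n ^ 3)"
  proof (rule bigoI[where c = "2300 * 8"])
    show "eventually (\<lambda>n. norm (real (?T n)) \<le> 2300 * 8 * norm (real n ^ 3)) at_top"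
      using eventually_ge_at_top[of 1]
    proof eventually_elim
      case (elim n)
      \<comment> \<open>\<open>n + 1 \<le> 2 * n\<close> from 1 on, which explains the factor
        8.\<close>
      have "(n + 1) * (n + 1) * (n + 1) \<le> (2 * n) * (2 * n) * (2 * n)" using elim by (intro mult_mono) auto
      then have "?T n \<le> 2300 * 8 * n ^ 3" by (simp add: power3_eq_cube)
      then have "real (?T n) \<le> real (2300 * 8 * n ^ 3)" by (simp only: of_nat_le_iff)
      then show ?case by simp
    qed
  qed
  fix d :: "nat list"
  assume "degree_sequence d \<and> graphic d"
  then have d: "degree_sequence d" and g: "graphic d" by auto
  define n where "n = length d"
  define f where "f = (\<lambda>i. d ! i)"
  obtain E D where E: "realizes E d" "dominating_set (length d) E D" "card D = MDS d" using MDS_witness[OF g] .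
  have r: "realization {..<n} E f" using E(1) unfolding realizes_iff n_def f_def .
  have dn: "f i \<le> n" if "i < n" for i
  proof -
    have "card (nbrs E i) \<le> card {..<n}" using nbrs_subset[OF realization_graph[OF r]] by (intro card_mono) auto
    then show ?thesis using realization_card[OF r, of i] that by simp
  qed
  have pos: "0 < f i" if "i < n" for i using d that unfolding degree_sequence_def n_def f_def by auto
  have sorted: "f j \<le> f i" if "i \<le> j" "j < n" for i j
    using d that unfolding degree_sequence_def n_def f_def sorted_wrt_iff_nth_less by (cases "i = j") auto
  \<comment> \<open>The summand 100 of \<open>max_word 100 n\<close> covers
    \<open>n \<le> 1\<close>, where the power is useless; from 2 on the power alone outgrows
    \<open>16 * n ^ 2\<close>, and 100 exceeds 20.\<close>
  have w: "4 * (n + 1) * (n + 1) + 20 \<le> max_word 100 n"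
  proof -
    consider "n = 0" | "n = 1" | "2 \<le> n" by linarith
    then show ?thesis
    proof cases
      case 3
      have "4 * (n + 1) * (n + 1) \<le> 4 * (2 * n) * (2 * n)" using 3 by (intro mult_mono) auto
      also have "\<dots> = 2 ^ 4 * n ^ 2" by (simp add: power2_eq_square)
      also have "\<dots> \<le> n ^ 98 * n ^ 2"
      proof (rule mult_right_mono)
        have "(2::nat) ^ 4 \<le> 2 ^ 98" by (rule power_increasing) auto
        also have "\<dots> \<le> n ^ 98" using 3 by (intro power_mono) auto
        finally show "2 ^ 4 \<le> n ^ 98" .
      qed simp
      also have "\<dots> = n ^ 100" by (simp flip: power_add)
      finally show ?thesis unfolding max_word_def by simp
    qed (simp_all add: max_word_def)
  qed
  have s: "current n 0 0 f {} (input_state d)" "regs (input_state d) 3 = 0"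
    by (simp_all add: current_def input_state_def n_def f_def adj_matrix_def)
  obtain t s' B k where res: "exec (max_word 100 n) Realize (input_state d) t s'" "t \<le> ?T n"
    "realization {..<n} B f" "adj_matrix n B (arrs s' 1)" "k \<le> n" "dominates {..<n} B {..<k}"
    "\<And>k'. k' \<le> n \<Longrightarrow> feasible {..<k'} {k'..<n} f \<Longrightarrow> k \<le> k'"
    using runs_Realize[OF dn w r pos sorted s] unfolding runs_def by blast
  have B: "realizes B d" using res(3) unfolding realizes_iff n_def f_def .
  have D: "dominating_set n B {..<k}" using res(6) unfolding dominating_set_iff .
  have "dominates {..<n} E D" using E(2) unfolding dominating_set_iff n_def .
  \<comment> \<open>An optimal dominating set of any realization can be moved to the initial segment
    of the same size, so the least feasible \<open>k\<close> is at most \<open>MDS d\<close>; the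
    constructed graph shows the converse.\<close>
  from feasible_initial_segment[OF r this E(3) sorted pos] have "k \<le> MDS d" by (intro res(7)) auto
  moreover have "MDS d \<le> k" using MDS_le[OF B, of "{..<k}"] D unfolding n_def by simp
  ultimately have "card {..<k} = MDS d" by simp
  moreover have "outputs_graph n s' B"
    using res(4) B unfolding outputs_graph_def adj_matrix_def realizes_def n_def by simp
  ultimately show "\<exists>t s E. exec (max_word 100 (length d)) Realize (input_state d) t s \<and> t \<le> ?T (length d) \<and>
    outputs_graph (length d) s E \<and> realizes E d \<and> (\<exists>D. dominating_set (length d) E D \<and> card D = MDS d)"
    using res(1,2) B D unfolding n_def by blast
qed

end
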